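(* There is a polynomial-time algorithm that, given any instance $(G,w,\mathcal{T})$ of the Steiner Multicycle problem with $w\colon E(G)\to\{1,2\}$, outputs a set of vertex-disjoint cycles of $G$ that respects $\mathcal{T}$ and whose cost is at most $\frac{11}{9}\,\mathrm{opt}(G,w,\mathcal{T})$. That is, there is an $\frac{11}{9}$-approximation algorithm for the $\{1,2\}$-Steiner Multicycle problem.
   Context: Steiner Multicycle problem: the input is a complete graph $G$, a weight function $w$ on $E(G)$, and a collection $\mathcal{T}$ of pairwise disjoint subsets of $V(G)$, each of size at least 2 (terminal sets). A cycle is a nonempty connected subgraph all of whose vertices have degree 2; in addition, for each $T\in\mathcal{T}$ with $|T|=2$, the edge joining the two vertices of $T$ is duplicated, so a cycle of length 2 consisting of these two parallel edges (of cost twice the weight of that edge) is allowed. A cycle $C$ respects $\mathcal{T}$ if for every $T\in\mathcal{T}$ either $T\subseteq V(C)$ or $T\cap V(C)=\emptyset$. A set $\mathcal{C}$ of vertex-disjoint cycles respects $\mathcal{T}$ if every cycle in it respects $\mathcal{T}$ and every vertex of every terminal set lies in some cycle of $\mathcal{C}$. The cost $w(\mathcal{C})$ is the total weight of edges over all cycles of $\mathcal{C}$, and $\mathrm{opt}(G,w,\mathcal{T})$ is the minimum cost of such a set. The $\{1,2\}$-Steiner Multicycle problem is the restriction to instances where every edge weight is 1 or 2. *)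

theory Defs
  imports Complex_Main "HOL-Library.Disjoint_Sets" "HOL-Computational_Algebra.Polynomial"
begin

section \<open>The Steiner Multicycle problem\<close>

definition complete_edges :: "'v set \<Rightarrow> 'v set set" where
  "complete_edges V = {e. e \<subseteq> V \<and> card e = 2}"

definition smc_instance :: "'v set \<Rightarrow> 'v set set \<Rightarrow> bool" where
  "smc_instance V \<T> \<longleftrightarrow>
     finite V \<and> disjoint \<T> \<and> (\<forall>T\<in>\<T>. T \<subseteq> V \<and> 2 \<le> card T)"

text \<open>
  Edges of the multigraph carry a tag: \<open>(e, False)\<close> is the edge \<open>e\<close> of the complete graph,
  \<open>(e, True)\<close> is its parallel copy, present exactly when \<open>e\<close> is a terminal set.
\<close>

definition dup_edges :: "'v set \<Rightarrow> 'v set set \<Rightarrow> ('v set \<times> bool) set" where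
  "dup_edges V \<T> = complete_edges V \<times> {False} \<union> {T \<in> \<T>. card T = 2} \<times> {True}"

record 'v mgraph =
  verts :: "'v set"
  edges :: "('v set \<times> bool) set"

definition is_subgraph :: "'v set \<Rightarrow> 'v set set \<Rightarrow> 'v mgraph \<Rightarrow> bool" where
  "is_subgraph V \<T> H \<longleftrightarrow>
     verts H \<subseteq> V \<and> edges H \<subseteq> dup_edges V \<T> \<and> (\<forall>e\<in>edges H. fst e \<subseteq> verts H)"

definition connected_mgraph :: "'v mgraph \<Rightarrow> bool" where
  "connected_mgraph H \<longleftrightarrow>
     (\<forall>u\<in>verts H. \<forall>v\<in>verts H. (u, v) \<in> {(a, b). \<exists>e\<in>edges H. fst e = {a, b}}\<^sup>*)"

definition degree_in :: "'v mgraph \<Rightarrow> 'v \<Rightarrow> nat" where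
  "degree_in H v = card {e \<in> edges H. v \<in> fst e}"

definition is_cycle :: "'v set \<Rightarrow> 'v set set \<Rightarrow> 'v mgraph \<Rightarrow> bool" where
  "is_cycle V \<T> C \<longleftrightarrow>
     is_subgraph V \<T> C \<and> verts C \<noteq> {} \<and> connected_mgraph C \<and>
     (\<forall>v\<in>verts C. degree_in C v = 2)"

definition cycle_respects :: "'v set set \<Rightarrow> 'v mgraph \<Rightarrow> bool" where
  "cycle_respects \<T> C \<longleftrightarrow> (\<forall>T\<in>\<T>. T \<subseteq> verts C \<or> T \<inter> verts C = {})"

definition disjoint_cycles :: "'v set \<Rightarrow> 'v set set \<Rightarrow> 'v mgraph set \<Rightarrow> bool" where
  "disjoint_cycles V \<T> \<C> \<longleftrightarrow>
     (\<forall>C\<in>\<C>. is_cycle V \<T> C) \<and>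
     (\<forall>C\<in>\<C>. \<forall>D\<in>\<C>. C \<noteq> D \<longrightarrow> verts C \<inter> verts D = {})"

definition respects_terminals :: "'v set set \<Rightarrow> 'v mgraph set \<Rightarrow> bool" where
  "respects_terminals \<T> \<C> \<longleftrightarrow>
     (\<forall>C\<in>\<C>. cycle_respects \<T> C) \<and> (\<forall>T\<in>\<T>. \<forall>v\<in>T. \<exists>C\<in>\<C>. v \<in> verts C)"

definition cost :: "('v set \<Rightarrow> nat) \<Rightarrow> 'v mgraph set \<Rightarrow> nat" where
  "cost w \<C> = (\<Sum>C\<in>\<C>. \<Sum>e\<in>edges C. w (fst e))"

definition opt :: "'v set \<Rightarrow> ('v set \<Rightarrow> nat) \<Rightarrow> 'v set set \<Rightarrow> nat" where
  "opt V w \<T> = Min {cost w \<C> |\<C>. disjoint_cycles V \<T> \<C> \<and> respects_terminals \<T> \<C>}"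

lemma finite_solutions:
  assumes "smc_instance V \<T>"
  shows "finite {\<C>. disjoint_cycles V \<T> \<C> \<and> respects_terminals \<T> \<C>}"
proof -
  have V: "finite V" and T: "\<T> \<subseteq> Pow V"
    using assms by (auto simp: smc_instance_def)
  have "dup_edges V \<T> \<subseteq> Pow V \<times> UNIV"
    using T by (auto simp: dup_edges_def complete_edges_def)
  then have E: "finite (dup_edges V \<T>)"
    by (rule finite_subset) (use V in auto)
  let ?G = "(\<lambda>(A, B). \<lparr>verts = A, edges = B\<rparr>) ` (Pow V \<times> Pow (dup_edges V \<T>))"
  have "C \<in> ?G" if "is_cycle V \<T> C" for C
    using that by (intro image_eqI[where x = "(verts C, edges C)"])
      (auto simp: is_cycle_def is_subgraph_def)
  then have "{\<C>. disjoint_cycles V \<T> \<C> \<and> respects_terminals \<T> \<C>} \<subseteq> Pow ?G"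
    by (auto simp: disjoint_cycles_def)
  then show ?thesis
    by (rule finite_subset) (use V E in auto)
qed


section \<open>Polynomial time\<close>

text \<open>
  The machine model is Jones's WHILE language over binary trees (N. D. Jones, Computability
  and Complexity from a Programming Perspective, MIT Press, 1997), with an additional
  conditional. Every elementary operation takes unit time; there is no equality test on trees
  other than the comparison with \<open>Leaf\<close>. The class of problems solved in polynomial time is
  the same as for Turing machines.
\<close>

datatype tree = Leaf | Node tree tree

fun left :: "tree \<Rightarrow> tree" where
  "left Leaf = Leaf"
| "left (Node l r) = l"

fun right :: "tree \<Rightarrow> tree" where
  "right Leaf = Leaf"
| "right (Node l r) = r"

datatype exp = VarE nat | NilE | ConsE exp exp | HdE exp | TlE exp

type_synonym store = "nat \<Rightarrow> tree"

primrec eval_exp :: "exp \<Rightarrow> store \<Rightarrow> tree" where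
  "eval_exp (VarE x) s = s x"
| "eval_exp NilE s = Leaf"
| "eval_exp (ConsE a b) s = Node (eval_exp a s) (eval_exp b s)"
| "eval_exp (HdE a) s = left (eval_exp a s)"
| "eval_exp (TlE a) s = right (eval_exp a s)"

primrec exp_time :: "exp \<Rightarrow> nat" where
  "exp_time (VarE x) = 1"
| "exp_time NilE = 1"
| "exp_time (ConsE a b) = 1 + exp_time a + exp_time b"
| "exp_time (HdE a) = 1 + exp_time a"
| "exp_time (TlE a) = 1 + exp_time a"

datatype com =
    Skip
  | Assign nat exp
  | Seq com com
  | Cond exp com com
  | While exp com

text \<open>\<open>exec c s t s'\<close>: started in store \<open>s\<close>, \<open>c\<close> halts after exactly \<open>t\<close> steps in \<open>s'\<close>.\<close>

inductive exec :: "com \<Rightarrow> store \<Rightarrow> nat \<Rightarrow> store \<Rightarrow> bool" where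
  Skip: "exec Skip s 1 s"
| Assign: "exec (Assign x e) s (1 + exp_time e) (s(x := eval_exp e s))"
| Seq: "exec c s t s' \<Longrightarrow> exec d s' u s'' \<Longrightarrow> exec (Seq c d) s (t + u) s''"
| CondTrue: "eval_exp e s \<noteq> Leaf \<Longrightarrow> exec c s t s' \<Longrightarrow>
    exec (Cond e c d) s (1 + exp_time e + t) s'"
| CondFalse: "eval_exp e s = Leaf \<Longrightarrow> exec d s t s' \<Longrightarrow>
    exec (Cond e c d) s (1 + exp_time e + t) s'"
| WhileTrue: "eval_exp e s \<noteq> Leaf \<Longrightarrow> exec c s t s' \<Longrightarrow> exec (While e c) s' u s'' \<Longrightarrow>
    exec (While e c) s (1 + exp_time e + t + u) s''"
| WhileFalse: "eval_exp e s = Leaf \<Longrightarrow> exec (While e c) s (1 + exp_time e) s"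

inductive_cases exec_SkipE: "exec Skip s t s'"
inductive_cases exec_AssignE: "exec (Assign x e) s t s'"
inductive_cases exec_SeqE: "exec (Seq c d) s t s'"
inductive_cases exec_CondE: "exec (Cond e c d) s t s'"
inductive_cases exec_WhileE: "exec (While e c) s t s'"

lemma exec_deterministic:
  "exec c s t s' \<Longrightarrow> exec c s u s'' \<Longrightarrow> t = u \<and> s' = s''"
proof (induction arbitrary: u s'' rule: exec.induct)
  case (Skip s)
  then show ?case by (auto elim: exec_SkipE)
next
  case (Assign x e s)
  then show ?case by (auto elim: exec_AssignE)
next
  case (Seq c s t s1 d t' s2)
  from Seq.prems obtain a b r where "exec c s a r" "exec d r b s''" "u = a + b"
    by (rule exec_SeqE)
  with Seq.IH(1)[of a r] Seq.IH(2)[of b s''] show ?case by simp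
next
  case (CondTrue e s c t s1 d)
  from CondTrue.prems CondTrue.hyps obtain a where "exec c s a s''" "u = 1 + exp_time e + a"
    by (auto elim: exec_CondE)
  with CondTrue.IH[of a s''] show ?case by simp
next
  case (CondFalse e s d t s1 c)
  from CondFalse.prems CondFalse.hyps obtain a where "exec d s a s''" "u = 1 + exp_time e + a"
    by (auto elim: exec_CondE)
  with CondFalse.IH[of a s''] show ?case by simp
next
  case (WhileTrue e s c t s1 t' s2)
  from WhileTrue.prems WhileTrue.hyps(1) obtain a b r
    where "exec c s a r" "exec (While e c) r b s''" "u = 1 + exp_time e + a + b"
    by (auto elim: exec_WhileE)
  with WhileTrue.IH(1)[of a r] WhileTrue.IH(2)[of b s''] show ?case by simp
next
  case (WhileFalse e s c)
  then show ?case by (auto elim: exec_WhileE)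
qed

text \<open>Input and output are passed in variable \<open>0\<close>; all other variables are initially \<open>Leaf\<close>.\<close>

definition outputs_within :: "com \<Rightarrow> tree \<Rightarrow> nat \<Rightarrow> tree \<Rightarrow> bool" where
  "outputs_within P x b y \<longleftrightarrow>
     (\<exists>t s. exec P ((\<lambda>_. Leaf)(0 := x)) t s \<and> t \<le> b \<and> s 0 = y)"


section \<open>Input and output format\<close>

primrec enc_list :: "('a \<Rightarrow> tree) \<Rightarrow> 'a list \<Rightarrow> tree" where
  "enc_list f [] = Leaf"
| "enc_list f (x # xs) = Node (f x) (enc_list f xs)"

text \<open>
  Unary numerals suffice: the only numbers occurring are vertex names below the number \<open>n\<close> of
  vertices, of which the weight matrix makes every input at least quadratic, and weights.
\<close>

definition enc_nat :: "nat \<Rightarrow> tree" where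
  "enc_nat n = enc_list (\<lambda>_. Leaf) [0..<n]"

definition enc_bool :: "bool \<Rightarrow> tree" where
  "enc_bool b = (if b then Node Leaf Leaf else Leaf)"

definition enc_matrix :: "nat \<Rightarrow> (nat set \<Rightarrow> nat) \<Rightarrow> tree" where
  "enc_matrix n w =
     enc_list (\<lambda>i. enc_list (\<lambda>j. enc_nat (if i = j then 0 else w {i, j})) [0..<n]) [0..<n]"

text \<open>The terminal sets may be listed in any order, and so may the elements of each of them.\<close>

definition lists_terminals :: "nat list list \<Rightarrow> nat set set \<Rightarrow> bool" where
  "lists_terminals Ts \<T> \<longleftrightarrow>
     distinct (map set Ts) \<and> (\<forall>T\<in>set Ts. distinct T) \<and> set (map set Ts) = \<T>"

definition enc_instance :: "nat \<Rightarrow> (nat set \<Rightarrow> nat) \<Rightarrow> nat list list \<Rightarrow> tree" where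
  "enc_instance n w Ts = Node (enc_matrix n w) (enc_list (enc_list enc_nat) Ts)"

type_synonym edge_code = "nat \<times> nat \<times> bool"

definition edge_of :: "edge_code \<Rightarrow> nat set \<times> bool" where
  "edge_of = (\<lambda>(u, v, b). ({u, v}, b))"

definition enc_edge :: "edge_code \<Rightarrow> tree" where
  "enc_edge = (\<lambda>(u, v, b). Node (enc_nat u) (Node (enc_nat v) (enc_bool b)))"

type_synonym cycle_code = "nat list \<times> edge_code list"

definition cycle_of :: "cycle_code \<Rightarrow> nat mgraph" where
  "cycle_of = (\<lambda>(vs, es). \<lparr>verts = set vs, edges = set (map edge_of es)\<rparr>)"

definition enc_cycle :: "cycle_code \<Rightarrow> tree" where
  "enc_cycle = (\<lambda>(vs, es). Node (enc_list enc_nat vs) (enc_list enc_edge es))"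

text \<open>
  The lists are free of repetitions, so the representation of a set of vertex-disjoint cycles
  has size polynomial in the number of vertices.
\<close>

definition represents_cycles :: "tree \<Rightarrow> nat mgraph set \<Rightarrow> bool" where
  "represents_cycles y \<C> \<longleftrightarrow>
     (\<exists>Cs. y = enc_list enc_cycle Cs \<and>
        distinct (map cycle_of Cs) \<and> set (map cycle_of Cs) = \<C> \<and>
        (\<forall>(vs, es)\<in>set Cs. distinct vs \<and> distinct (map edge_of es)))"

end

theory Submission
  imports Defs "HOL-Library.Multiset" "HOL-Library.Product_Plus"
begin

text \<open>
  Let \<open>t\<close> be the number of terminals and call an edge of weight 1 light. A family of disjoint
  light paths and light cycles that covers the terminals and whose cycles respect the terminal
  sets yields a solution of cost at most \<open>t + p\<close>, where \<open>p\<close> is the number of paths: keep the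
  cycles and join all paths to one further cycle. Such a family is improved by local search. The
  moves reverse, split, join, close and reopen paths and cycles; a family is replaced by one of
  smaller potential that is reachable by 100 moves. The potential counts, in order of priority,
  the paths, the cycles and, with weights, the paths with one or two vertices.

  The light edges between terminals in an optimal solution give two slots to every terminal,
  except for \<open>d \<le> 2 (opt - t)\<close> missing ones. In a local optimum the slots at the ends of paths are
  charged to path edges: an edge from an end to an inner vertex \<open>x\<close> of another path is charged to
  a path edge at \<open>x\<close>, and two charges to the same edge would allow an improvement. Since there are
  at most \<open>t - p\<close> path edges, \<open>5 p \<le> t + d + 2 p\<^sub>1 + p\<^sub>2\<close>, where \<open>p\<^sub>1\<close> counts one-vertex paths and
  \<open>p\<^sub>2\<close> counts two-vertex paths whose edge is used by the optimal solution. One-vertex paths are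
  adjacent only to centres of three-vertex paths, and so are then the ends of the latter;
  two-vertex paths are adjacent only to paths with three to five vertices. Counting these
  adjacencies gives \<open>8 p\<^sub>1 + 4 p\<^sub>2 \<le> 2 p + 3 d\<close>. Hence \<open>18 p \<le> 4 t + 7 d\<close>, that is, \<open>9 (t + p) \<le>
  11 opt\<close>.
\<close>

section \<open>Polynomial-time WHILE programs\<close>

lemma poly_mono_nat: "m \<le> n \<Longrightarrow> poly p m \<le> poly p n" for p :: "nat poly"
  by (induction p) (auto intro!: add_mono mult_mono)

definition runs_within :: "com \<Rightarrow> store \<Rightarrow> nat \<Rightarrow> store \<Rightarrow> bool" where
  "runs_within P s b s' \<longleftrightarrow> (\<exists>t\<le>b. exec P s t s')"

lemma runs_within_mono: "runs_within P s a s' \<Longrightarrow> a \<le> b \<Longrightarrow> runs_within P s b s'"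
  unfolding runs_within_def by (meson order_trans)

lemma runs_within_Assign:
  "1 + exp_time e \<le> b \<Longrightarrow> s' = s(x := eval_exp e s) \<Longrightarrow> runs_within (Assign x e) s b s'"
  unfolding runs_within_def using exec.Assign by blast

lemma runs_within_Seq:
  "runs_within P s a s1 \<Longrightarrow> runs_within Q s1 b s2 \<Longrightarrow> runs_within (Seq P Q) s (a + b) s2"
  unfolding runs_within_def by (meson add_mono exec.Seq)

lemma runs_within_CondTrue:
  "eval_exp e s \<noteq> Leaf \<Longrightarrow> runs_within P s b s' \<Longrightarrow>
    runs_within (Cond e P Q) s (1 + exp_time e + b) s'"
  unfolding runs_within_def by (meson add_left_mono exec.CondTrue)

lemma runs_within_CondFalse:
  "eval_exp e s = Leaf \<Longrightarrow> runs_within Q s b s' \<Longrightarrow>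
    runs_within (Cond e P Q) s (1 + exp_time e + b) s'"
  unfolding runs_within_def by (meson add_left_mono exec.CondFalse)

lemma runs_within_WhileTrue:
  "eval_exp e s \<noteq> Leaf \<Longrightarrow> runs_within P s a s1 \<Longrightarrow> runs_within (While e P) s1 b s2 \<Longrightarrow>
    runs_within (While e P) s (1 + exp_time e + a + b) s2"
  unfolding runs_within_def by (meson add_left_mono add_mono exec.WhileTrue)

lemma runs_within_WhileFalse:
  "eval_exp e s = Leaf \<Longrightarrow> runs_within (While e P) s (1 + exp_time e) s"
  unfolding runs_within_def using exec.WhileFalse by blast

definition clean :: "nat \<Rightarrow> store \<Rightarrow> bool" where
  "clean N s \<longleftrightarrow> (\<forall>i. 0 < i \<longrightarrow> i < N \<longrightarrow> s i = Leaf)"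

lemma clean_mono: "clean N s \<Longrightarrow> M \<le> N \<Longrightarrow> clean M s"
  by (auto simp: clean_def)

lemma clean_fun_upd: "clean N s \<Longrightarrow> i = 0 \<or> N \<le> i \<Longrightarrow> clean N (s(i := v))"
  by (auto simp: clean_def)

text \<open>The size of the result is bounded separately, since a tree may have exponentially more nodes
  than steps were used to build it. Programs restore all variables but \<open>0\<close>, which makes them
  composable.\<close>

definition computes ::
    "com \<Rightarrow> nat \<Rightarrow> nat poly \<Rightarrow> ('a \<Rightarrow> tree) \<Rightarrow> ('b \<Rightarrow> tree) \<Rightarrow> ('a \<Rightarrow> 'b) \<Rightarrow> bool" where
  "computes P N p ea eb f \<longleftrightarrow>
     (\<forall>x s. s 0 = ea x \<longrightarrow> clean N s \<longrightarrow>
       runs_within P s (poly p (size (ea x))) (s(0 := eb (f x)))) \<and>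
     (\<forall>x. size (eb (f x)) \<le> poly p (size (ea x)))"

definition polytime :: "('a \<Rightarrow> tree) \<Rightarrow> ('b \<Rightarrow> tree) \<Rightarrow> ('a \<Rightarrow> 'b) \<Rightarrow> bool" where
  "polytime ea eb f \<longleftrightarrow> (\<exists>P N p. computes P N p ea eb f)"

named_theorems polytime_intros

lemma computes_runs_within:
  "computes P N p ea eb f \<Longrightarrow> s 0 = ea x \<Longrightarrow> clean N s \<Longrightarrow>
    runs_within P s (poly p (size (ea x))) (s(0 := eb (f x)))"
  by (simp add: computes_def)

lemma computes_size: "computes P N p ea eb f \<Longrightarrow> size (eb (f x)) \<le> poly p (size (ea x))"
  by (simp add: computes_def)

lemma polytimeI:
  assumes time: "\<And>x s. s 0 = ea x \<Longrightarrow> clean N s \<Longrightarrow>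
      runs_within P s (poly p (size (ea x))) (s(0 := eb (f x)))"
    and size: "\<And>x. size (eb (f x)) \<le> poly q (size (ea x))"
  shows "polytime ea eb f"
proof -
  have "computes P N (p + q) ea eb f"
    unfolding computes_def using runs_within_mono[OF time] size
    by (auto intro: order_trans[OF size])
  then show ?thesis unfolding polytime_def by blast
qed

lemma polytimeE:
  assumes "polytime ea eb f"
  obtains P N p where "computes P N p ea eb f"
  using assms by (auto simp: polytime_def)

lemma polytime_size_bound:
  assumes "polytime ea eb f"
  obtains p where "\<And>x. size (eb (f x)) \<le> poly p (size (ea x))"
proof -
  from assms obtain P N p where "computes P N p ea eb f" by (rule polytimeE)
  then show ?thesis by (intro that computes_size)
qed

lemma polytime_outputs_within:
  assumes "polytime ea eb f"
  obtains P p where "\<And>x. outputs_within P (ea x) (poly p (size (ea x))) (eb (f x))"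
proof -
  from assms obtain P N p where P: "computes P N p ea eb f" by (rule polytimeE)
  have "outputs_within P (ea x) (poly p (size (ea x))) (eb (f x))" for x
    using computes_runs_within[OF P, of "(\<lambda>_. Leaf)(0 := ea x)" x]
    unfolding runs_within_def outputs_within_def by (fastforce simp: clean_def)
  then show ?thesis by (rule that)
qed

lemma polytime_cong_enc: "polytime ea eb f \<Longrightarrow> (\<And>x. eb (f x) = ec (g x)) \<Longrightarrow> polytime ea ec g"
  unfolding polytime_def computes_def by simp

lemma polytime_exp:
  assumes "\<And>x s. s 0 = ea x \<Longrightarrow> eval_exp e s = eb (f x)"
    and "\<And>x. size (eb (f x)) \<le> poly p (size (ea x))"
  shows "polytime ea eb f"
proof (rule polytimeI[where P = "Assign 0 e" and N = 0 and p = "[:1 + exp_time e:]"])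
  fix x and s :: store assume "s 0 = ea x"
  with assms(1) show "runs_within (Assign 0 e) s (poly [:1 + exp_time e:] (size (ea x)))
      (s(0 := eb (f x)))"
    by (intro runs_within_Assign) auto
qed (rule assms(2))

lemma polytime_id [polytime_intros]: "polytime ea ea (\<lambda>x. x)"
  by (rule polytime_exp[where e = "VarE 0" and p = "[:0, 1:]"]) auto

primrec const_exp :: "tree \<Rightarrow> exp" where
  "const_exp Leaf = NilE"
| "const_exp (Node l r) = ConsE (const_exp l) (const_exp r)"

lemma eval_const_exp: "eval_exp (const_exp t) s = t"
  by (induction t) auto

lemma polytime_const [polytime_intros]: "polytime ea eb (\<lambda>x. c)"
  by (rule polytime_exp[where e = "const_exp (eb c)" and p = "[:size (eb c):]"])
    (auto simp: eval_const_exp)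

lemma polytime_comp:
  assumes "polytime ea eb f" "polytime eb ec g"
  shows "polytime ea ec (\<lambda>x. g (f x))"
proof -
  from assms obtain P N p Q M q where P: "computes P N p ea eb f" and Q: "computes Q M q eb ec g"
    by (blast elim: polytimeE)
  have q_le: "poly q (size (eb (f x))) \<le> poly (pcompose q p) (size (ea x))" for x
    unfolding poly_pcompose by (rule poly_mono_nat[OF computes_size[OF P]])
  show ?thesis
  proof (rule polytimeI[where P = "Seq P Q" and N = "max N M" and p = "p + pcompose q p" and
        q = "pcompose q p"])
    fix x and s :: store assume s: "s 0 = ea x" "clean (max N M) s"
    let ?s = "s(0 := eb (f x))"
    have "runs_within P s (poly p (size (ea x))) ?s"
      using P s clean_mono[OF s(2)] by (intro computes_runs_within) auto
    moreover have "runs_within Q ?s (poly q (size (eb (f x)))) (?s(0 := ec (g (f x))))"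
      using Q clean_mono[OF s(2), of M] by (intro computes_runs_within clean_fun_upd) auto
    then have "runs_within Q ?s (poly (pcompose q p) (size (ea x))) (s(0 := ec (g (f x))))"
      using runs_within_mono[OF _ q_le] by auto
    ultimately show "runs_within (Seq P Q) s (poly (p + pcompose q p) (size (ea x)))
        (s(0 := ec (g (f x))))"
      unfolding poly_add by (rule runs_within_Seq)
  next
    show "size (ec (g (f x))) \<le> poly (pcompose q p) (size (ea x))" for x
      using computes_size[OF Q] q_le by (rule order_trans)
  qed
qed

definition enc_pair :: "('a \<Rightarrow> tree) \<Rightarrow> ('b \<Rightarrow> tree) \<Rightarrow> 'a \<times> 'b \<Rightarrow> tree" where
  "enc_pair ea eb = (\<lambda>(x, y). Node (ea x) (eb y))"

lemma enc_pair_Pair [simp]: "enc_pair ea eb (x, y) = Node (ea x) (eb y)"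
  by (simp add: enc_pair_def)

lemma enc_pair_conv: "enc_pair ea eb p = Node (ea (fst p)) (eb (snd p))"
  by (cases p) simp

lemma polytime_fst [polytime_intros]:
  assumes "polytime ea (enc_pair eb ec) f"
  shows "polytime ea eb (\<lambda>x. fst (f x))"
proof -
  have "polytime (enc_pair eb ec) eb fst"
    by (rule polytime_exp[where e = "HdE (VarE 0)" and p = "[:0, 1:]"]) (auto simp: enc_pair_conv)
  with assms show ?thesis by (rule polytime_comp)
qed

lemma polytime_snd [polytime_intros]:
  assumes "polytime ea (enc_pair eb ec) f"
  shows "polytime ea ec (\<lambda>x. snd (f x))"
proof -
  have "polytime (enc_pair eb ec) ec snd"
    by (rule polytime_exp[where e = "TlE (VarE 0)" and p = "[:0, 1:]"]) (auto simp: enc_pair_conv)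
  with assms show ?thesis by (rule polytime_comp)
qed

definition apfst_com :: "nat \<Rightarrow> com \<Rightarrow> com" where
  "apfst_com K P = Seq (Assign K (TlE (VarE 0))) (Seq (Assign 0 (HdE (VarE 0)))
     (Seq P (Seq (Assign 0 (ConsE (VarE 0) (VarE K))) (Assign K NilE))))"

lemma runs_within_apfst_com:
  assumes P: "\<And>s. s 0 = t \<Longrightarrow> clean K s \<Longrightarrow> runs_within P s b (s(0 := t'))"
    and "0 < K" "s 0 = Node t r" "clean (Suc K) s"
  shows "runs_within (apfst_com K P) s (b + 12) (s(0 := Node t' r))"
proof -
  have "runs_within (Assign K (TlE (VarE 0))) s 3 (s(K := r))"
    using assms(3) by (intro runs_within_Assign) auto
  moreover have "runs_within (Assign 0 (HdE (VarE 0))) (s(K := r)) 3 (s(0 := t, K := r))"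
    using assms(2,3) by (intro runs_within_Assign) (auto simp: fun_eq_iff)
  moreover have "runs_within P (s(0 := t, K := r)) b (s(0 := t', K := r))"
  proof -
    have "clean K (s(0 := t, K := r))"
      using assms(4) by (auto intro!: clean_fun_upd elim: clean_mono)
    from P[OF _ this] show ?thesis using assms(2) by (simp add: fun_upd_twist)
  qed
  moreover have "runs_within (Assign 0 (ConsE (VarE 0) (VarE K))) (s(0 := t', K := r)) 4
      (s(0 := Node t' r, K := r))"
    using assms(2) by (intro runs_within_Assign) (auto simp: fun_eq_iff)
  moreover have "s K = Leaf" using assms(2,4) by (simp add: clean_def)
  then have "runs_within (Assign K NilE) (s(0 := Node t' r, K := r)) 2 (s(0 := Node t' r))"
    using assms(2) by (intro runs_within_Assign) (auto simp: fun_eq_iff)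
  ultimately have "runs_within (apfst_com K P) s (3 + (3 + (b + (4 + 2)))) (s(0 := Node t' r))"
    unfolding apfst_com_def by (intro runs_within_Seq)
  then show ?thesis by (rule runs_within_mono) simp
qed

lemma polytime_apfst:
  assumes "polytime ea eb f"
  shows "polytime (enc_pair ea ec) (enc_pair eb ec) (apfst f)"
proof -
  from assms obtain P N p where P: "computes P N p ea eb f" by (rule polytimeE)
  have p_le: "poly p (size (ea (fst z))) \<le> poly p (size (enc_pair ea ec z))" for z
    by (rule poly_mono_nat) (simp add: enc_pair_conv)
  show ?thesis
  proof (rule polytimeI[where P = "apfst_com (Suc N) P" and N = "Suc (Suc N)" and
        p = "p + [:12:]" and q = "p + [:1, 1:]"])
    fix z and s :: store assume s: "s 0 = enc_pair ea ec z" "clean (Suc (Suc N)) s"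
    have "runs_within (apfst_com (Suc N) P) s (poly p (size (ea (fst z))) + 12)
        (s(0 := Node (eb (f (fst z))) (ec (snd z))))"
      using s by (intro runs_within_apfst_com computes_runs_within[OF P])
        (auto simp: enc_pair_conv elim: clean_mono)
    then show "runs_within (apfst_com (Suc N) P) s (poly (p + [:12:]) (size (enc_pair ea ec z)))
        (s(0 := enc_pair eb ec (apfst f z)))"
      using p_le[of z] by (auto simp: enc_pair_conv elim: runs_within_mono)
  next
    show "size (enc_pair eb ec (apfst f z)) \<le> poly (p + [:1, 1:]) (size (enc_pair ea ec z))" for z
      using computes_size[OF P, of "fst z"] p_le[of z] by (simp add: enc_pair_conv)
  qed
qed

lemma polytime_Pair [polytime_intros]:
  assumes "polytime ea eb f" "polytime ea ec g"
  shows "polytime ea (enc_pair eb ec) (\<lambda>x. (f x, g x))"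
proof -
  have dup: "polytime ea (enc_pair ea ea) (\<lambda>x. (x, x))"
    by (rule polytime_exp[where e = "ConsE (VarE 0) (VarE 0)" and p = "[:1, 2:]"]) auto
  have swap: "polytime (enc_pair e1 e2) (enc_pair e2 e1) prod.swap" for e1 e2
    by (rule polytime_exp[where e = "ConsE (TlE (VarE 0)) (HdE (VarE 0))" and p = "[:0, 1:]"])
      (auto simp: enc_pair_conv)
  from dup have "polytime ea (enc_pair eb ea) (\<lambda>x. apfst f (x, x))"
    by (rule polytime_comp[OF _ polytime_apfst[OF assms(1)]])
  then have "polytime ea (enc_pair ea eb) (\<lambda>x. prod.swap (apfst f (x, x)))"
    by (rule polytime_comp[OF _ swap])
  then have "polytime ea (enc_pair ec eb) (\<lambda>x. apfst g (prod.swap (apfst f (x, x))))"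
    by (rule polytime_comp[OF _ polytime_apfst[OF assms(2)]])
  from polytime_comp[OF this swap] show ?thesis by simp
qed

lemma polytime_comp2:
  assumes "polytime (enc_pair e1 e2) ec (\<lambda>p. F (fst p) (snd p))"
    and "polytime ea e1 f" "polytime ea e2 g"
  shows "polytime ea ec (\<lambda>x. F (f x) (g x))"
  using polytime_comp[OF polytime_Pair[OF assms(2,3)] assms(1)] by simp

lemma polytime_comp3:
  assumes "polytime (enc_pair e1 (enc_pair e2 e3)) ec (\<lambda>p. F (fst p) (fst (snd p)) (snd (snd p)))"
    and "polytime ea e1 f" "polytime ea e2 g" "polytime ea e3 h"
  shows "polytime ea ec (\<lambda>x. F (f x) (g x) (h x))"
  using polytime_comp[OF polytime_Pair[OF assms(2) polytime_Pair[OF assms(3,4)]] assms(1)] by simp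

lemma polytime_uncons:
  "polytime (\<lambda>(y, ys, x). enc_pair (enc_list eb) ea (y # ys, x))
    (enc_pair eb (enc_pair (enc_list eb) ea)) (\<lambda>p. p)"
  by (rule polytime_exp[where p = "[:0, 1:]" and
        e = "ConsE (HdE (HdE (VarE 0))) (ConsE (TlE (HdE (VarE 0))) (TlE (VarE 0)))"]) auto

lemma polytime_case_list_pair:
  assumes "polytime ea ec f" "polytime (enc_pair eb (enc_pair (enc_list eb) ea)) ec g"
  shows "polytime (enc_pair (enc_list eb) ea) ec
    (\<lambda>p. case fst p of [] \<Rightarrow> f (snd p) | y # ys \<Rightarrow> g (y, ys, snd p))"
proof -
  let ?e = "enc_pair (enc_list eb) ea"
  define e_Cons where "e_Cons = (\<lambda>(y, ys, x). ?e (y # ys, x))"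
  obtain Q M q where Q: "computes Q M q e_Cons ec g"
    using polytime_comp[OF polytime_uncons assms(2)] unfolding e_Cons_def by (rule polytimeE)
  have "polytime ?e ec (\<lambda>p. f (snd p))"
    by (rule polytime_comp[OF polytime_snd[OF polytime_id] assms(1)])
  then obtain P N p where P: "computes P N p ?e ec (\<lambda>p. f (snd p))" by (rule polytimeE)
  show ?thesis
  proof (rule polytimeI[where P = "Cond (HdE (VarE 0)) Q P" and N = "max N M" and
        p = "p + q + [:3:]" and q = "p + q"])
    fix z and s :: store assume s: "s 0 = ?e z" "clean (max N M) s"
    have clean: "clean N s" "clean M s" using clean_mono[OF s(2)] by auto
    obtain l x where z: "z = (l, x)" by (cases z)
    show "runs_within (Cond (HdE (VarE 0)) Q P) s (poly (p + q + [:3:]) (size (?e z)))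
      (s(0 := ec (case fst z of [] \<Rightarrow> f (snd z) | y # ys \<Rightarrow> g (y, ys, snd z))))"
    proof (cases l)
      case Nil
      from computes_runs_within[OF P s(1) clean(1)] have
        "runs_within (Cond (HdE (VarE 0)) Q P) s
          (1 + exp_time (HdE (VarE 0)) + poly p (size (?e z))) (s(0 := ec (f x)))"
        by (intro runs_within_CondFalse) (use s z Nil in auto)
      with Nil show ?thesis by (auto simp: z elim: runs_within_mono)
    next
      case (Cons y ys)
      have "s 0 = e_Cons (y, ys, x)" using s z Cons by (simp add: e_Cons_def)
      from computes_runs_within[OF Q this clean(2)] have
        "runs_within (Cond (HdE (VarE 0)) Q P) s
          (1 + exp_time (HdE (VarE 0)) + poly q (size (e_Cons (y, ys, x))))
          (s(0 := ec (g (y, ys, x))))"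
        by (intro runs_within_CondTrue) (use s z Cons in auto)
      with Cons show ?thesis by (auto simp: z e_Cons_def elim: runs_within_mono)
    qed
  next
    show "size (ec (case fst z of [] \<Rightarrow> f (snd z) | y # ys \<Rightarrow> g (y, ys, snd z)))
      \<le> poly (p + q) (size (?e z))" for z
      using computes_size[OF P, of z] computes_size[OF Q, of "(hd (fst z), tl (fst z), snd z)"]
      by (cases z) (auto simp: e_Cons_def split: list.split)
  qed
qed

lemma polytime_case_list [polytime_intros]:
  assumes "polytime ea (enc_list eb) l" "polytime ea ec f"
    "polytime (enc_pair eb (enc_pair (enc_list eb) ea)) ec
      (\<lambda>p. g (snd (snd p)) (fst p) (fst (snd p)))"
  shows "polytime ea ec (\<lambda>x. case l x of [] \<Rightarrow> f x | y # ys \<Rightarrow> g x y ys)"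
  using polytime_comp[OF polytime_Pair[OF assms(1) polytime_id]
    polytime_case_list_pair[OF assms(2,3)]]
  unfolding fst_conv snd_conv .

lemma polytime_If [polytime_intros]:
  assumes "polytime ea enc_bool b" "polytime ea ec f" "polytime ea ec g"
  shows "polytime ea ec (\<lambda>x. if b x then f x else g x)"
proof -
  have "polytime ea (enc_list (\<lambda>_. Leaf)) (\<lambda>x. if b x then [()] else [])"
    using assms(1) by (rule polytime_cong_enc) (simp add: enc_bool_def)
  moreover have "polytime (enc_pair (\<lambda>_. Leaf) (enc_pair (enc_list (\<lambda>_. Leaf)) ea)) ec
      (\<lambda>p. f (snd (snd p)))"
    by (rule polytime_comp[OF _ assms(2)]) (rule polytime_intros)+
  ultimately have "polytime ea ec
      (\<lambda>x. case if b x then [()] else [] of [] \<Rightarrow> g x | _ # _ \<Rightarrow> f x)"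
    by (intro polytime_case_list[OF _ assms(3)])
  moreover have "(case if c then [()] else [] of [] \<Rightarrow> v | _ # _ \<Rightarrow> u) = (if c then u else v)"
    for c and u v :: 'b by simp
  ultimately show ?thesis by simp
qed

section \<open>Polynomial-time list functions\<close>

lemma length_le_size_enc_list: "length xs \<le> size (enc_list e xs)"
  by (induction xs) auto

lemma size_enc_list_append:
  "size (enc_list e (xs @ ys)) = size (enc_list e xs) + size (enc_list e ys)"
  by (induction xs) auto

lemma size_enc_list_mset: "size (enc_list e xs) = (\<Sum>x\<in>#mset xs. size (e x) + 1)"
  by (induction xs) auto

lemma size_enc_list_rev: "size (enc_list e (rev xs)) = size (enc_list e xs)"
  by (simp add: size_enc_list_mset)

lemma size_le_size_enc_list: "y \<in> set ys \<Longrightarrow> size (e y) \<le> size (enc_list e ys)"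
  by (induction ys) auto

lemma size_enc_list_le:
  "(\<And>y. y \<in> set ys \<Longrightarrow> size (e y) \<le> c) \<Longrightarrow> size (enc_list e ys) \<le> length ys * (c + 1)"
proof (induction ys)
  case (Cons y ys)
  have "size (e y) \<le> c" using Cons.prems[of y] by simp
  moreover have "size (enc_list e ys) \<le> length ys * (c + 1)" using Cons by simp
  ultimately show ?case by simp
qed simp

lemma size_enc_list_concat: "size (enc_list e (concat xss)) \<le> size (enc_list (enc_list e) xss)"
  by (induction xss) (auto simp: size_enc_list_append)

lemma enc_list_map: "enc_list e (map f xs) = enc_list (\<lambda>x. e (f x)) xs"
  by (induction xs) auto

lemma polytime_Cons [polytime_intros]:
  "polytime ea eb f \<Longrightarrow> polytime ea (enc_list eb) g \<Longrightarrow> polytime ea (enc_list eb) (\<lambda>x. f x # g x)"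
  by (rule polytime_cong_enc[OF polytime_Pair[of ea eb f "enc_list eb" g]]) auto

lemma polytime_tl [polytime_intros]:
  assumes "polytime ea (enc_list eb) f"
  shows "polytime ea (enc_list eb) (\<lambda>x. tl (f x))"
proof -
  have "polytime ea (enc_list eb) (\<lambda>x. case f x of [] \<Rightarrow> [] | y # ys \<Rightarrow> ys)"
    by (rule polytime_intros assms)+
  moreover have "(case ys of [] \<Rightarrow> [] | y # ys' \<Rightarrow> ys') = tl ys" for ys :: "'b list"
    by (cases ys) auto
  ultimately show ?thesis by simp
qed

lemma polytime_eq_Nil [polytime_intros]:
  assumes "polytime ea (enc_list eb) f"
  shows "polytime ea enc_bool (\<lambda>x. f x = [])"
proof -
  have "polytime ea enc_bool (\<lambda>x. case f x of [] \<Rightarrow> True | _ # _ \<Rightarrow> False)"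
    by (rule polytime_intros assms)+
  then show ?thesis by (rule polytime_cong_enc) (auto split: list.splits)
qed

text \<open>The bounds \<open>K\<close> and \<open>B\<close> in the lemmas on \<open>fold\<close> prevent iterated steps from squaring the size of
  the accumulator again and again.\<close>

lemma runs_within_fold_loop:
  fixes ea :: "'a \<Rightarrow> tree" and eb :: "'b \<Rightarrow> tree" and ec :: "'c \<Rightarrow> tree"
  defines "es \<equiv> enc_pair (enc_list eb) (enc_pair ec ea)"
  assumes step: "computes P N p es es
      (\<lambda>z. case fst z of [] \<Rightarrow> z | y # ys \<Rightarrow> (ys, h (snd (snd z)) y (fst (snd z)), snd (snd z)))"
    and "s 0 = es (ys, r, x)" "clean N s"
    and "\<And>us vs. ys = us @ vs \<Longrightarrow> size (es (vs, fold (h x) us r, x)) \<le> K"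
  shows "runs_within (While (HdE (VarE 0)) P) s (length ys * (poly p K + 3) + 3)
    (s(0 := es ([], fold (h x) ys r, x)))"
  using assms(3-5)
proof (induction ys arbitrary: s r)
  case Nil
  then have "s(0 := es ([], fold (h x) [] r, x)) = s" by (auto simp: fun_eq_iff)
  with Nil show ?case
    using runs_within_WhileFalse[of "HdE (VarE 0)" s P] by (simp add: es_def numeral_3_eq_3)
next
  case (Cons y ys)
  let ?s = "s(0 := es (ys, h x y r, x))"
  have "runs_within P s (poly p (size (es (y # ys, r, x)))) ?s"
    using computes_runs_within[OF step Cons.prems(1,2)] by simp
  then have "runs_within P s (poly p K) ?s"
    by (rule runs_within_mono) (use Cons.prems(3)[of "[]"] in \<open>auto intro: poly_mono_nat\<close>)
  moreover have "runs_within (While (HdE (VarE 0)) P) ?s (length ys * (poly p K + 3) + 3)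
      (?s(0 := es ([], fold (h x) ys (h x y r), x)))"
  proof (rule Cons.IH)
    show "size (es (vs, fold (h x) us (h x y r), x)) \<le> K" if "ys = us @ vs" for us vs
      using Cons.prems(3)[of "y # us"] that by simp
    show "clean N ?s" using Cons.prems(2) by (rule clean_fun_upd) simp
  qed simp
  moreover have "eval_exp (HdE (VarE 0)) s \<noteq> Leaf" using Cons.prems(1) by (simp add: es_def)
  ultimately have "runs_within (While (HdE (VarE 0)) P) s
      (1 + exp_time (HdE (VarE 0)) + poly p K + (length ys * (poly p K + 3) + 3))
      (?s(0 := es ([], fold (h x) ys (h x y r), x)))"
    by (intro runs_within_WhileTrue)
  then show ?case unfolding fun_upd_upd fold_simps by (rule runs_within_mono) simp
qed

lemma polytime_fold_loop:
  fixes ea :: "'a \<Rightarrow> tree" and eb :: "'b \<Rightarrow> tree" and ec :: "'c \<Rightarrow> tree"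
  defines "es \<equiv> enc_pair (enc_list eb) (enc_pair ec ea)"
  assumes init: "polytime ea es (\<lambda>x. (l x, i x, x))" and step: "polytime es es
      (\<lambda>z. case fst z of [] \<Rightarrow> z | y # ys \<Rightarrow> (ys, h (snd (snd z)) y (fst (snd z)), snd (snd z)))"
    and bound: "\<And>x us vs. l x = us @ vs \<Longrightarrow>
      size (es (vs, fold (h x) us (i x), x)) \<le> poly K (size (ea x))"
  shows "polytime ea es (\<lambda>x. ([], fold (h x) (l x) (i x), x))"
proof -
  from init obtain E M q where E: "computes E M q ea es (\<lambda>x. (l x, i x, x))" by (rule polytimeE)
  from step obtain P N p where P: "computes P N p es es
      (\<lambda>z. case fst z of [] \<Rightarrow> z | y # ys \<Rightarrow> (ys, h (snd (snd z)) y (fst (snd z)), snd (snd z)))"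
    by (rule polytimeE)
  show ?thesis
  proof (rule polytimeI[where P = "Seq E (While (HdE (VarE 0)) P)" and N = "max N M" and
        p = "q + (q * (pcompose p K + [:3:]) + [:3:])" and q = K])
    fix x and s :: store assume s: "s 0 = ea x" "clean (max N M) s"
    let ?s = "s(0 := es (l x, i x, x))" and ?n = "size (ea x)"
    have "clean M s" using s(2) by (rule clean_mono) simp
    from computes_runs_within[OF E s(1) this] have "runs_within E s (poly q ?n) ?s" .
    moreover have "runs_within (While (HdE (VarE 0)) P) ?s
        (length (l x) * (poly p (poly K ?n) + 3) + 3) (?s(0 := es ([], fold (h x) (l x) (i x), x)))"
      unfolding es_def
      by (rule runs_within_fold_loop[OF P[unfolded es_def] _ _ bound[unfolded es_def]])
        (use s(2) in \<open>auto intro!: clean_fun_upd elim: clean_mono\<close>)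
    moreover have "length (l x) \<le> poly q ?n"
      using computes_size[OF E, of x] length_le_size_enc_list[of "l x" eb] by (simp add: es_def)
    then have "length (l x) * (poly p (poly K ?n) + 3) + 3
        \<le> poly (q * (pcompose p K + [:3:]) + [:3:]) ?n"
      by (simp add: poly_pcompose mult_right_mono)
    ultimately show "runs_within (Seq E (While (HdE (VarE 0)) P)) s
        (poly (q + (q * (pcompose p K + [:3:]) + [:3:])) ?n)
        (s(0 := es ([], fold (h x) (l x) (i x), x)))"
      unfolding poly_add[of q] fun_upd_upd by (rule runs_within_Seq[OF _ runs_within_mono])
  qed (use bound in simp)
qed

lemma polytime_fold:
  fixes h :: "'a \<Rightarrow> 'b \<Rightarrow> 'c \<Rightarrow> 'c"
  assumes list: "polytime ea (enc_list eb) l" and init: "polytime ea ec i"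
    and step: "polytime (enc_pair eb (enc_pair ec ea)) ec
      (\<lambda>p. h (snd (snd p)) (fst p) (fst (snd p)))"
    and bound: "\<And>x us vs. l x = us @ vs \<Longrightarrow> size (ec (fold (h x) us (i x))) \<le> poly B (size (ea x))"
  shows "polytime ea ec (\<lambda>x. fold (h x) (l x) (i x))"
proof -
  let ?es = "enc_pair (enc_list eb) (enc_pair ec ea)"
  obtain q where q: "\<And>x. size (enc_list eb (l x)) \<le> poly q (size (ea x))"
    using list by (rule polytime_size_bound) blast
  have "polytime ea ?es (\<lambda>x. ([], fold (h x) (l x) (i x), x))"
  proof (rule polytime_fold_loop[where K = "q + B + [:2, 1:]"])
    show "polytime ea ?es (\<lambda>x. (l x, i x, x))" by (rule polytime_intros list init)+
    show "polytime ?es ?es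
        (\<lambda>z. case fst z of [] \<Rightarrow> z | y # ys \<Rightarrow> (ys, h (snd (snd z)) y (fst (snd z)), snd (snd z)))"
      by (rule polytime_case_list polytime_Pair polytime_comp3[OF step] polytime_fst polytime_snd
          polytime_id)+
    show "size (?es (vs, fold (h x) us (i x), x)) \<le> poly (q + B + [:2, 1:]) (size (ea x))"
      if "l x = us @ vs" for x us vs
      using q[of x] bound[OF that] by (simp add: that size_enc_list_append)
  qed
  from polytime_fst[OF polytime_snd[OF this]] show ?thesis by simp
qed

lemma polytime_rev [polytime_intros]:
  assumes "polytime ea (enc_list eb) f"
  shows "polytime ea (enc_list eb) (\<lambda>x. rev (f x))"
proof -
  obtain p where p: "\<And>x. size (enc_list eb (f x)) \<le> poly p (size (ea x))"
    using assms by (rule polytime_size_bound) blast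
  have "polytime ea (enc_list eb) (\<lambda>x. fold Cons (f x) [])"
  proof (rule polytime_fold[where B = p, OF assms])
    show "size (enc_list eb (fold Cons us [])) \<le> poly p (size (ea x))"
      if "f x = us @ vs" for x us vs
      using p[of x] by (simp add: that size_enc_list_append size_enc_list_rev fold_Cons_rev)
  qed (rule polytime_intros)+
  then show ?thesis by (simp add: fold_Cons_rev)
qed

lemma polytime_foldr:
  fixes h :: "'a \<Rightarrow> 'b \<Rightarrow> 'c \<Rightarrow> 'c"
  assumes "polytime ea (enc_list eb) l" "polytime ea ec i"
    and "polytime (enc_pair eb (enc_pair ec ea)) ec (\<lambda>p. h (snd (snd p)) (fst p) (fst (snd p)))"
    and bound: "\<And>x us vs. l x = us @ vs \<Longrightarrow> size (ec (foldr (h x) vs (i x))) \<le> poly B (size (ea x))"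
  shows "polytime ea ec (\<lambda>x. foldr (h x) (l x) (i x))"
proof -
  have "polytime ea ec (\<lambda>x. fold (h x) (rev (l x)) (i x))"
  proof (rule polytime_fold[where B = B])
    show "size (ec (fold (h x) us (i x))) \<le> poly B (size (ea x))"
      if "rev (l x) = us @ vs" for x us vs
      using bound[of x "rev vs" "rev us"] that by (simp add: foldr_conv_fold rev_swap)
  qed (rule assms polytime_rev)+
  then show ?thesis by (simp add: foldr_conv_fold)
qed

lemma polytime_list_rec:
  fixes g :: "'a \<Rightarrow> 'b list \<Rightarrow> 'c"
  assumes list: "polytime ea (enc_list eb) l" and init: "polytime ea ec i"
    and step: "polytime (enc_pair eb (enc_pair (enc_list eb) (enc_pair ec ea))) ec
      (\<lambda>p. h (snd (snd (snd p))) (fst p) (fst (snd p)) (fst (snd (snd p))))"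
    and rec: "\<And>x. g x [] = i x" "\<And>x y ys. g x (y # ys) = h x y ys (g x ys)"
    and bound: "\<And>x us vs. l x = us @ vs \<Longrightarrow> size (ec (g x vs)) \<le> poly B (size (ea x))"
  shows "polytime ea ec (\<lambda>x. g x (l x))"
proof -
  let ?step = "\<lambda>x y z. (y # fst z, h x y (fst z) (snd z))"
  have foldr_step: "foldr (?step x) ys ([], i x) = (ys, g x ys)" for x ys
    by (induction ys) (auto simp: rec)
  obtain p where p: "\<And>x. size (enc_list eb (l x)) \<le> poly p (size (ea x))"
    using list by (rule polytime_size_bound) blast
  have "polytime (enc_pair eb (enc_pair (enc_pair (enc_list eb) ec) ea))
      (enc_pair eb (enc_pair (enc_list eb) (enc_pair ec ea)))
      (\<lambda>p. (fst p, fst (fst (snd p)), snd (fst (snd p)), snd (snd p)))"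
    by (rule polytime_intros)+
  from polytime_comp[OF this step] have step_pair: "polytime
      (enc_pair eb (enc_pair (enc_pair (enc_list eb) ec) ea)) ec
      (\<lambda>p. h (snd (snd p)) (fst p) (fst (fst (snd p))) (snd (fst (snd p))))" by simp
  have "polytime ea (enc_pair (enc_list eb) ec) (\<lambda>x. foldr (?step x) (l x) ([], i x))"
  proof (rule polytime_foldr[where B = "p + B + [:1:]"])
    show "size (enc_pair (enc_list eb) ec (foldr (?step x) vs ([], i x)))
        \<le> poly (p + B + [:1:]) (size (ea x))" if "l x = us @ vs" for x us vs
      using p[of x] bound[OF that] by (simp add: foldr_step that size_enc_list_append)
  qed (rule step_pair list init polytime_intros)+
  from polytime_snd[OF this] show ?thesis by (simp add: foldr_step)
qed

lemma polytime_append [polytime_intros]: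
  assumes "polytime ea (enc_list eb) f" "polytime ea (enc_list eb) g"
  shows "polytime ea (enc_list eb) (\<lambda>x. f x @ g x)"
proof -
  obtain p q where p: "\<And>x. size (enc_list eb (f x)) \<le> poly p (size (ea x))"
    and q: "\<And>x. size (enc_list eb (g x)) \<le> poly q (size (ea x))"
    using polytime_size_bound[OF assms(1)] polytime_size_bound[OF assms(2)] by metis
  have "foldr Cons xs ys = xs @ ys" for xs ys :: "'b list" by (induction xs) auto
  moreover have "polytime ea (enc_list eb) (\<lambda>x. foldr Cons (f x) (g x))"
  proof (rule polytime_foldr[where B = "p + q"])
    show "size (enc_list eb (foldr Cons vs (g x))) \<le> poly (p + q) (size (ea x))"
      if "f x = us @ vs" for x us vs
      using p[of x] q[of x] calculation by (simp add: that size_enc_list_append)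
  qed (rule assms polytime_intros)+
  ultimately show ?thesis by simp
qed

lemma polytime_map [polytime_intros]:
  assumes "polytime ea (enc_list eb) l" "polytime (enc_pair eb ea) ec (\<lambda>p. h (snd p) (fst p))"
  shows "polytime ea (enc_list ec) (\<lambda>x. map (h x) (l x))"
proof -
  obtain p where p: "\<And>x. size (enc_list eb (l x)) \<le> poly p (size (ea x))"
    using assms(1) by (rule polytime_size_bound) blast
  obtain q where q: "\<And>z. size (ec (h (snd z) (fst z))) \<le> poly q (size (enc_pair eb ea z))"
    using assms(2) by (rule polytime_size_bound) blast
  let ?q = "pcompose q (p + [:1, 1:])"
  have size_h: "size (ec (h x y)) \<le> poly ?q (size (ea x))" if "y \<in> set (l x)" for x y
  proof -
    have "size (enc_pair eb ea (y, x)) \<le> poly (p + [:1, 1:]) (size (ea x))"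
      using size_le_size_enc_list[OF that, of eb] p[of x] by simp
    then have "poly q (size (enc_pair eb ea (y, x))) \<le> poly ?q (size (ea x))"
      unfolding poly_pcompose by (rule poly_mono_nat)
    with q[of "(y, x)"] show ?thesis by simp
  qed
  have size_map: "size (enc_list ec (map (h x) vs)) \<le> poly (p * (?q + 1)) (size (ea x))"
    if "l x = us @ vs" for x us vs
  proof -
    have "size (enc_list ec (map (h x) vs)) \<le> length (map (h x) vs) * (poly ?q (size (ea x)) + 1)"
      using size_h[of _ x] that by (intro size_enc_list_le) auto
    also have "\<dots> \<le> poly p (size (ea x)) * (poly ?q (size (ea x)) + 1)"
      using p[of x] length_le_size_enc_list[of "l x" eb] that by (intro mult_right_mono) auto
    finally show ?thesis by simp
  qed
  have map_conv_foldr: "map f ys = foldr (\<lambda>y. (#) (f y)) ys []" for f :: "'b \<Rightarrow> 'c" and ys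
    by (induction ys) auto
  have "polytime ea (enc_list ec) (\<lambda>x. foldr (\<lambda>y. (#) (h x y)) (l x) [])"
  proof (rule polytime_foldr[where B = "p * (?q + 1)"])
    show "size (enc_list ec (foldr (\<lambda>y. (#) (h x y)) vs [])) \<le> poly (p * (?q + 1)) (size (ea x))"
      if "l x = us @ vs" for x us vs
      using size_map[OF that] by (simp add: map_conv_foldr)
  qed (rule assms(1) polytime_comp2[OF assms(2)] polytime_intros)+
  then show ?thesis by (simp add: map_conv_foldr)
qed

lemma polytime_concat [polytime_intros]:
  assumes "polytime ea (enc_list (enc_list eb)) f"
  shows "polytime ea (enc_list eb) (\<lambda>x. concat (f x))"
proof -
  obtain p where p: "\<And>x. size (enc_list (enc_list eb) (f x)) \<le> poly p (size (ea x))"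
    using assms by (rule polytime_size_bound) blast
  have "polytime ea (enc_list eb) (\<lambda>x. foldr (@) (f x) [])"
  proof (rule polytime_foldr[where B = p, OF assms])
    show "size (enc_list eb (foldr (@) vs [])) \<le> poly p (size (ea x))"
      if "f x = us @ vs" for x us vs
      using p[of x] size_enc_list_concat[of eb vs]
      by (simp add: that size_enc_list_append concat_conv_foldr)
  qed (rule polytime_intros)+
  then show ?thesis by (simp add: concat_conv_foldr)
qed

lemma polytime_filter [polytime_intros]:
  assumes "polytime ea (enc_list eb) l" "polytime (enc_pair eb ea) enc_bool (\<lambda>p. h (snd p) (fst p))"
  shows "polytime ea (enc_list eb) (\<lambda>x. filter (h x) (l x))"
proof -
  have "polytime ea (enc_list eb) (\<lambda>x. concat (map (\<lambda>y. if h x y then [y] else []) (l x)))"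
    by (rule assms polytime_intros)+
  moreover have "concat (map (\<lambda>y. if P y then [y] else []) ys) = filter P ys"
    for P and ys :: "'b list" by (induction ys) auto
  ultimately show ?thesis by simp
qed

lemma polytime_not [polytime_intros]:
  "polytime ea enc_bool b \<Longrightarrow> polytime ea enc_bool (\<lambda>x. \<not> b x)"
  by (rule polytime_cong_enc[OF polytime_If[of ea b enc_bool "\<lambda>_. False" "\<lambda>_. True"]])
    (auto intro: polytime_const)

lemma polytime_conj [polytime_intros]:
  "polytime ea enc_bool b \<Longrightarrow> polytime ea enc_bool c \<Longrightarrow> polytime ea enc_bool (\<lambda>x. b x \<and> c x)"
  by (rule polytime_cong_enc[OF polytime_If[of ea b enc_bool c "\<lambda>_. False"]])
    (auto intro: polytime_const)

lemma polytime_disj [polytime_intros]: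
  "polytime ea enc_bool b \<Longrightarrow> polytime ea enc_bool c \<Longrightarrow> polytime ea enc_bool (\<lambda>x. b x \<or> c x)"
  by (rule polytime_cong_enc[OF polytime_If[of ea b enc_bool "\<lambda>_. True" c]])
    (auto intro: polytime_const)

lemma polytime_list_all [polytime_intros]:
  assumes "polytime ea (enc_list eb) l" "polytime (enc_pair eb ea) enc_bool (\<lambda>p. h (snd p) (fst p))"
  shows "polytime ea enc_bool (\<lambda>x. list_all (h x) (l x))"
proof -
  have "polytime ea enc_bool (\<lambda>x. filter (\<lambda>y. \<not> h x y) (l x) = [])"
    by (rule assms polytime_intros)+
  then show ?thesis by (simp add: filter_empty_conv list_all_iff)
qed

lemma polytime_list_ex [polytime_intros]:
  assumes "polytime ea (enc_list eb) l" "polytime (enc_pair eb ea) enc_bool (\<lambda>p. h (snd p) (fst p))"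
  shows "polytime ea enc_bool (\<lambda>x. list_ex (h x) (l x))"
proof -
  have "polytime ea enc_bool (\<lambda>x. \<not> list_all (\<lambda>y. \<not> h x y) (l x))"
    by (rule assms polytime_intros)+
  then show ?thesis by (simp add: list_ex_iff list_all_iff)
qed

abbreviation enc_unary :: "unit list \<Rightarrow> tree" where
  "enc_unary \<equiv> enc_list (\<lambda>_. Leaf)"

lemma enc_list_const: "length xs = length ys \<Longrightarrow> enc_list (\<lambda>_. c) xs = enc_list (\<lambda>_. c) ys"
  by (induction xs ys rule: list_induct2) auto

lemma enc_nat_unary: "enc_nat n = enc_unary (replicate n ())"
  unfolding enc_nat_def by (rule enc_list_const) simp

lemma size_enc_nat [simp]: "size (enc_nat n) = n"
  unfolding enc_nat_unary by (induction n) auto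

lemma polytime_replicate [polytime_intros]:
  "polytime ea enc_nat f \<Longrightarrow> polytime ea enc_unary (\<lambda>x. replicate (f x) ())"
  by (erule polytime_cong_enc) (auto simp: enc_nat_unary)

lemma polytime_length [polytime_intros]:
  assumes "polytime ea (enc_list eb) f"
  shows "polytime ea enc_nat (\<lambda>x. length (f x))"
proof -
  have "polytime ea enc_unary (\<lambda>x. map (\<lambda>_. ()) (f x))" by (rule assms polytime_intros)+
  then show ?thesis by (rule polytime_cong_enc) (auto simp: enc_nat_unary intro: enc_list_const)
qed

lemma polytime_funpow:
  assumes "polytime ea enc_nat n" "polytime ea ec i"
    "polytime (enc_pair ec ea) ec (\<lambda>p. h (snd p) (fst p))"
    and bound: "\<And>x k. k \<le> n x \<Longrightarrow> size (ec ((h x ^^ k) (i x))) \<le> poly B (size (ea x))"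
  shows "polytime ea ec (\<lambda>x. (h x ^^ n x) (i x))"
proof -
  have "polytime ea ec (\<lambda>x. fold (\<lambda>_. h x) (replicate (n x) ()) (i x))"
  proof (rule polytime_fold[where B = B])
    show "size (ec (fold (\<lambda>_. h x) us (i x))) \<le> poly B (size (ea x))"
      if "replicate (n x) () = us @ vs" for x us vs
    proof -
      have "us = replicate (length us) ()" by (simp add: replicate_length_same)
      moreover have "length us \<le> n x" using arg_cong[OF that, of length] by simp
      ultimately show ?thesis using bound[of "length us" x] by (metis fold_replicate)
    qed
  qed (rule assms(2) polytime_comp2[OF assms(3)] polytime_replicate[OF assms(1)] polytime_intros)+
  then show ?thesis by simp
qed

lemma polytime_add [polytime_intros]:
  assumes "polytime ea enc_nat f" "polytime ea enc_nat g"
  shows "polytime ea enc_nat (\<lambda>x. f x + g x)"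
proof -
  have "polytime ea enc_nat (\<lambda>x. length (replicate (f x) () @ replicate (g x) ()))"
    by (rule assms polytime_intros)+
  then show ?thesis by simp
qed

lemma polytime_sum_list [polytime_intros]:
  assumes "polytime ea (enc_list enc_nat) f"
  shows "polytime ea enc_nat (\<lambda>x. sum_list (f x))"
proof -
  have "polytime ea enc_nat (\<lambda>x. length (concat (map (\<lambda>n. replicate n ()) (f x))))"
    by (rule assms polytime_intros)+
  then show ?thesis by (simp add: length_concat comp_def)
qed

lemma polytime_drop [polytime_intros]:
  assumes "polytime ea enc_nat n" "polytime ea (enc_list eb) l"
  shows "polytime ea (enc_list eb) (\<lambda>x. drop (n x) (l x))"
proof -
  obtain p where p: "\<And>x. size (enc_list eb (l x)) \<le> poly p (size (ea x))"
    using assms(2) by (rule polytime_size_bound) blast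
  have funpow_tl: "(tl ^^ k) ys = drop k ys" for k and ys :: "'b list"
    by (induction k) (simp_all add: drop_Suc tl_drop)
  have "polytime ea (enc_list eb) (\<lambda>x. (tl ^^ n x) (l x))"
  proof (rule polytime_funpow[OF assms, where B = p])
    show "size (enc_list eb ((tl ^^ k) (l x))) \<le> poly p (size (ea x))" for k x
      using p[of x] size_enc_list_append[of eb "take k (l x)" "drop k (l x)"]
      by (simp add: funpow_tl)
  qed (rule polytime_intros)+
  then show ?thesis by (simp add: funpow_tl)
qed

lemma polytime_le [polytime_intros]:
  assumes "polytime ea enc_nat f" "polytime ea enc_nat g"
  shows "polytime ea enc_bool (\<lambda>x. f x \<le> g x)"
proof -
  have "polytime ea enc_bool (\<lambda>x. drop (g x) (replicate (f x) ()) = [])"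
    by (rule assms polytime_intros)+
  then show ?thesis by simp
qed

lemma polytime_less [polytime_intros]:
  assumes "polytime ea enc_nat f" "polytime ea enc_nat g"
  shows "polytime ea enc_bool (\<lambda>x. f x < g x)"
  using polytime_not[OF polytime_le[OF assms(2,1)]] by (simp add: not_le)

lemma polytime_nat_eq [polytime_intros]:
  assumes "polytime ea enc_nat f" "polytime ea enc_nat g"
  shows "polytime ea enc_bool (\<lambda>x. f x = g x)"
  using polytime_conj[OF polytime_le[OF assms] polytime_le[OF assms(2,1)]] by (simp add: eq_iff)

lemma polytime_member [polytime_intros]:
  assumes "polytime ea enc_nat v" "polytime ea (enc_list enc_nat) l"
  shows "polytime ea enc_bool (\<lambda>x. v x \<in> set (l x))"
proof -
  have "polytime (enc_pair enc_nat (enc_list enc_nat)) enc_bool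
      (\<lambda>p. list_ex (\<lambda>u. u = fst p) (snd p))"
    by (rule polytime_intros)+
  from polytime_comp2[OF this assms] show ?thesis by (simp add: list_ex_iff)
qed

lemma polytime_zip_tl [polytime_intros]:
  assumes "polytime ea (enc_list eb) f"
  shows "polytime ea (enc_list (enc_pair eb eb)) (\<lambda>x. zip (f x) (tl (f x)))"
proof -
  obtain p where p: "\<And>x. size (enc_list eb (f x)) \<le> poly p (size (ea x))"
    using assms by (rule polytime_size_bound) blast
  have size_zip: "size (enc_list (enc_pair eb eb) (zip xs ys))
      \<le> size (enc_list eb xs) + size (enc_list eb ys)" for xs ys
    by (induction xs ys rule: list_induct2') auto
  show ?thesis
  proof (rule polytime_list_rec[OF assms, where g = "\<lambda>_ ys. zip ys (tl ys)" and i = "\<lambda>_. []" and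
        h = "\<lambda>x y ys r. case ys of [] \<Rightarrow> [] | z # _ \<Rightarrow> (y, z) # r" and B = "smult 2 p"])
    show "size (enc_list (enc_pair eb eb) (zip vs (tl vs))) \<le> poly (smult 2 p) (size (ea x))"
      if "f x = us @ vs" for x us vs
      using p[of x] size_zip[of vs "tl vs"] that
      by (cases vs) (auto simp: size_enc_list_append)
  qed (auto split: list.split | rule polytime_intros)+
qed

fun splits :: "'a list \<Rightarrow> ('a list \<times> 'a list) list" where
  "splits [] = [([], [])]"
| "splits (x # xs) = ([], x # xs) # map (\<lambda>q. (x # fst q, snd q)) (splits xs)"

lemma set_splits: "set (splits xs) = {(A, B). xs = A @ B}"
  by (induction xs) (auto simp: Cons_eq_append_conv image_iff)

lemma length_splits: "length (splits xs) = Suc (length xs)"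
  by (induction xs) auto

lemma size_enc_list_splits:
  "size (enc_list (enc_pair (enc_list e) (enc_list e)) (splits xs))
    \<le> (size (enc_list e xs) + 1) * (size (enc_list e xs) + 2)"
proof -
  have "size (enc_list (enc_pair (enc_list e) (enc_list e)) (splits xs))
      \<le> length (splits xs) * (size (enc_list e xs) + 1 + 1)"
    by (rule size_enc_list_le) (auto simp: set_splits size_enc_list_append)
  also have "\<dots> \<le> (size (enc_list e xs) + 1) * (size (enc_list e xs) + 2)"
    using length_le_size_enc_list[of xs e] unfolding length_splits by (intro mult_mono) auto
  finally show ?thesis .
qed

lemma polytime_splits [polytime_intros]:
  assumes "polytime ea (enc_list eb) f"
  shows "polytime ea (enc_list (enc_pair (enc_list eb) (enc_list eb))) (\<lambda>x. splits (f x))"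
proof -
  obtain p where p: "\<And>x. size (enc_list eb (f x)) \<le> poly p (size (ea x))"
    using assms by (rule polytime_size_bound) blast
  show ?thesis
  proof (rule polytime_list_rec[OF assms, where g = "\<lambda>_. splits" and i = "\<lambda>_. [([], [])]" and
        h = "\<lambda>x y ys r. ([], y # ys) # map (\<lambda>q. (y # fst q, snd q)) r" and
        B = "(p + [:1:]) * (p + [:2:])"])
    show "size (enc_list (enc_pair (enc_list eb) (enc_list eb)) (splits vs))
        \<le> poly ((p + [:1:]) * (p + [:2:])) (size (ea x))" if "f x = us @ vs" for x us vs
    proof -
      have "size (enc_list eb vs) \<le> poly p (size (ea x))"
        using p[of x] by (simp add: that size_enc_list_append)
      then have "(size (enc_list eb vs) + 1) * (size (enc_list eb vs) + 2)
          \<le> (poly p (size (ea x)) + 1) * (poly p (size (ea x)) + 2)" by (intro mult_mono) auto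
      with size_enc_list_splits[of eb vs] show ?thesis by simp
    qed
  qed (simp | rule polytime_intros)+
qed

definition picks :: "'a list \<Rightarrow> ('a \<times> 'a list) list" where
  "picks xs = concat (map (\<lambda>q. case snd q of [] \<Rightarrow> [] | y # ys \<Rightarrow> [(y, fst q @ ys)]) (splits xs))"

lemma set_picks: "set (picks xs) = {(y, A @ B) | y A B. xs = A @ y # B}"
  unfolding picks_def by (auto simp: set_splits split: list.splits) force

lemma mset_picks: "(y, ys) \<in> set (picks xs) \<Longrightarrow> mset xs = add_mset y (mset ys)"
  by (auto simp: set_picks)

lemma picks_complete:
  assumes "mset xs = add_mset y R"
  obtains ys where "(y, ys) \<in> set (picks xs)" "mset ys = R"
proof -
  have "y \<in> set xs" using assms by (metis set_mset_mset union_single_eq_member)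
  then obtain A B where "xs = A @ y # B" by (auto simp: in_set_conv_decomp)
  with assms show ?thesis by (intro that[of "A @ B"]) (auto simp: set_picks)
qed

lemma polytime_picks [polytime_intros]:
  assumes "polytime ea (enc_list eb) f"
  shows "polytime ea (enc_list (enc_pair eb (enc_list eb))) (\<lambda>x. picks (f x))"
  unfolding picks_def by (rule assms polytime_intros)+

section \<open>The local search\<close>

type_synonym 'v state = "'v list multiset \<times> 'v list multiset"

definition closed_wrt :: "'v set set \<Rightarrow> 'v set \<Rightarrow> bool" where
  "closed_wrt \<T> X \<longleftrightarrow> (\<forall>T\<in>\<T>. T \<subseteq> X \<or> T \<inter> X = {})"

inductive move :: "('v \<Rightarrow> 'v \<Rightarrow> bool) \<Rightarrow> 'v set set \<Rightarrow> 'v state \<Rightarrow> 'v state \<Rightarrow> bool"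
  for adj \<T> where
  stay: "move adj \<T> S S"
| reverse: "move adj \<T> (add_mset P R, C) (add_mset (rev P) R, C)"
| split: "A \<noteq> [] \<Longrightarrow> B \<noteq> [] \<Longrightarrow>
    move adj \<T> (add_mset (A @ B) R, C) (add_mset A (add_mset B R), C)"
| join: "A \<noteq> [] \<Longrightarrow> B \<noteq> [] \<Longrightarrow> adj (last A) (hd B) \<Longrightarrow>
    move adj \<T> (add_mset A (add_mset B R), C) (add_mset (A @ B) R, C)"
| close: "P \<noteq> [] \<Longrightarrow> adj (last P) (hd P) \<Longrightarrow> closed_wrt \<T> (set P) \<Longrightarrow>
    move adj \<T> (add_mset P R, C) (R, add_mset P C)"
| unclose: "A @ B \<noteq> [] \<Longrightarrow> move adj \<T> (R, add_mset (A @ B) C) (add_mset (B @ A) R, C)"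

definition reach :: "('v \<Rightarrow> 'v \<Rightarrow> bool) \<Rightarrow> 'v set set \<Rightarrow> nat \<Rightarrow> 'v state \<Rightarrow> 'v state \<Rightarrow> bool" where
  "reach adj \<T> n = move adj \<T> ^^ n"

definition vertices :: "'v state \<Rightarrow> 'v multiset" where
  "vertices S = (\<Sum>P\<in>#fst S. mset P) + (\<Sum>C\<in>#snd S. mset C)"

text \<open>A consecutive pair that is itself closed can be cut out as a cycle of length 2; the potential
  counts the other pairs, and hence prefers such a pair to be consecutive.\<close>

fun unlocked :: "'v set set \<Rightarrow> 'v list \<Rightarrow> nat" where
  "unlocked \<T> (x # y # zs) = (if closed_wrt \<T> {x, y} then 0 else 1) + unlocked \<T> (y # zs)"
| "unlocked \<T> _ = 0"

definition path_weight :: "'v set set \<Rightarrow> 'v list \<Rightarrow> nat" where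
  "path_weight \<T> P =
     (if length P \<le> 1 then 20 else if length P = 2 then 10 else 0) + unlocked \<T> P"

definition rest_weight :: "'v set set \<Rightarrow> 'v state \<Rightarrow> nat" where
  "rest_weight \<T> S = (\<Sum>P\<in>#fst S. path_weight \<T> P) + (\<Sum>C\<in>#snd S. unlocked \<T> C)"

text \<open>A move increases \<open>rest_weight\<close> by at most 40 and the number of cycles by at most 1, so over 100
  moves the three summands are compared lexicographically.\<close>

definition potential :: "'v set set \<Rightarrow> 'v state \<Rightarrow> nat" where
  "potential \<T> S = 200000 * size (fst S) + 1000 * size (snd S) + rest_weight \<T> S"

definition local_opt :: "('v \<Rightarrow> 'v \<Rightarrow> bool) \<Rightarrow> 'v set set \<Rightarrow> nat \<Rightarrow> 'v state \<Rightarrow> bool" where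
  "local_opt adj \<T> n S \<longleftrightarrow> (\<forall>S'. reach adj \<T> n S S' \<longrightarrow> potential \<T> S \<le> potential \<T> S')"

subsection \<open>Weights\<close>

lemma vertices_mset: "vertices (mset ps, mset cs) = mset (concat ps @ concat cs)"
  by (simp add: vertices_def mset_concat sum_mset_sum_list[symmetric])

lemma unlocked_append:
  "unlocked \<T> (A @ B) = unlocked \<T> A + unlocked \<T> B +
    (if A = [] \<or> B = [] \<or> closed_wrt \<T> {last A, hd B} then 0 else 1)"
proof (induction \<T> A rule: unlocked.induct)
  case ("2_2" \<T> x)
  show ?case by (cases B) auto
qed auto

lemma unlocked_rev: "unlocked \<T> (rev P) = unlocked \<T> P"
  by (induction \<T> P rule: unlocked.induct) (auto simp: unlocked_append insert_commute last_rev)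

lemma unlocked_attach_le:
  "unlocked \<T> ((L @ [x]) @ D) + unlocked \<T> M \<le> unlocked \<T> (L @ x # M) + unlocked \<T> D + 1"
  using unlocked_append[of \<T> "L @ [x]" M] unlocked_append[of \<T> "L @ [x]" D] by simp

lemma path_weight_rev: "path_weight \<T> (rev P) = path_weight \<T> P"
  by (simp add: path_weight_def unlocked_rev)

lemma potential_add: "potential \<T> (S + S') = potential \<T> S + potential \<T> S'"
  by (simp add: potential_def rest_weight_def)

lemma rest_weight_move: "move adj \<T> S S' \<Longrightarrow> rest_weight \<T> S' \<le> rest_weight \<T> S + 40"
  by (induction rule: move.induct)
    (auto simp: rest_weight_def path_weight_def unlocked_rev unlocked_append)

subsection \<open>Sequences of moves\<close>

lemma reach_0: "reach adj \<T> 0 S S' \<longleftrightarrow> S' = S"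
  by (auto simp: reach_def)

lemma reach_Suc: "reach adj \<T> (Suc n) S S' \<longleftrightarrow> (\<exists>S1. reach adj \<T> n S S1 \<and> move adj \<T> S1 S')"
  by (auto simp: reach_def)

lemma reach_1: "reach adj \<T> 1 S S' \<longleftrightarrow> move adj \<T> S S'"
  by (simp add: reach_def eq_OO)

lemma reach_trans [trans]:
  "reach adj \<T> n S S' \<Longrightarrow> reach adj \<T> m S' S'' \<Longrightarrow> reach adj \<T> (n + m) S S''"
  unfolding reach_def by (rule relpowp_trans)

lemma reach_refl: "reach adj \<T> n S S"
proof (induction n)
  case (Suc n)
  then show ?case using reach_Suc stay by blast
qed (simp add: reach_0)

lemma reach_mono: "reach adj \<T> n S S' \<Longrightarrow> n \<le> k \<Longrightarrow> reach adj \<T> k S S'"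
  using reach_trans[OF _ reach_refl, of adj \<T> n S S' "k - n"] by simp

lemma reach_induct [consumes 1, case_names refl step]:
  assumes "reach adj \<T> n S S'" "I 0 S"
    and "\<And>n S1 S2. reach adj \<T> n S S1 \<Longrightarrow> I n S1 \<Longrightarrow> move adj \<T> S1 S2 \<Longrightarrow> I (Suc n) S2"
  shows "I n S'"
  using assms(1)
proof (induction n arbitrary: S')
  case (Suc n)
  then show ?case using assms(3) unfolding reach_Suc by blast
qed (simp add: reach_0 assms(2))

lemma move_frame: "move adj \<T> S S' \<Longrightarrow> move adj \<T> (S + F) (S' + F)"
  by (induction rule: move.induct; cases F) (auto intro: move.intros)

lemma reach_frame: "reach adj \<T> n S S' \<Longrightarrow> reach adj \<T> n (S + F) (S' + F)"
proof (induction rule: reach_induct)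
  case (step n S1 S2)
  then show ?case using move_frame unfolding reach_Suc by blast
qed (simp add: reach_0)

lemma vertices_move: "move adj \<T> S S' \<Longrightarrow> vertices S' = vertices S"
  by (induction rule: move.induct) (auto simp: vertices_def)

lemma vertices_reach: "reach adj \<T> n S S' \<Longrightarrow> vertices S' = vertices S"
  by (induction rule: reach_induct) (auto simp: vertices_move)

lemma rest_weight_reach: "reach adj \<T> n S S' \<Longrightarrow> rest_weight \<T> S' \<le> rest_weight \<T> S + 40 * n"
  by (induction rule: reach_induct) (auto dest!: rest_weight_move)

lemma size_cycles_move: "move adj \<T> S S' \<Longrightarrow> size (snd S') \<le> size (snd S) + 1"
  by (induction rule: move.induct) auto

lemma size_cycles_reach: "reach adj \<T> n S S' \<Longrightarrow> size (snd S') \<le> size (snd S) + n"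
  by (induction rule: reach_induct) (auto dest!: size_cycles_move)

lemma size_paths_le_if_potential_le:
  assumes "reach adj \<T> n S S'" "n \<le> 100" "potential \<T> S \<le> potential \<T> S'"
  shows "size (fst S) \<le> size (fst S')"
  using rest_weight_reach[OF assms(1)] size_cycles_reach[OF assms(1)] assms(2,3)
  unfolding potential_def by linarith

subsection \<open>Rearranging paths\<close>

locale local_search =
  fixes adj :: "'v \<Rightarrow> 'v \<Rightarrow> bool" and \<T> :: "'v set set"
  assumes adj_sym: "adj u v \<Longrightarrow> adj v u"
begin

abbreviation transforms :: "nat \<Rightarrow> 'v list multiset \<Rightarrow> 'v list multiset \<Rightarrow> bool" where
  "transforms n X Y \<equiv> reach adj \<T> n (X, {#}) (Y, {#})"

lemma transforms_split:
  "A \<noteq> [] \<Longrightarrow> B \<noteq> [] \<Longrightarrow> transforms 1 (add_mset (A @ B) R) (add_mset A (add_mset B R))"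
  unfolding reach_1 by (rule move.split)

lemma transforms_join:
  "A \<noteq> [] \<Longrightarrow> B \<noteq> [] \<Longrightarrow> adj (last A) (hd B) \<Longrightarrow>
    transforms 1 (add_mset A (add_mset B R)) (add_mset (A @ B) R)"
  unfolding reach_1 by (rule move.join)

lemma transforms_rev: "transforms 1 (add_mset P R) (add_mset (rev P) R)"
  unfolding reach_1 by (rule move.reverse)

lemma reach_close:
  "P \<noteq> [] \<Longrightarrow> adj (last P) (hd P) \<Longrightarrow> closed_wrt \<T> (set P) \<Longrightarrow>
    reach adj \<T> 1 (add_mset P R, C) (R, add_mset P C)"
  unfolding reach_1 by (rule move.close)

lemma transforms_frame: "transforms n X Y \<Longrightarrow> transforms n (X + R) (Y + R)"
  using reach_frame[of adj \<T> n "(X, {#})" "(Y, {#})" "(R, {#})"] by simp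

lemma transforms_add_mset: "transforms n {#P#} {#P'#} \<Longrightarrow> transforms n (add_mset P R) (add_mset P' R)"
  using transforms_frame[of n "{#P#}" "{#P'#}" R] by simp

lemma mset_eq_if_transforms: "transforms n {#P#} {#P'#} \<Longrightarrow> mset P' = mset P"
  using vertices_reach[of adj \<T> n "({#P#}, {#})" "({#P'#}, {#})"] by (simp add: vertices_def)

lemma transforms_reorient:
  "list_all2 (\<lambda>P D. D = P \<or> D = rev P) Ps Ds \<Longrightarrow> transforms (length Ds) (mset Ps) (mset Ds)"
proof (induction rule: list_all2_induct)
  case (Cons P Ps D Ds)
  have "transforms (length Ds) (mset (P # Ps)) (mset (P # Ds))"
    using transforms_frame[OF Cons.IH, of "{#P#}"] by simp
  also have "transforms 1 (mset (P # Ds)) (mset (D # Ds))"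
    using Cons.hyps(1) transforms_rev[of P "mset Ds"] by (auto intro: reach_refl)
  finally show ?case by simp
qed (simp add: reach_refl)

lemma transforms_rotate:
  assumes "A \<noteq> []" "B \<noteq> []" "adj (last B) (hd A)"
  shows "transforms 2 {#A @ B#} {#B @ A#}"
proof -
  have "transforms 1 {#A @ B#} {#B, A#}"
    using transforms_split[OF assms(1,2), of "{#}"] by (simp add: add_mset_commute)
  also have "transforms 1 {#B, A#} {#B @ A#}" using assms by (intro transforms_join)
  finally show ?thesis by (rule reach_mono) simp
qed

lemma transforms_rev_prefix:
  assumes "A \<noteq> []" "B \<noteq> []" "adj (hd A) (hd B)"
  shows "transforms 3 {#A @ B#} {#rev A @ B#}"
proof -
  have "transforms 1 {#A @ B#} {#A, B#}" using assms by (intro transforms_split)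
  also have "transforms 1 {#A, B#} {#rev A, B#}" by (rule transforms_rev)
  also have "transforms 1 {#rev A, B#} {#rev A @ B#}"
    using assms by (intro transforms_join) (auto simp: last_rev)
  finally show ?thesis by (rule reach_mono) simp
qed

lemma transforms_rev_suffix:
  assumes "A \<noteq> []" "B \<noteq> []" "adj (last A) (last B)"
  shows "transforms 3 {#A @ B#} {#A @ rev B#}"
proof -
  have "transforms 1 {#A @ B#} {#B, A#}"
    using transforms_split[OF assms(1,2), of "{#}"] by (simp add: add_mset_commute)
  also have "transforms 1 {#B, A#} {#A, rev B#}"
    using transforms_rev[of B "{#A#}"] by (simp add: add_mset_commute)
  also have "transforms 1 {#A, rev B#} {#A @ rev B#}"
    using assms by (intro transforms_join) (auto simp: hd_rev)
  finally show ?thesis by (rule reach_mono) simp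
qed

definition endable :: "'v list \<Rightarrow> 'v \<Rightarrow> bool" where
  "endable P v \<longleftrightarrow> (\<exists>P'. transforms 5 {#P#} {#P'#} \<and> last P' = v)"

lemma endableI: "transforms n {#P#} {#P'#} \<Longrightarrow> n \<le> 5 \<Longrightarrow> endable P (last P')"
  unfolding endable_def using reach_mono by blast

lemma endableE:
  assumes "endable P v" "P \<noteq> []"
  obtains P' where "transforms 5 {#P#} {#P'#}" "last P' = v" "P' \<noteq> []"
  using assms mset_eq_if_transforms unfolding endable_def by (metis mset_zero_iff)

lemma endable_last: "endable P (last P)"
  by (rule endableI[OF reach_refl[of _ _ 0]]) simp

lemma endable_hd: "P \<noteq> [] \<Longrightarrow> endable P (hd P)"
  using endableI[OF transforms_rev[of P "{#}"]] by (simp add: last_rev)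

lemma endable_last_prefix:
  assumes "A \<noteq> []" "B \<noteq> []" "adj (hd A) (hd B)"
  shows "endable (A @ B) (last A)"
proof -
  have "transforms 3 {#A @ B#} {#rev A @ B#}" by (rule transforms_rev_prefix[OF assms])
  also have "transforms 1 {#rev A @ B#} {#rev (rev A @ B)#}" by (rule transforms_rev)
  finally have "endable (A @ B) (last (rev (rev A @ B)))" by (rule endableI) simp
  then show ?thesis using assms(1) by (simp add: last_rev)
qed

lemma transforms_closable:
  assumes "adj (last P) (hd P)" "v \<in> set P"
  obtains P' where "transforms 2 {#P#} {#P'#}" "last P' = v"
proof -
  from assms(2) obtain A B where P: "P = A @ v # B" by (auto simp: in_set_conv_decomp)
  show ?thesis
  proof (cases "B = []")
    case True
    then show ?thesis using that[OF reach_refl] P by simp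
  next
    case False
    with assms P have "transforms 2 {#(A @ [v]) @ B#} {#B @ (A @ [v])#}"
      by (intro transforms_rotate) (auto simp: hd_append)
    with P show ?thesis by (intro that[of "B @ A @ [v]"]) auto
  qed
qed

definition crossing :: "'v list \<Rightarrow> bool" where
  "crossing P \<longleftrightarrow> (\<exists>A B. P = A @ B \<and> A \<noteq> [] \<and> B \<noteq> [] \<and>
     adj (hd A) (hd B) \<and> adj (last A) (last B))"

definition spinnable :: "'v list \<Rightarrow> bool" where
  "spinnable P \<longleftrightarrow> length P \<ge> 3 \<and> (adj (hd P) (last P) \<or> crossing P)"

lemma crossing_rev_if: "crossing P \<Longrightarrow> crossing (rev P)"
proof -
  assume "crossing P"
  then obtain A B where "P = A @ B" "A \<noteq> []" "B \<noteq> []" "adj (hd A) (hd B)" "adj (last A) (last B)"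
    unfolding crossing_def by blast
  then show ?thesis unfolding crossing_def
    by (intro exI[of _ "rev B"] exI[of _ "rev A"]) (auto simp: hd_rev last_rev intro: adj_sym)
qed

lemma spinnable_rev: "spinnable (rev P) \<longleftrightarrow> spinnable P"
  using crossing_rev_if[of P] crossing_rev_if[of "rev P"] adj_sym
  unfolding spinnable_def by (cases "P = []") (auto simp: hd_rev last_rev)

lemma spinnable_transforms_closable:
  assumes "spinnable P"
  obtains P' where "transforms 3 {#P#} {#P'#}" "adj (last P') (hd P')"
proof (cases "adj (hd P) (last P)")
  case True
  then show ?thesis using that[OF reach_refl] adj_sym by blast
next
  case False
  with assms obtain A B where P: "P = A @ B" and
    AB: "A \<noteq> []" "B \<noteq> []" "adj (hd A) (hd B)" "adj (last A) (last B)"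
    unfolding spinnable_def crossing_def by blast
  from AB(3) have "adj (last (A @ rev B)) (hd (A @ rev B))"
    using AB(1,2) adj_sym by (simp add: last_rev)
  with transforms_rev_suffix[OF AB(1,2,4)] show ?thesis using that unfolding P by blast
qed

lemma endable_spinnable:
  assumes "spinnable P" "v \<in> set P"
  shows "endable P v"
proof -
  from assms(1) obtain Q where Q: "transforms 3 {#P#} {#Q#}" "adj (last Q) (hd Q)"
    by (rule spinnable_transforms_closable)
  have "v \<in> set Q" using mset_eq_if_transforms[OF Q(1)] assms(2) by (metis set_mset_mset)
  with Q(2) obtain P' where P': "transforms 2 {#Q#} {#P'#}" "last P' = v"
    by (rule transforms_closable)
  from reach_trans[OF Q(1) P'(1)] have "endable P (last P')" by (rule endableI) simp
  then show ?thesis unfolding P'(2) .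
qed

lemma transforms_triangle:
  assumes "spinnable P" "length P = 3" "u \<in> set P" "w \<in> set P" "u \<noteq> w"
  obtains P' where "transforms 3 {#P#} {#P'#}" "hd P' = u" "last P' = w"
proof -
  from assms(2) obtain a b c where P: "P = [a, b, c]" by (auto simp: length_Suc_conv numeral_3_eq_3)
  have "adj a c"
    using assms(1) unfolding spinnable_def crossing_def P by (auto simp: Cons_eq_append_conv)
  then have "adj c a" by (rule adj_sym)
  have "transforms 2 {#P#} {#[a, b, c]#}" unfolding P by (rule reach_refl)
  moreover have "transforms 2 {#P#} {#[b, c, a]#}"
    using transforms_rotate[of "[a]" "[b, c]"] \<open>adj c a\<close> P by simp
  moreover have "transforms 2 {#P#} {#[c, a, b]#}"
    using transforms_rotate[of "[a, b]" "[c]"] \<open>adj c a\<close> P by simp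
  moreover have "transforms 3 {#P#} {#rev Q#}" "transforms 3 {#P#} {#Q#}"
    if "transforms 2 {#P#} {#Q#}" for Q
    using reach_trans[OF that transforms_rev] reach_mono[OF that] by simp_all
  ultimately have "transforms 3 {#P#} {#P'#}"
    if "P' \<in> {[a, b, c], [b, c, a], [c, a, b], [c, b, a], [a, c, b], [b, a, c]}" for P'
    using that by force
  moreover have "\<exists>P'\<in>{[a, b, c], [b, c, a], [c, a, b], [c, b, a], [a, c, b], [b, a, c]}.
      hd P' = u \<and> last P' = w"
    using assms(3-5) unfolding P by auto
  ultimately show ?thesis using that by blast
qed

subsection \<open>Combining several paths\<close>

lemma transforms_join_ends:
  assumes "P \<noteq> []" "P' \<noteq> []" "endable P u" "endable P' v" "adj u v"
  obtains Q where "transforms 12 {#P, P'#} {#Q#}"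
proof -
  obtain Q where Q: "transforms 5 {#P#} {#Q#}" "last Q = u" "Q \<noteq> []"
    using assms(3,1) by (rule endableE)
  obtain Q' where Q': "transforms 5 {#P'#} {#Q'#}" "last Q' = v" "Q' \<noteq> []"
    using assms(4,2) by (rule endableE)
  have "transforms 5 {#P, P'#} {#P', Q#}"
    using transforms_add_mset[OF Q(1), of "{#P'#}"] by (simp add: add_mset_commute)
  also have "transforms 5 {#P', Q#} {#Q', Q#}" by (rule transforms_add_mset[OF Q'(1)])
  also have "transforms 1 {#Q', Q#} {#Q, rev Q'#}"
    using transforms_rev[of Q' "{#Q#}"] by (simp add: add_mset_commute)
  also have "transforms 1 {#Q, rev Q'#} {#Q @ rev Q'#}"
    by (rule transforms_join) (use assms(5) Q Q' in \<open>auto simp: hd_rev\<close>)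
  finally show ?thesis by (intro that) simp
qed

lemma transforms_bridge:
  assumes "P \<noteq> []" "P' \<noteq> []" "A \<noteq> []" "B \<noteq> []" "endable P u" "endable P' v"
    and "adj u (last A)" "adj v (hd B)"
  obtains Q Q' where "transforms 20 {#P, P', A @ B#} {#Q, Q'#}"
proof -
  obtain Q where Q: "transforms 5 {#P#} {#Q#}" "last Q = u" "Q \<noteq> []"
    using assms(5,1) by (rule endableE)
  obtain Q' where Q': "transforms 12 {#P', B#} {#Q'#}"
    using transforms_join_ends[OF assms(2,4,6) endable_hd assms(8)] assms(4) by blast
  have "transforms 5 {#P, P', A @ B#} {#A @ B, Q, P'#}"
    using transforms_add_mset[OF Q(1), of "{#P', A @ B#}"] by (simp add: add_mset_commute)
  also have "transforms 1 {#A @ B, Q, P'#} {#A, B, Q, P'#}" using assms by (intro transforms_split)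
  also have "transforms 1 {#A, B, Q, P'#} {#Q, rev A, P', B#}"
    using transforms_rev[of A "{#B, Q, P'#}"] by (simp add: add_mset_commute)
  also have "transforms 1 {#Q, rev A, P', B#} {#Q @ rev A, P', B#}"
    by (rule transforms_join) (use assms Q in \<open>auto simp: hd_rev\<close>)
  also have "transforms 12 {#Q @ rev A, P', B#} {#Q', Q @ rev A#}"
    using transforms_frame[OF Q', of "{#Q @ rev A#}"] by (simp add: add_mset_commute)
  finally show ?thesis by (intro that) simp
qed

lemma transforms_insert:
  assumes "transforms n {#P#} {#P'#}" "P \<noteq> []" "A \<noteq> []" "B \<noteq> []"
    and "adj (last A) (hd P')" "adj (last P') (hd B)"
  shows "transforms (n + 3) {#P, A @ B#} {#A @ P' @ B#}"
proof -
  have "P' \<noteq> []" using mset_eq_if_transforms[OF assms(1)] assms(2) by auto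
  have "transforms n {#P, A @ B#} {#A @ B, P'#}"
    using transforms_add_mset[OF assms(1), of "{#A @ B#}"] by (simp add: add_mset_commute)
  also have "transforms 1 {#A @ B, P'#} {#A, P', B#}"
    using transforms_split[OF assms(3,4), of "{#P'#}"] by (simp add: add_mset_commute)
  also have "transforms 1 {#A, P', B#} {#A @ P', B#}"
    using assms \<open>P' \<noteq> []\<close> by (intro transforms_join)
  also have "transforms 1 {#A @ P', B#} {#(A @ P') @ B#}"
    using assms \<open>P' \<noteq> []\<close> by (intro transforms_join) auto
  finally have "transforms (n + 1 + 1 + 1) {#P, A @ B#} {#A @ P' @ B#}" by simp
  then show ?thesis by (rule reach_mono) simp
qed

lemma transforms_shift:
  assumes "transforms n {#D#} {#u # D'#}" "D' \<noteq> []" "A \<noteq> []" "B \<noteq> []" "adj u (last A)"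
    "adj u (hd B)"
  shows "transforms (n + 4) {#D, A @ B#} {#D', A @ [u] @ B#}"
proof -
  have "transforms n {#D, A @ B#} {#[u] @ D', A @ B#}"
    using transforms_add_mset[OF assms(1)] by simp
  also have "transforms 1 {#[u] @ D', A @ B#} {#[u], D', A @ B#}"
    by (rule transforms_split) (use assms(2) in auto)
  also have "transforms (0 + 3) {#[u], D', A @ B#} {#D', A @ [u] @ B#}"
    using transforms_frame[OF transforms_insert[OF reach_refl[of _ _ 0], of "[u]" A B], of "{#D'#}"]
      assms(3-6)
    by (simp add: add_mset_commute adj_sym)
  finally show ?thesis by (rule reach_mono) simp
qed

lemma reach_absorb_cycle:
  assumes "D \<noteq> []" "endable D u" "adj u v" "v \<in> set c"
  obtains D' where "reach adj \<T> 7 ({#D#}, {#c#}) ({#D'#}, {#})"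
proof -
  obtain Q where Q: "transforms 5 {#D#} {#Q#}" "last Q = u" "Q \<noteq> []"
    using assms(2,1) by (rule endableE)
  from assms(4) obtain A B where c: "c = A @ v # B" by (auto simp: in_set_conv_decomp)
  have "reach adj \<T> 5 ({#D#}, {#c#}) ({#Q#}, {#c#})"
    using reach_frame[OF Q(1), of "({#}, {#c#})"] by simp
  also have "reach adj \<T> 1 ({#Q#}, {#c#}) ({#(v # B) @ A, Q#}, {#})"
    unfolding c reach_1 by (rule move.unclose) simp
  also have "reach adj \<T> 1 ({#(v # B) @ A, Q#}, {#}) ({#Q @ (v # B) @ A#}, {#})"
    using transforms_join[of Q "(v # B) @ A" "{#}"] Q assms(3) by (simp add: add_mset_commute)
  finally show ?thesis by (intro that) simp
qed

lemma reach_close_prefix: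
  assumes "P \<noteq> []" "Q \<noteq> []" "adj (last P) (hd P)" "closed_wrt \<T> (set P)"
  shows "reach adj \<T> 2 ({#P @ Q#}, {#}) ({#Q#}, {#P#})"
proof -
  have "reach adj \<T> 1 ({#P @ Q#}, {#}) ({#P, Q#}, {#})" using assms(1,2) by (rule transforms_split)
  also have "reach adj \<T> 1 ({#P, Q#}, {#}) ({#Q#}, {#P#})" using assms(1,3,4) by (rule reach_close)
  finally show ?thesis by (rule reach_mono) simp
qed

lemma transforms_attach:
  assumes "D \<noteq> []" "M \<noteq> []" "adj x (hd D)"
  shows "transforms 2 {#D, L @ x # M#} {#(L @ [x]) @ D, M#}"
proof -
  have "transforms 1 {#D, (L @ [x]) @ M#} {#L @ [x], D, M#}"
    using transforms_split[of "L @ [x]" M "{#D#}"] assms(2) by (simp add: add_mset_commute)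
  also have "transforms 1 {#L @ [x], D, M#} {#(L @ [x]) @ D, M#}"
    using assms(1,3) by (intro transforms_join) simp_all
  finally have "transforms 2 {#D, (L @ [x]) @ M#} {#(L @ [x]) @ D, M#}" by (rule reach_mono) simp
  then show ?thesis by simp
qed

lemma potential_attach_single_less:
  assumes "L \<noteq> []" "2 \<le> length M"
  shows "potential \<T> ({#(L @ [x]) @ [u], M#}, {#}) + 2 < potential \<T> ({#[u], L @ x # M#}, {#})"
proof -
  have "0 < length L" using assms(1) by simp
  then show ?thesis
    using unlocked_attach_le[of \<T> L x "[u]" M] assms(2)
    unfolding potential_def rest_weight_def path_weight_def by simp
qed

text \<open>The difference of more than 2 leaves room for an exchange that changes the number of closed
  pairs.\<close>

lemma absorb_single_path:
  assumes "adj u x" "L \<noteq> []" "M \<noteq> []" "4 \<le> length (L @ x # M)"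
  obtains X where "transforms 3 {#[u], L @ x # M#} X"
    "potential \<T> (X, {#}) + 2 < potential \<T> ({#[u], L @ x # M#}, {#})"
proof (cases "2 \<le> length M")
  case True
  have "transforms 2 {#[u], L @ x # M#} {#(L @ [x]) @ [u], M#}"
    using adj_sym[OF assms(1)] assms(3) by (intro transforms_attach) simp_all
  then have "transforms 3 {#[u], L @ x # M#} {#(L @ [x]) @ [u], M#}" by (rule reach_mono) simp
  then show ?thesis using potential_attach_single_less[OF assms(2) True] by (rule that)
next
  case False
  then have rev: "rev M \<noteq> []" "2 \<le> length (rev L)" using assms(3,4) by (cases M; simp)+
  have "transforms 1 {#[u], L @ x # M#} {#[u], rev M @ x # rev L#}"
    using transforms_rev[of "L @ x # M" "{#[u]#}"] by (simp add: add_mset_commute)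
  also have "transforms 2 {#[u], rev M @ x # rev L#} {#(rev M @ [x]) @ [u], rev L#}"
    using adj_sym[OF assms(1)] assms(2) by (intro transforms_attach) simp_all
  finally have "transforms 3 {#[u], L @ x # M#} {#(rev M @ [x]) @ [u], rev L#}"
    by (rule reach_mono) simp
  moreover have "potential \<T> ({#[u], rev M @ x # rev L#}, {#}) =
      potential \<T> ({#[u], L @ x # M#}, {#})"
    using path_weight_rev[of \<T> "L @ x # M"] by (simp add: potential_def rest_weight_def)
  ultimately show ?thesis using potential_attach_single_less[OF rev, of x u]
    by (intro that) simp_all
qed

end

section \<open>Local optima\<close>

lemma mset_subseteq_if_distinct: "distinct xs \<Longrightarrow> set xs \<subseteq> set_mset M \<Longrightarrow> mset xs \<subseteq># M"
  by (auto simp: subseteq_mset_def distinct_count_atmost_1 Suc_le_eq)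

lemma distinct_if_mset_subseteq_mset_set:
  assumes "mset xs \<subseteq># mset_set A"
  shows "distinct xs"
  unfolding distinct_count_atmost_1
proof
  fix x show "count (mset xs) x = (if x \<in> set xs then 1 else 0)"
  proof (cases "x \<in># mset xs")
    case True
    have "count (mset xs) x \<le> 1"
      by (rule order_trans[OF mset_subset_eq_count[OF assms]]) (simp add: count_mset_set')
    with True show ?thesis by (simp add: le_Suc_eq not_in_iff)
  qed (simp add: not_in_iff)
qed

lemma append_eq_splitE:
  assumes "A @ B = A' @ B'"
  obtains (longer) C where "A = A' @ C" "B' = C @ B" | (shorter) C where "A' = A @ C" "B = C @ B'"
  using assms by (auto simp: append_eq_append_conv2)

lemma append_eq_if_same_edge:
  assumes "distinct (A @ B)" "X @ Y = A @ B" "A \<noteq> []" "B \<noteq> []" "X \<noteq> []" "Y \<noteq> []"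
    and edge: "{last A, hd B} = {last X, hd Y}"
  shows "X = A \<and> Y = B"
proof -
  have trivial_split: "C = []"
    if "P @ C @ Q = A @ B" "{last (P @ C), hd Q} = {last P, hd (C @ Q)}" "P \<noteq> []" "Q \<noteq> []" for P C Q
  proof (rule ccontr)
    assume "C \<noteq> []"
    have "distinct (P @ C @ Q)" using that(1) assms(1) by simp
    moreover have "last P \<in> set P" using that(3) by simp
    ultimately have "last P \<notin> set C" "last P \<notin> set Q" by (simp_all add: disjoint_iff)
    with last_in_set[OF \<open>C \<noteq> []\<close>] hd_in_set[OF that(4)]
    have "last P \<noteq> last C \<and> last P \<noteq> hd Q" by metis
    moreover have "last P \<in> {last (P @ C), hd Q}" unfolding that(2) by simp
    ultimately show False using \<open>C \<noteq> []\<close> by simp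
  qed
  from assms(2) show ?thesis
  proof (cases rule: append_eq_splitE)
    case (longer C)
    have "{last (A @ C), hd Y} = {last A, hd (C @ Y)}" using edge unfolding longer by (rule sym)
    from trivial_split[OF _ this assms(3,6)] have "C = []" unfolding longer by blast
    with longer show ?thesis by simp
  next
    case (shorter C)
    have "{last (X @ C), hd B} = {last X, hd (C @ B)}" using edge unfolding shorter .
    from trivial_split[OF _ this assms(5,4)] have "C = []" unfolding shorter by simp
    with shorter show ?thesis by simp
  qed
qed

locale local_optimum = local_search adj \<T> for adj :: "'v \<Rightarrow> 'v \<Rightarrow> bool" and \<T> +
  fixes U :: "'v set" and Ps Cs :: "'v list multiset"
  assumes adj_irrefl: "\<not> adj u u"
    and finite_U: "finite U"
    and singleton_not_closed: "x \<in> U \<Longrightarrow> \<not> closed_wrt \<T> {x}"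
    and cover: "vertices (Ps, Cs) = mset_set U"
    and nonempty: "[] \<notin># Ps"
    and optimal: "local_opt adj \<T> 100 (Ps, Cs)"
begin

lemma paths_subset:
  assumes "mset Qs \<subseteq># Ps"
  shows "distinct (concat Qs) \<and> set (concat Qs) \<subseteq> U"
proof -
  from assms obtain R where "Ps = mset Qs + R" by (auto simp: mset_subset_eq_exists_conv)
  moreover have "(\<Sum>P\<in>#mset Qs. mset P) = mset (concat Qs)" by (induction Qs) auto
  ultimately have cover_le: "mset (concat Qs) \<subseteq># mset_set U"
    unfolding cover[symmetric] vertices_def by simp
  then have "distinct (concat Qs)" by (rule distinct_if_mset_subseteq_mset_set)
  moreover have "set (concat Qs) \<subseteq> U" using set_mset_mono[OF cover_le] finite_U by simp
  ultimately show ?thesis ..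
qed

lemma paths_disjoint:
  assumes "P \<in># Ps" "P' \<in># Ps" "P \<noteq> P'"
  shows "set P \<inter> set P' = {}"
  using paths_subset[of "[P, P']"] mset_subseteq_if_distinct[of "[P, P']" Ps] assms by auto

lemma paths_eq_if_common_vertex:
  "P \<in># Ps \<Longrightarrow> P' \<in># Ps \<Longrightarrow> v \<in> set P \<Longrightarrow> v \<in> set P' \<Longrightarrow> P = P'"
  using paths_disjoint by blast

lemma size_paths: "size Ps = card (set_mset Ps)"
proof -
  have "count Ps P \<le> 1" for P
  proof (rule ccontr)
    assume "\<not> ?thesis"
    then have "mset [P, P] \<subseteq># Ps" by (auto simp: subseteq_mset_def)
    with paths_subset[of "[P, P]"] have "P = []" by simp
    then show False using nonempty \<open>\<not> count Ps P \<le> 1\<close> by (simp add: not_in_iff)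
  qed
  then have "Ps = mset_set (set_mset Ps)"
    by (intro multiset_eqI) (auto simp: count_mset_set' le_Suc_eq count_eq_zero_iff)
  then show ?thesis by (metis size_mset_set)
qed

text \<open>Admitting both directions of every path halves the case distinctions below.\<close>

definition oriented :: "'v list \<Rightarrow> bool" where
  "oriented D \<longleftrightarrow> D \<in># Ps \<or> rev D \<in># Ps"

lemma oriented_path: "P \<in># Ps \<Longrightarrow> oriented P"
  by (simp add: oriented_def)

lemma oriented_rev: "oriented (rev D) \<longleftrightarrow> oriented D"
  by (auto simp: oriented_def)

lemma oriented_nonempty: "oriented D \<Longrightarrow> D \<noteq> []"
  using nonempty by (auto simp: oriented_def)

lemma oriented_distinct: "oriented D \<Longrightarrow> distinct D"
  using paths_subset[of "[D]"] paths_subset[of "[rev D]"] by (auto simp: oriented_def)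

lemma oriented_subset: "oriented D \<Longrightarrow> set D \<subseteq> U"
  using paths_subset[of "[D]"] paths_subset[of "[rev D]"] by (auto simp: oriented_def)

lemma oriented_common_vertex:
  assumes "oriented D" "oriented D'" "v \<in> set D" "v \<in> set D'"
  shows "D' = D \<or> D' = rev D"
  using assms paths_eq_if_common_vertex unfolding oriented_def by (metis rev_rev_ident set_rev)

lemma oriented_disjoint:
  assumes "oriented D" "oriented D'" "set D \<noteq> set D'"
  shows "set D \<inter> set D' = {}"
  using oriented_common_vertex[OF assms(1,2)] assms(3) by fastforce

lemma potential_minimal:
  assumes "\<forall>D\<in>set Ds. oriented D" "distinct (map set Ds)" "C \<subseteq># Cs"
    and "reach adj \<T> m (mset Ds, C) S'" "m + length Ds \<le> 100"
  shows "potential \<T> (mset Ds, C) \<le> potential \<T> S'"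
proof -
  define path where "path D = (if D \<in># Ps then D else rev D)" for D
  have path: "path D \<in># Ps" if "D \<in> set Ds" for D
    using assms(1) that by (auto simp: path_def oriented_def)
  have "set (path D) = set D" for D by (simp add: path_def)
  then have "distinct (map path Ds)"
    using assms(2) unfolding distinct_map by (metis inj_on_def)
  then have "mset (map path Ds) \<subseteq># Ps" using path by (intro mset_subseteq_if_distinct) auto
  then obtain R E where RE: "Ps = mset (map path Ds) + R" "Cs = C + E"
    using assms(3) by (auto simp: mset_subset_eq_exists_conv)
  have "transforms (length Ds) (mset (map path Ds)) (mset Ds)"
    by (rule transforms_reorient) (auto simp: list_all2_conv_all_nth path_def)
  from reach_frame[OF this, of "({#}, C)"]
  have "reach adj \<T> (length Ds) (mset (map path Ds), C) (mset Ds, C)" by simp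
  also note assms(4)
  finally have "reach adj \<T> (length Ds + m) (Ps, Cs) (S' + (R, E))"
    using reach_frame[of _ _ _ _ S' "(R, E)"] unfolding RE by fastforce
  then have "reach adj \<T> 100 (Ps, Cs) (S' + (R, E))" by (rule reach_mono) (use assms(5) in simp)
  then have "potential \<T> (Ps, Cs) \<le> potential \<T> (S' + (R, E))"
    using optimal unfolding local_opt_def by blast
  moreover have "(\<Sum>P\<in>#mset (map path Es). path_weight \<T> P) = (\<Sum>P\<in>#mset Es. path_weight \<T> P)" for Es
    by (induction Es) (auto simp: path_def path_weight_rev)
  then have "potential \<T> (mset (map path Ds), C) = potential \<T> (mset Ds, C)"
    by (simp add: potential_def rest_weight_def)
  ultimately show ?thesis
    using potential_add[of \<T> "(mset (map path Ds), C)" "(R, E)"] potential_add[of \<T> S' "(R, E)"]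
    unfolding RE by simp
qed

lemma path_count_minimal:
  assumes "\<forall>D\<in>set Ds. oriented D" "distinct (map set Ds)"
    and "reach adj \<T> m (mset Ds, {#}) (X, C)" "m + length Ds \<le> 100"
  shows "length Ds \<le> size X"
  using size_paths_le_if_potential_le[OF assms(3)] potential_minimal[OF assms(1,2) _ assms(3,4)]
    assms(4) by simp

text \<open>A cut stands for the path edge between \<open>last A\<close> and \<open>hd B\<close>.\<close>

definition cut :: "'v list \<Rightarrow> 'v list \<Rightarrow> bool" where
  "cut A B \<longleftrightarrow> oriented (A @ B) \<and> A \<noteq> [] \<and> B \<noteq> []"

lemma cutD: "cut A B \<Longrightarrow> oriented (A @ B)" "cut A B \<Longrightarrow> A \<noteq> []" "cut A B \<Longrightarrow> B \<noteq> []"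
  by (auto simp: cut_def)

lemma cut_rev: "cut (rev B) (rev A) \<longleftrightarrow> cut A B"
  using oriented_rev[of "A @ B"] by (auto simp: cut_def)

lemma cut_last_neq_hd: "cut A B \<Longrightarrow> last A \<noteq> hd B"
proof -
  assume cut: "cut A B"
  then have "distinct (A @ B)" by (intro oriented_distinct cutD)
  moreover have "last A \<in> set A" "hd B \<in> set B" using cutD[OF cut] by auto
  ultimately show ?thesis by (auto simp: disjoint_iff)
qed

lemma cut_edgeE:
  assumes "cut A B" "cut A' B'" "{last A, hd B} = {last A', hd B'}"
  obtains (forward) "A' = A" "B' = B" | (backward) "A' = rev B" "B' = rev A"
proof -
  have nonempty': "A' \<noteq> []" "B' \<noteq> []" by (rule cutD[OF assms(2)])+
  note split_eq = append_eq_if_same_edge[OF oriented_distinct[OF cutD(1)[OF assms(1)]] _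
    cutD(2,3)[OF assms(1)]]
  have "last A \<in> {last A', hd B'}" using assms(3) by blast
  moreover have "{last A', hd B'} \<subseteq> set (A' @ B')" using nonempty' by simp
  moreover have "last A \<in> set (A @ B)" using cutD(2)[OF assms(1)] by simp
  ultimately consider (same) "A' @ B' = A @ B" | (reversed) "A' @ B' = rev (A @ B)"
    using oriented_common_vertex[OF cutD(1)[OF assms(1)] cutD(1)[OF assms(2)]] by blast
  then show ?thesis
  proof cases
    case same
    from split_eq[OF same nonempty' assms(3)] that(1) show ?thesis by blast
  next
    case reversed
    then have "rev B' @ rev A' = A @ B" by (metis rev_append rev_rev_ident)
    moreover have "{last A, hd B} = {last (rev B'), hd (rev A')}"
      using nonempty' assms(3) by (simp add: last_rev hd_rev insert_commute)
    ultimately have "rev B' = A \<and> rev A' = B" using nonempty' by (intro split_eq) simp_all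
    then show ?thesis using that(2) by auto
  qed
qed

subsection \<open>Improvements that reduce the number of paths\<close>

lemma endable_not_adj:
  assumes "oriented D" "oriented D'" "set D \<noteq> set D'" "endable D u" "endable D' v"
  shows "\<not> adj u v"
proof
  assume "adj u v"
  with assms obtain Q where "transforms 12 {#D, D'#} {#Q#}"
    by (metis transforms_join_ends oriented_nonempty)
  with path_count_minimal[of "[D, D']" 12 "{#Q#}"] assms(1-3) show False by simp
qed

lemma bridge_not_adj:
  assumes "oriented D" "oriented D'" "cut A B"
    and "set D \<noteq> set D'" "set D \<noteq> set (A @ B)" "set D' \<noteq> set (A @ B)"
    and "endable D u" "endable D' v" "adj u (last A)"
  shows "\<not> adj v (hd B)"
proof
  assume "adj v (hd B)"
  with assms obtain Q Q' where "transforms 20 {#D, D', A @ B#} {#Q, Q'#}"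
    by (metis transforms_bridge oriented_nonempty cutD(2,3))
  with path_count_minimal[of "[D, D', A @ B]" 20 "{#Q, Q'#}"] assms(1-6) show False
    by (simp add: cutD)
qed

lemma insert_not_adj:
  assumes "oriented D" "cut A B" "set D \<noteq> set (A @ B)" "transforms n {#D#} {#D'#}" "n \<le> 5"
    and "adj (last A) (hd D')"
  shows "\<not> adj (last D') (hd B)"
proof
  assume "adj (last D') (hd B)"
  with transforms_insert[OF assms(4) oriented_nonempty[OF assms(1)]] assms(2,6)
  have "transforms (n + 3) {#D, A @ B#} {#A @ D' @ B#}" by (auto dest: cutD)
  with path_count_minimal[of "[D, A @ B]" "n + 3" "{#A @ D' @ B#}"] assms(1-3,5) show False
    by (simp add: cutD)
qed

lemma closable_not_closed:
  assumes "oriented D" "transforms 3 {#D#} {#D'#}" "adj (last D') (hd D')"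
  shows "\<not> closed_wrt \<T> (set D)"
proof
  assume "closed_wrt \<T> (set D)"
  moreover have "mset D' = mset D" by (rule mset_eq_if_transforms[OF assms(2)])
  ultimately have "reach adj \<T> 1 ({#D'#}, {#}) ({#}, {#D'#})"
    using assms(1,3) oriented_nonempty by (intro reach_close) (auto dest: mset_eq_setD)
  from reach_trans[OF assms(2) this] path_count_minimal[of "[D]" "3 + 1" "{#}" "{#D'#}"] assms(1)
  show False by simp
qed

lemma spinnable_not_closed: "oriented D \<Longrightarrow> spinnable D \<Longrightarrow> \<not> closed_wrt \<T> (set D)"
  using closable_not_closed spinnable_transforms_closable by metis

definition straddles :: "'v \<Rightarrow> 'v list \<Rightarrow> 'v list \<Rightarrow> bool" where
  "straddles u A B \<longleftrightarrow> cut A B \<and> u \<notin> set (A @ B) \<and> adj u (last A) \<and> adj u (hd B)"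

lemma straddlesD:
  assumes "straddles u A B"
  shows "cut A B" "oriented (A @ B)" "A \<noteq> []" "B \<noteq> []" "u \<notin> set (A @ B)"
    "adj u (last A)" "adj (last A) u" "adj u (hd B)"
  using assms adj_sym[of u "last A"] unfolding straddles_def cut_def by blast+

lemma straddles_rev: "straddles u (rev B) (rev A) \<longleftrightarrow> straddles u A B"
  unfolding straddles_def cut_rev by (auto simp: hd_rev last_rev dest: cutD)

lemma shift_straddling:
  assumes "oriented D" "transforms n {#D#} {#u # D'#}" "D' \<noteq> []" "straddles u A B"
  shows "transforms (n + 4) {#D, A @ B#} {#D', A @ [u] @ B#}" "set D \<noteq> set (A @ B)"
proof -
  show "transforms (n + 4) {#D, A @ B#} {#D', A @ [u] @ B#}"
    by (rule transforms_shift[OF assms(2,3) straddlesD(3,4,6,8)[OF assms(4)]])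
  show "set D \<noteq> set (A @ B)"
    using straddlesD(5)[OF assms(4)] mset_eq_setD[OF mset_eq_if_transforms[OF assms(2)]] by auto
qed

lemma straddling_successor_not_adj_ends:
  assumes "cut [u] D" "straddles u A B" "w = hd A \<or> w = last B"
  shows "\<not> adj w (hd D)"
proof
  assume "adj w (hd D)"
  have "oriented (u # D)" "D \<noteq> []" using assms(1) by (auto dest: cutD)
  note shift = shift_straddling[OF this(1) reach_refl[of _ _ 0] this(2) assms(2)]
  have "endable (A @ [u] @ B) w"
    using straddlesD(3,4)[OF assms(2)] assms(3) endable_hd[of "A @ [u] @ B"]
      endable_last[of "A @ [u] @ B"] by auto
  then obtain Q where Q: "transforms 12 {#D, A @ [u] @ B#} {#Q#}"
    using transforms_join_ends[OF \<open>D \<noteq> []\<close> _ endable_hd[OF \<open>D \<noteq> []\<close>] _ adj_sym[OF \<open>adj w (hd D)\<close>]]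
    by blast
  from reach_trans[OF shift(1) Q] have "transforms (0 + 4 + 12) {#u # D, A @ B#} {#Q#}" .
  with path_count_minimal[of "[u # D, A @ B]" "0 + 4 + 12" "{#Q#}"] \<open>oriented (u # D)\<close>
    straddlesD(2)[OF assms(2)] shift(2)
  show False by simp
qed

lemma straddling_successor_not_adj_other:
  assumes "cut [u] D" "straddles u A B"
    and "oriented W" "set W \<noteq> set (u # D)" "set W \<noteq> set (A @ B)" "endable W w"
  shows "\<not> adj w (hd D)"
proof
  assume "adj w (hd D)"
  have "oriented (u # D)" "D \<noteq> []" using assms(1) by (auto dest: cutD)
  note shift = shift_straddling[OF this(1) reach_refl[of _ _ 0] this(2) assms(2)]
  obtain Q where Q: "transforms 12 {#W, D#} {#Q#}"
    using transforms_join_ends[OF oriented_nonempty[OF assms(3)] \<open>D \<noteq> []\<close> assms(6)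
        endable_hd[OF \<open>D \<noteq> []\<close>] \<open>adj w (hd D)\<close>] .
  from transforms_frame[OF shift(1), of "{#W#}"]
  have "transforms (0 + 4) {#u # D, A @ B, W#} {#W, D, A @ [u] @ B#}"
    by (simp add: add_mset_commute)
  also from transforms_frame[OF Q, of "{#A @ [u] @ B#}"]
  have "transforms 12 {#W, D, A @ [u] @ B#} {#Q, A @ [u] @ B#}" by (simp add: add_mset_commute)
  finally have "transforms (0 + 4 + 12) {#u # D, A @ B, W#} {#Q, A @ [u] @ B#}" .
  with path_count_minimal[of "[u # D, A @ B, W]" "0 + 4 + 12" "{#Q, A @ [u] @ B#}"]
    \<open>oriented (u # D)\<close> straddlesD(2)[OF assms(2)] assms(3-5) shift(2)
  show False by auto
qed

lemma straddling_rest_not_closed: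
  assumes "oriented D" "transforms 3 {#D#} {#u # D'#}" "D' \<noteq> []" "straddles u A B"
    and "adj (last D') (hd D')"
  shows "\<not> closed_wrt \<T> (set D')"
proof
  assume closed: "closed_wrt \<T> (set D')"
  note shift = shift_straddling[OF assms(1-4)]
  have "reach adj \<T> 1 ({#D', A @ [u] @ B#}, {#}) ({#A @ [u] @ B#}, {#D'#})"
    using assms(3,5) closed by (rule reach_close)
  from reach_trans[OF shift(1) this]
    path_count_minimal[of "[D, A @ B]" "3 + 4 + 1" "{#A @ [u] @ B#}" "{#D'#}"] assms(1)
    straddlesD(2)[OF assms(4)] shift(2)
  show False by simp
qed

lemma two_straddling_same_vertices:
  assumes "cut [a] [b]" "straddles a A B" "straddles b A' B'"
  shows "set (A @ B) = set (A' @ B')"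
proof (rule ccontr)
  assume neq: "\<not> ?thesis"
  have ab: "oriented [a, b]" using assms(1) by (auto dest: cutD)
  note shift = shift_straddling[OF ab reach_refl[of _ _ 0] _ assms(2)]
  have "set [a, b] \<noteq> set (A' @ B')" using straddlesD(5)[OF assms(3)] by auto
  have "transforms (0 + 4) {#[a, b], A @ B, A' @ B'#} {#[b], A' @ B', A @ [a] @ B#}"
    using transforms_frame[OF shift(1), of "{#A' @ B'#}"] by (simp add: add_mset_commute)
  also have "transforms (0 + 3) {#[b], A' @ B', A @ [a] @ B#} {#A' @ [b] @ B', A @ [a] @ B#}"
    using transforms_frame[OF transforms_insert[OF reach_refl[of _ _ 0], of "[b]" A' B'],
        of "{#A @ [a] @ B#}"] straddlesD[OF assms(3)] by (simp add: add_mset_commute)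
  finally have "transforms (0 + 4 + (0 + 3)) {#[a, b], A @ B, A' @ B'#}
      {#A' @ [b] @ B', A @ [a] @ B#}" .
  with path_count_minimal[of "[[a, b], A @ B, A' @ B']" "0 + 4 + (0 + 3)"
    "{#A' @ [b] @ B', A @ [a] @ B#}"]
    ab neq straddlesD(2)[OF assms(2)] straddlesD(2)[OF assms(3)] shift(2)
    \<open>set [a, b] \<noteq> set (A' @ B')\<close>
  show False by simp
qed

lemma two_straddling_same_path:
  assumes "cut [a] [b]" "straddles a A B" "straddles b A' B'" "A' @ B' = A @ B"
  shows False
proof (cases "A' = A")
  case True
  with assms(4) have "B' = B" by simp
  have "oriented [a, b]" using assms(1) by (auto dest: cutD)
  from insert_not_adj[OF this straddlesD(1)[OF assms(2)], of 0 "[a, b]"] show False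
    using straddlesD[OF assms(2)] straddlesD[OF assms(3)] True \<open>B' = B\<close>
    by (auto simp: reach_refl)
next
  case False
  have ab: "oriented [a, b]" using assms(1) by (auto dest: cutD)
  note shift = shift_straddling[OF ab reach_refl[of _ _ 0] _ assms(2)]
  have "\<exists>X Y. A @ [a] @ B = X @ Y \<and> X \<noteq> [] \<and> Y \<noteq> [] \<and> last X = last A' \<and> hd Y = hd B'"
    using assms(4)
  proof (cases rule: append_eq_splitE)
    case (longer C)
    with False have "C \<noteq> []" by auto
    with longer straddlesD(4)[OF assms(3)] show ?thesis
      by (intro exI[of _ "A @ [a] @ C"] exI[of _ B']) auto
  next
    case (shorter C)
    with False have "C \<noteq> []" by auto
    with shorter straddlesD(3)[OF assms(3)] show ?thesis
      by (intro exI[of _ A'] exI[of _ "C @ [a] @ B"]) auto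
  qed
  then obtain X Y where XY: "A @ [a] @ B = X @ Y" "X \<noteq> []" "Y \<noteq> []" "last X = last A'"
    "hd Y = hd B'" by blast
  have "transforms (0 + 4) {#[a, b], A @ B#} {#[b], X @ Y#}" using shift(1) unfolding XY(1) by simp
  also have "transforms (0 + 3) {#[b], X @ Y#} {#X @ [b] @ Y#}"
    by (rule transforms_insert[OF reach_refl]) (use XY straddlesD[OF assms(3)] in auto)
  finally have "transforms (0 + 4 + (0 + 3)) {#[a, b], A @ B#} {#X @ [b] @ Y#}" .
  with path_count_minimal[of "[[a, b], A @ B]" "0 + 4 + (0 + 3)" "{#X @ [b] @ Y#}"] ab
    straddlesD(2)[OF assms(2)] shift(2)
  show False by simp
qed

lemma two_straddling_impossible:
  assumes "cut [a] [b]" "straddles a A B" "straddles b A' B'"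
  shows False
proof -
  have hd_A: "hd A \<in> set (A @ B)" using straddlesD(3)[OF assms(2)] by simp
  then have "hd A \<in> set (A' @ B')" unfolding two_straddling_same_vertices[OF assms] .
  from oriented_common_vertex[OF straddlesD(2)[OF assms(2)] straddlesD(2)[OF assms(3)] hd_A this]
  have "A' @ B' = A @ B \<or> A' @ B' = rev (A @ B)" .
  then show False
  proof
    assume "A' @ B' = rev (A @ B)"
    then have reversed: "rev B' @ rev A' = A @ B" by (metis rev_append rev_rev_ident)
    have "straddles b (rev B') (rev A')" using assms(3) by (simp only: straddles_rev)
    from two_straddling_same_path[OF assms(1,2) this reversed] show False .
  qed (rule two_straddling_same_path[OF assms])
qed

lemma closed_pair_successor_not_adj:
  assumes "cut [a, b] B" "adj a b" "closed_wrt \<T> {a, b}"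
    and "oriented W" "set W \<noteq> set ([a, b] @ B)" "endable W w"
  shows "\<not> adj w (hd B)"
proof
  assume "adj w (hd B)"
  have "B \<noteq> []" using assms(1) by (rule cutD)
  obtain Q where Q: "transforms 12 {#W, B#} {#Q#}"
    using transforms_join_ends[OF oriented_nonempty[OF assms(4)] \<open>B \<noteq> []\<close> assms(6)
        endable_hd[OF \<open>B \<noteq> []\<close>] \<open>adj w (hd B)\<close>] .
  have "reach adj \<T> 2 ({#[a, b] @ B#}, {#}) ({#B#}, {#[a, b]#})"
    using \<open>B \<noteq> []\<close> adj_sym[OF assms(2)] assms(3) by (intro reach_close_prefix) simp_all
  from reach_frame[OF this, of "({#W#}, {#})"]
  have "reach adj \<T> 2 ({#[a, b] @ B, W#}, {#}) ({#W, B#}, {#[a, b]#})"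
    by (simp add: add_mset_commute)
  also from reach_frame[OF Q, of "({#}, {#[a, b]#})"]
  have "reach adj \<T> 12 ({#W, B#}, {#[a, b]#}) ({#Q#}, {#[a, b]#})" by simp
  finally have "reach adj \<T> (2 + 12) ({#[a, b] @ B, W#}, {#}) ({#Q#}, {#[a, b]#})" .
  with path_count_minimal[of "[[a, b] @ B, W]" "2 + 12" "{#Q#}"] cutD(1)[OF assms(1)] assms(4,5)
  show False by simp
qed

lemma closed_pair_successor_not_closed:
  assumes "cut [a, b] [c, d]" "adj a b" "closed_wrt \<T> {a, b}" "adj c d"
  shows "\<not> closed_wrt \<T> {c, d}"
proof
  assume closed: "closed_wrt \<T> {c, d}"
  have "reach adj \<T> 2 ({#[a, b] @ [c, d]#}, {#}) ({#[c, d]#}, {#[a, b]#})"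
    using adj_sym[OF assms(2)] assms(3) by (intro reach_close_prefix) simp_all
  also have "reach adj \<T> 1 ({#[c, d]#}, {#[a, b]#}) ({#}, {#[c, d], [a, b]#})"
    using adj_sym[OF assms(4)] closed by (intro reach_close) simp_all
  finally show False
    using path_count_minimal[of "[[a, b] @ [c, d]]" "2 + 1" "{#}"] cutD(1)[OF assms(1)] by simp
qed

subsection \<open>Improvements of the lower-order terms of the potential\<close>

lemma endable_cycle_not_adj:
  assumes "oriented D" "endable D u" "c \<in># Cs" "v \<in> set c"
  shows "\<not> adj u v"
proof
  assume "adj u v"
  with assms(1,2,4) obtain D' where D': "reach adj \<T> 7 ({#D#}, {#c#}) ({#D'#}, {#})"
    by (metis reach_absorb_cycle oriented_nonempty)
  with potential_minimal[of "[D]" "{#c#}" 7] assms(1,3)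
  have "potential \<T> ({#D#}, {#c#}) \<le> potential \<T> ({#D'#}, {#})" by simp
  with rest_weight_reach[OF D'] show False by (simp add: potential_def)
qed

lemma chord_not_closed:
  assumes "cut A B" "2 \<le> length A" "adj (hd A) (hd B)"
  shows "\<not> closed_wrt \<T> {hd A, hd B}"
proof
  assume closed: "closed_wrt \<T> {hd A, hd B}"
  have "A \<noteq> []" "B \<noteq> []" "oriented (A @ B)" using assms(1) by (auto dest: cutD)
  then have dist: "distinct (A @ B)" and "hd B \<in> U"
    using oriented_distinct[of "A @ B"] oriented_subset[of "A @ B"] by auto
  have "hd A \<noteq> last A" using dist assms(2) by (cases A) auto
  moreover have "hd A \<noteq> hd B" "last A \<noteq> hd B"
    using dist \<open>A \<noteq> []\<close> \<open>B \<noteq> []\<close> by (metis disjoint_iff distinct_append hd_in_set last_in_set)+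
  ultimately have "\<not> closed_wrt \<T> {last A, hd B}"
    using closed singleton_not_closed[OF \<open>hd B \<in> U\<close>] unfolding closed_wrt_def by blast
  then have "path_weight \<T> (rev A @ B) < path_weight \<T> (A @ B)"
    using closed \<open>A \<noteq> []\<close> \<open>B \<noteq> []\<close>
    by (simp add: path_weight_def unlocked_append unlocked_rev last_rev)
  moreover have "potential \<T> ({#A @ B#}, {#}) \<le> potential \<T> ({#rev A @ B#}, {#})"
    using potential_minimal[of "[A @ B]" "{#}" 3] \<open>oriented (A @ B)\<close>
      transforms_rev_prefix[OF \<open>A \<noteq> []\<close> \<open>B \<noteq> []\<close> assms(3)] by simp
  ultimately show False by (simp add: potential_def rest_weight_def)
qed

lemma single_not_adj_long:
  assumes "oriented [u]" "oriented (L @ x # M)" "u \<notin> set (L @ x # M)"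
    and "L \<noteq> []" "M \<noteq> []" "4 \<le> length (L @ x # M)"
  shows "\<not> adj u x"
proof
  assume "adj u x"
  then obtain X where "transforms 3 {#[u], L @ x # M#} X"
    "potential \<T> (X, {#}) + 2 < potential \<T> ({#[u], L @ x # M#}, {#})"
    using assms(4-6) by (rule absorb_single_path)
  with potential_minimal[of "[[u], L @ x # M]" "{#}" 3 "(X, {#})"] assms(1-3) show False by auto
qed

text \<open>Exchanging \<open>u\<close> with the leaf \<open>q\<close> increases the potential by at most 2, so that \<open>q\<close> inherits the
  restrictions on one-vertex paths.\<close>

lemma star_leaf_not_adj_long:
  assumes "oriented [u]" "oriented [q, y, r]" "adj u y" "u \<notin> {q, y, r}"
    and "oriented (L @ x # M)" "u \<notin> set (L @ x # M)" "set [q, y, r] \<noteq> set (L @ x # M)"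
    and "L \<noteq> []" "M \<noteq> []" "4 \<le> length (L @ x # M)"
  shows "\<not> adj q x"
proof
  let ?W = "L @ x # M"
  assume "adj q x"
  then obtain X where X: "transforms 3 {#[q], ?W#} X"
    "potential \<T> (X, {#}) + 2 < potential \<T> ({#[q], ?W#}, {#})"
    using assms(8-10) by (rule absorb_single_path)
  have "transforms 1 {#[u], [q, y, r], ?W#} {#[u], [y, r], [q], ?W#}"
    using transforms_split[of "[q]" "[y, r]" "{#[u], ?W#}"] by (simp add: add_mset_commute)
  also have "transforms 1 {#[u], [y, r], [q], ?W#} {#[q], ?W, [u, y, r]#}"
    using transforms_join[of "[u]" "[y, r]" "{#[q], ?W#}"] assms(3) by (simp add: add_mset_commute)
  also have "transforms 3 {#[q], ?W, [u, y, r]#} (X + {#[u, y, r]#})"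
    using transforms_frame[OF X(1), of "{#[u, y, r]#}"] by (simp add: add_mset_commute)
  finally have "potential \<T> ({#[u], [q, y, r], ?W#}, {#}) \<le> potential \<T> (X + {#[u, y, r]#}, {#})"
    using potential_minimal[of "[[u], [q, y, r], ?W]" "{#}" "1 + 1 + 3" "(X + {#[u, y, r]#}, {#})"]
      assms(1,2,4-7) by auto
  also have "\<dots> = potential \<T> (X, {#}) + potential \<T> ({#[u, y, r]#}, {#})"
    using potential_add[of \<T> "(X, {#})" "({#[u, y, r]#}, {#})"] by simp
  moreover have "potential \<T> ({#[q], ?W#}, {#}) + potential \<T> ({#[u, y, r]#}, {#})
      \<le> potential \<T> ({#[u], [q, y, r], ?W#}, {#}) + 2"
    by (simp add: potential_def rest_weight_def path_weight_def)
  ultimately show False using X(2) by linarith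
qed

lemma two_path_not_adj_long:
  assumes "oriented [u, v]" "oriented (L @ x # M)" "u \<notin> set (L @ x # M)" "3 \<le> length M"
  shows "\<not> adj u x"
proof
  assume "adj u x"
  have "transforms 2 {#[u, v], L @ x # M#} {#(L @ [x]) @ [u, v], M#}"
    using adj_sym[OF \<open>adj u x\<close>] assms(4) by (intro transforms_attach) auto
  then have "potential \<T> ({#[u, v], L @ x # M#}, {#}) \<le>
      potential \<T> ({#(L @ [x]) @ [u, v], M#}, {#})"
    using potential_minimal[of "[[u, v], L @ x # M]" "{#}" 2] assms(1-3) by auto
  then show False using unlocked_attach_le[of \<T> L x "[u, v]" M] assms(4)
    by (simp add: potential_def rest_weight_def path_weight_def split: if_splits)
qed

end

section \<open>Charging slots to path edges\<close>

definition edges_at :: "('v set \<times> bool) set \<Rightarrow> 'v \<Rightarrow> ('v set \<times> bool) set" where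
  "edges_at X v = {e \<in> X. v \<in> fst e}"

type_synonym 'v slot = "'v \<times> 'v set \<times> bool"

text \<open>\<open>G\<close> stands for the edges of weight 1 between terminals in an optimal solution; the flag
  distinguishes parallel edges. A slot is a vertex together with an edge of \<open>G\<close> at this vertex.\<close>

locale charging = local_optimum adj \<T> U Ps Cs
  for adj :: "'v \<Rightarrow> 'v \<Rightarrow> bool" and \<T> U Ps Cs +
  fixes G :: "('v set \<times> bool) set"
  assumes finite_G: "finite G"
    and G_edge: "e \<in> G \<Longrightarrow> \<exists>u v. fst e = {u, v} \<and> u \<in> U \<and> v \<in> U \<and> adj u v"
    and G_degree: "v \<in> U \<Longrightarrow> card (edges_at G v) \<le> 2"
    and G_closed: "X \<subseteq> U \<Longrightarrow>
      (\<And>v. v \<in> X \<Longrightarrow> card (edges_at G v) = 2 \<and> (\<forall>e\<in>edges_at G v. fst e \<subseteq> X)) \<Longrightarrow>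
      closed_wrt \<T> X"
begin

definition deficit :: "'v \<Rightarrow> nat" where
  "deficit v = 2 - card (edges_at G v)"

lemma finite_edges_at: "finite (edges_at G v)"
  using finite_G by (simp add: edges_at_def)

lemma card_edges_at_deficit: "v \<in> U \<Longrightarrow> card (edges_at G v) + deficit v = 2"
  using G_degree by (simp add: deficit_def)

lemma edges_at_eq_pair:
  assumes "v \<in> U" "e1 \<in> edges_at G v" "e2 \<in> edges_at G v" "e1 \<noteq> e2"
  shows "edges_at G v = {e1, e2}"
  using card_seteq[OF finite_edges_at, of "{e1, e2}" v] G_degree[OF assms(1)] assms(2-4) by simp

lemma G_edgeD:
  assumes "e \<in> G" "fst e = {u, x}"
  shows "adj u x" "u \<noteq> x" "u \<in> U" "x \<in> U" "e \<in> edges_at G u" "e \<in> edges_at G x"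
proof -
  from G_edge[OF assms(1)] obtain a b where "fst e = {a, b}" "a \<in> U" "b \<in> U" "adj a b" by blast
  then show "adj u x" "u \<in> U" "x \<in> U"
    using assms(2) adj_sym[of a b] by (auto simp: doubleton_eq_iff)
  then show "u \<noteq> x" "e \<in> edges_at G u" "e \<in> edges_at G x"
    using assms adj_irrefl by (auto simp: edges_at_def)
qed

lemma edges_atE:
  assumes "e \<in> edges_at G u"
  obtains x where "e \<in> G" "fst e = {u, x}"
proof -
  have "e \<in> G" "u \<in> fst e" using assms by (auto simp: edges_at_def)
  moreover from G_edge[OF this(1)] obtain a b where "fst e = {a, b}" by blast
  ultimately have "fst e = {u, a} \<or> fst e = {u, b}" by auto
  with \<open>e \<in> G\<close> that show ?thesis by blast
qed

lemma parallel_closed: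
  assumes "e \<in> G" "e' \<in> G" "e \<noteq> e'" "fst e = {a, b}" "fst e' = {a, b}"
  shows "closed_wrt \<T> {a, b}"
proof (rule G_closed)
  show "{a, b} \<subseteq> U" using G_edgeD[OF assms(1,4)] by simp
  fix v assume "v \<in> {a, b}"
  then have "edges_at G v = {e, e'}"
    using assms G_edgeD[OF assms(1,4)] by (intro edges_at_eq_pair) (auto simp: edges_at_def)
  with assms(3-5) show "card (edges_at G v) = 2 \<and> (\<forall>e\<in>edges_at G v. fst e \<subseteq> {a, b})" by simp
qed

lemma pair_path_edge_unique:
  assumes "oriented P" "length P = 2" "e \<in> G" "fst e = set P" "e' \<in> G" "fst e' = set P"
  shows "e' = e"
proof (rule ccontr)
  assume "e' \<noteq> e"
  from assms(2) obtain a b where P: "P = [a, b]" by (auto simp: length_Suc_conv numeral_2_eq_2)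
  have "closed_wrt \<T> {a, b}" using parallel_closed[OF assms(5,3) \<open>e' \<noteq> e\<close>] assms(4,6) P by simp
  moreover have "adj b a" using G_edgeD(1)[of e b a] assms(3,4) P by auto
  ultimately show False using closable_not_closed[OF assms(1) reach_refl] P by simp
qed

text \<open>The second of two parallel edges of \<open>G\<close> needs a charging rule of its own.\<close>

definition primary :: "'v set \<times> bool \<Rightarrow> bool" where
  "primary e \<longleftrightarrow> \<not> (snd e \<and> (fst e, False) \<in> G)"

lemma primary_unique:
  "e \<in> G \<Longrightarrow> e' \<in> G \<Longrightarrow> fst e = fst e' \<Longrightarrow> primary e \<Longrightarrow> primary e' \<Longrightarrow> e = e'"
  unfolding primary_def by (cases e; cases e'; cases "snd e"; cases "snd e'") auto

lemma not_primaryD: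
  assumes "\<not> primary e"
  shows "snd e" "(fst e, False) \<in> G" "(fst e, False) \<noteq> e"
  using assms unfolding primary_def by (cases e; simp)+

definition rigid_cut :: "'v list \<Rightarrow> 'v list \<Rightarrow> bool" where
  "rigid_cut A B \<longleftrightarrow> cut A B \<and> \<not> spinnable (A @ B)"

lemma rigid_cutD:
  assumes "rigid_cut A B"
  shows "cut A B" "oriented (A @ B)" "A \<noteq> []" "B \<noteq> []" "\<not> spinnable (A @ B)"
  using assms by (auto simp: rigid_cut_def dest: cutD)

lemma outside_neighbourE:
  assumes "oriented D" "endable D u" "e \<in> G" "fst e = {u, x}" "x \<notin> set D"
  obtains L M where "rigid_cut L (x # M)" "M \<noteq> []" "set D \<inter> set (L @ x # M) = {}"
proof -
  have "adj u x" "x \<in> U" using G_edgeD[OF assms(3,4)] by auto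
  then have "x \<in># vertices (Ps, Cs)" unfolding cover using finite_U by simp
  moreover have "x \<notin> set c" if "c \<in># Cs" for c
    using endable_cycle_not_adj[OF assms(1,2) that] \<open>adj u x\<close> by blast
  ultimately obtain W where W: "W \<in># Ps" "x \<in> set W" by (auto simp: vertices_def)
  from W(2) obtain L M where LM: "W = L @ x # M" by (auto simp: in_set_conv_decomp)
  have oriented: "oriented W" using W(1) by (rule oriented_path)
  have "set D \<noteq> set W" using assms(5) W(2) by auto
  from endable_not_adj[OF assms(1) oriented this assms(2)] have "\<not> endable W x"
    using \<open>adj u x\<close> by blast
  moreover have "endable W (hd W)" "endable W (last W)"
    using W(2) by (auto intro: endable_hd endable_last)
  ultimately have "L \<noteq> []" "M \<noteq> []" unfolding LM by auto
  moreover have "\<not> spinnable W" using endable_spinnable[of W x] W(2) \<open>\<not> endable W x\<close> by blast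
  ultimately show ?thesis
    using that[of L M] oriented oriented_disjoint[OF assms(1) oriented \<open>set D \<noteq> set W\<close>]
    unfolding LM rigid_cut_def cut_def by simp
qed

subsection \<open>Slots of spinnable paths\<close>

definition leaving_slots :: "'v list \<Rightarrow> 'v slot set" where
  "leaving_slots P = {(v, e). v \<in> set P \<and> e \<in> edges_at G v \<and> \<not> fst e \<subseteq> set P}"

definition loose :: "'v list \<Rightarrow> 'v \<Rightarrow> bool" where
  "loose P v \<longleftrightarrow> v \<in> set P \<and> (deficit v \<noteq> 0 \<or> (\<exists>e. (v, e) \<in> leaving_slots P))"

lemma not_looseD:
  assumes "P \<in># Ps" "v \<in> set P" "\<not> loose P v"
  shows "card (edges_at G v) = 2" "\<And>e. e \<in> edges_at G v \<Longrightarrow> fst e \<subseteq> set P"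
proof -
  have inside: "deficit v = 0" "\<And>e. (v, e) \<notin> leaving_slots P"
    using assms(2,3) by (auto simp: loose_def)
  then show "fst e \<subseteq> set P" if "e \<in> edges_at G v" for e
    using assms(2) that unfolding leaving_slots_def by blast
  have "v \<in> U" using oriented_subset[OF oriented_path[OF assms(1)]] assms(2) by blast
  then show "card (edges_at G v) = 2" using card_edges_at_deficit[of v] inside(1) by simp
qed

lemma ex_loose:
  assumes "P \<in># Ps" "spinnable P"
  obtains v where "loose P v"
proof -
  have "\<exists>v\<in>set P. loose P v"
  proof (rule ccontr)
    assume "\<not> ?thesis"
    then have "card (edges_at G v) = 2 \<and> (\<forall>e\<in>edges_at G v. fst e \<subseteq> set P)" if "v \<in> set P" for v
      using not_looseD[OF assms(1) that] that by simp
    with oriented_subset[OF oriented_path[OF assms(1)]] have "closed_wrt \<T> (set P)"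
      by (rule G_closed)
    then show False using spinnable_not_closed[OF oriented_path[OF assms(1)] assms(2)] by simp
  qed
  then show ?thesis using that by blast
qed

lemma loose_slot:
  assumes "loose P v"
  obtains X where "X \<subseteq> leaving_slots P" "finite X" "card X \<le> 1" "1 \<le> card X + deficit v"
    "fst ` X \<subseteq> {v}"
proof (cases "deficit v = 0")
  case True
  with assms obtain e where "(v, e) \<in> leaving_slots P" by (auto simp: loose_def)
  then show ?thesis by (intro that[of "{(v, e)}"]) auto
next
  case False
  then show ?thesis by (intro that[of "{}"]) auto
qed

text \<open>Every vertex of a spinnable path can become an end, so none of its edges is charged from outside:
  with five vertices or more its own edges pay for it, otherwise the missing units come from the
  selected leaving slots or from deficits.\<close>

definition selectable :: "'v list \<Rightarrow> 'v slot set \<Rightarrow> bool" where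
  "selectable P X \<longleftrightarrow> X \<subseteq> leaving_slots P \<and>
     5 \<le> card X + (\<Sum>v\<in>set P. deficit v) + length P \<and>
     (\<forall>s\<in>X. \<forall>s'\<in>X. s \<noteq> s' \<longrightarrow> length P = 3 \<and> (fst s = fst s' \<longrightarrow>
       (\<exists>b c. set P = {fst s, b, c} \<and> adj b c \<and> closed_wrt \<T> {b, c})))"

lemma selectable_if_one_loose:
  assumes "loose P v" "4 \<le> length P"
  shows "\<exists>X. selectable P X"
proof -
  from assms(1) obtain X where X: "X \<subseteq> leaving_slots P" "finite X" "card X \<le> 1"
    "1 \<le> card X + deficit v"
    by (rule loose_slot)
  have "deficit v \<le> (\<Sum>v\<in>set P. deficit v)"
    using assms(1) by (intro member_le_sum) (auto simp: loose_def)
  then have "selectable P X"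
    using X assms(2) unfolding selectable_def by (auto simp: card_le_Suc0_iff_eq)
  then show ?thesis ..
qed

lemma selectable_if_two_loose:
  assumes "loose P v" "loose P w" "v \<noteq> w" "length P = 3"
  shows "\<exists>X. selectable P X"
proof -
  from assms(1) obtain X where X: "X \<subseteq> leaving_slots P" "finite X" "card X \<le> 1"
    "1 \<le> card X + deficit v" "fst ` X \<subseteq> {v}" by (rule loose_slot)
  from assms(2) obtain Y where Y: "Y \<subseteq> leaving_slots P" "finite Y" "card Y \<le> 1"
    "1 \<le> card Y + deficit w" "fst ` Y \<subseteq> {w}" by (rule loose_slot)
  have "X \<inter> Y = {}" using X(5) Y(5) assms(3) by fastforce
  then have "card (X \<union> Y) = card X + card Y" using X(2) Y(2) by (rule card_Un_disjoint[rotated 2])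
  moreover have "deficit v + deficit w \<le> (\<Sum>v\<in>set P. deficit v)"
    using sum_mono2[of "set P" "{v, w}" deficit] assms(1-3) by (auto simp: loose_def)
  ultimately have "5 \<le> card (X \<union> Y) + (\<Sum>v\<in>set P. deficit v) + length P"
    using X(4) Y(4) assms(4) by linarith
  moreover have "fst s \<noteq> fst s'" if "s \<in> X \<union> Y" "s' \<in> X \<union> Y" "s \<noteq> s'" for s s'
  proof -
    have "s = s'" if "s \<in> X \<and> s' \<in> X \<or> s \<in> Y \<and> s' \<in> Y"
      using that X(2,3) Y(2,3) by (auto simp: card_le_Suc0_iff_eq)
    then show ?thesis using that X(5) Y(5) assms(3) by fastforce
  qed
  ultimately have "selectable P (X \<union> Y)"
    using X(1) Y(1) assms(4) unfolding selectable_def by blast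
  then show ?thesis ..
qed

lemma not_loose_triangle_edge:
  assumes "P \<in># Ps" "set P = {z, a, b}" "a \<noteq> b" "\<not> loose P a" "e \<in> edges_at G a"
  shows "fst e = {a, b} \<or> fst e = {a, z}"
proof -
  from assms(5) obtain x where x: "e \<in> G" "fst e = {a, x}" by (rule edges_atE)
  have "fst e \<subseteq> {z, a, b}" using not_looseD(2)[OF assms(1) _ assms(4,5)] assms(2) by blast
  then show ?thesis using x G_edgeD(2)[OF x] by auto
qed

lemma one_loose_parallel_edges:
  assumes "P \<in># Ps" "set P = {z, a, b}" "distinct [z, a, b]" "loose P z" "\<not> loose P a" "\<not> loose P b"
  obtains e1 e2 where "edges_at G a = {e1, e2}" "e1 \<noteq> e2" "fst e1 = {a, b}" "fst e2 = {a, b}"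
proof -
  have U: "a \<in> U" "b \<in> U" "z \<in> U"
    using oriented_subset[OF oriented_path[OF assms(1)]] assms(2) by auto
  obtain e1 e2 where edges_a: "edges_at G a = {e1, e2}" "e1 \<noteq> e2"
    using not_looseD(1)[OF assms(1) _ assms(5)] assms(2) by (auto simp: card_2_iff)
  obtain d1 d2 where edges_b: "edges_at G b = {d1, d2}" "d1 \<noteq> d2"
    using not_looseD(1)[OF assms(1) _ assms(6)] assms(2) by (auto simp: card_2_iff)
  have to_a: "fst d = {a, b}" if "d \<in> edges_at G b" "fst d \<noteq> {b, z}" for d
    using not_loose_triangle_edge[of P z b a d] assms that by auto
  have not_z: "fst e \<noteq> {a, z}" if e: "e \<in> edges_at G a" for e
  proof
    assume az: "fst e = {a, z}"
    show False
    proof (cases "\<exists>d\<in>edges_at G b. fst d = {b, z}")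
      case True
      then obtain d where d: "d \<in> edges_at G b" "fst d = {b, z}" by blast
      have "e \<noteq> d" using az d assms(3) by (auto simp: doubleton_eq_iff)
      then have "edges_at G z = {e, d}"
        using e az d U by (intro edges_at_eq_pair) (auto simp: edges_at_def)
      then have "\<not> loose P z"
        using az d assms(2) \<open>e \<noteq> d\<close> by (auto simp: loose_def leaving_slots_def deficit_def)
      then show False using assms(4) by blast
    next
      case False
      then have "fst d1 = {a, b}" "fst d2 = {a, b}" using to_a edges_b(1) by blast+
      then have "d1 \<in> edges_at G a" "d2 \<in> edges_at G a"
        using edges_b(1) by (auto simp: edges_at_def)
      then have "edges_at G a = {d1, d2}" using edges_b(2) U(1) by (intro edges_at_eq_pair)
      then have "fst e = {a, b}" using e \<open>fst d1 = {a, b}\<close> \<open>fst d2 = {a, b}\<close> by auto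
      then show False using az assms(3) by (auto simp: doubleton_eq_iff)
    qed
  qed
  have "fst e = {a, b}" if "e \<in> edges_at G a" for e
    using not_loose_triangle_edge[OF assms(1,2) _ assms(5) that] not_z[OF that] assms(3) by auto
  with edges_a that show ?thesis by auto
qed

lemma selectable_if_only_loose:
  assumes "P \<in># Ps" "set P = {z, a, b}" "distinct [z, a, b]" "loose P z" "\<not> loose P a" "\<not> loose P b"
    and "length P = 3"
  shows "\<exists>X. selectable P X"
proof -
  from assms(1-6) obtain e1 e2 where edges_a: "edges_at G a = {e1, e2}" "e1 \<noteq> e2"
    "fst e1 = {a, b}" "fst e2 = {a, b}" by (rule one_loose_parallel_edges)
  have in_G: "e1 \<in> G" "e2 \<in> G" using edges_a(1) by (auto simp: edges_at_def)
  note e1 = G_edgeD[OF in_G(1) edges_a(3)]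
  have edges_b: "edges_at G b = {e1, e2}"
    using e1(4,6) edges_a(2) G_edgeD(6)[OF in_G(2) edges_a(4)] by (intro edges_at_eq_pair)
  have not_ab: "a \<notin> fst e" "b \<notin> fst e" if "e \<in> edges_at G z" for e
  proof -
    have e: "e \<in> G" "z \<in> fst e" using that by (simp_all add: edges_at_def)
    then have "fst e \<noteq> {a, b}" using assms(3) by auto
    then have "e \<notin> edges_at G a" "e \<notin> edges_at G b" using edges_a edges_b by auto
    then show "a \<notin> fst e" "b \<notin> fst e" using e(1) by (simp_all add: edges_at_def)
  qed
  have "\<not> fst e \<subseteq> set P" if e: "e \<in> edges_at G z" for e
  proof -
    from e obtain x where x: "e \<in> G" "fst e = {z, x}" by (rule edges_atE)
    then show ?thesis using not_ab[OF e] G_edgeD(2)[OF x] assms(2) by auto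
  qed
  then have leaving: "{z} \<times> edges_at G z \<subseteq> leaving_slots P"
    using assms(2) by (auto simp: leaving_slots_def)
  have "z \<in> U" using oriented_subset[OF oriented_path[OF assms(1)]] assms(2) by auto
  then have "card ({z} \<times> edges_at G z) + deficit z = 2"
    using card_edges_at_deficit by (simp add: card_cartesian_product_singleton)
  moreover have "deficit z \<le> (\<Sum>v\<in>set P. deficit v)"
    unfolding assms(2) by (intro member_le_sum) auto
  ultimately have "selectable P ({z} \<times> edges_at G z)"
    using leaving assms(2,7) e1(1) parallel_closed[OF in_G edges_a(2-4)]
    unfolding selectable_def by auto
  then show ?thesis ..
qed

lemma ex_selectable:
  assumes "P \<in># Ps" "spinnable P"
  shows "\<exists>X. selectable P X"
proof -
  from assms obtain z where z: "loose P z" by (rule ex_loose)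
  show ?thesis
  proof (cases "4 \<le> length P")
    case True
    with z show ?thesis by (rule selectable_if_one_loose)
  next
    case False
    then have len: "length P = 3" using assms(2) by (simp add: spinnable_def)
    have "z \<in> set P" using z by (simp add: loose_def)
    moreover have "card (set P) = 3"
      using distinct_card[OF oriented_distinct[OF oriented_path[OF assms(1)]]] len by simp
    ultimately have "card (set P - {z}) = 2" by (simp add: card_Diff_singleton)
    then obtain a b where "set P - {z} = {a, b}" "a \<noteq> b" by (auto simp: card_2_iff)
    with \<open>z \<in> set P\<close> have P: "set P = {z, a, b}" "distinct [z, a, b]" by auto
    show ?thesis
    proof (cases "loose P a \<or> loose P b")
      case True
      then show ?thesis using selectable_if_two_loose[OF z _ _ len] P(2) by auto
    next
      case False
      then show ?thesis using selectable_if_only_loose[OF assms(1) P z _ _ len] by blast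
    qed
  qed
qed

definition selection :: "'v list \<Rightarrow> 'v slot set" where
  "selection P = (SOME X. selectable P X)"

lemma selectable_selection: "P \<in># Ps \<Longrightarrow> spinnable P \<Longrightarrow> selectable P (selection P)"
  unfolding selection_def using ex_selectable by (rule someI_ex)

subsection \<open>The charging slots\<close>

text \<open>The edge of a two-vertex path provides a slot for only one of its ends.\<close>

definition end_slots :: "'v list \<Rightarrow> 'v slot set" where
  "end_slots P = (if spinnable P then selection P
     else SIGMA u:{hd P, last P}. {e \<in> edges_at G u. \<not> (u = last P \<and> fst e = set P)})"

definition charging_slots :: "'v slot set" where
  "charging_slots = (\<Union>P\<in>set_mset Ps. end_slots P)"

lemma end_slotsD:
  assumes "P \<in># Ps" "(u, e) \<in> end_slots P"
  shows "u \<in> set P" "endable P u" "e \<in> edges_at G u" "\<not> spinnable P \<Longrightarrow> u = hd P \<or> u = last P"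
    "spinnable P \<Longrightarrow> \<not> fst e \<subseteq> set P"
proof -
  have "P \<noteq> []" using assms(1) nonempty by auto
  have "u \<in> set P \<and> endable P u \<and> e \<in> edges_at G u \<and> (\<not> spinnable P \<longrightarrow> u = hd P \<or> u = last P) \<and>
    (spinnable P \<longrightarrow> \<not> fst e \<subseteq> set P)"
  proof (cases "spinnable P")
    case True
    with assms selectable_selection[of P] have "(u, e) \<in> leaving_slots P"
      by (auto simp: end_slots_def selectable_def)
    then show ?thesis using True endable_spinnable[OF True, of u] by (auto simp: leaving_slots_def)
  next
    case False
    with assms(2) have "u = hd P \<or> u = last P" "e \<in> edges_at G u" by (auto simp: end_slots_def)
    then show ?thesis
      using False \<open>P \<noteq> []\<close> endable_hd[of P] endable_last[of P] by auto
  qed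
  then show "u \<in> set P" "endable P u" "e \<in> edges_at G u" "\<not> spinnable P \<Longrightarrow> u = hd P \<or> u = last P"
    "spinnable P \<Longrightarrow> \<not> fst e \<subseteq> set P" by blast+
qed

lemma charging_slots_edge: "(u, e) \<in> charging_slots \<Longrightarrow> e \<in> edges_at G u"
  unfolding charging_slots_def using end_slotsD(3) by blast

lemma charging_slots_in_G: "(u, e) \<in> charging_slots \<Longrightarrow> e \<in> G"
  using charging_slots_edge[of u e] by (simp add: edges_at_def)

text \<open>Both slots of such an end \<open>u\<close> would be charged to the path edge that it straddles. Moving \<open>u\<close>
  into this edge makes its neighbour an end, which therefore is not hit from outside. This leaves
  the path edge at \<open>u\<close> free for one of the two slots, called \<open>dropped u\<close>.\<close>

definition straddling_end :: "'v \<Rightarrow> bool" where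
  "straddling_end u \<longleftrightarrow> (\<exists>D. rigid_cut [u] D) \<and>
     (\<exists>A B. cut A B \<and> u \<notin> set (A @ B) \<and> (\<exists>e\<in>G. fst e = {u, last A}) \<and> (\<exists>e\<in>G. fst e = {u, hd B}))"

definition dropped :: "'v \<Rightarrow> 'v set \<times> bool" where
  "dropped u = (SOME e. e \<in> edges_at G u)"

lemma straddling_endE:
  assumes "straddling_end u"
  obtains A B e1 e2 where "straddles u A B" "edges_at G u = {e1, e2}"
    "fst e1 = {u, last A}" "fst e2 = {u, hd B}"
proof -
  from assms obtain A B e1 e2 where AB: "cut A B" "u \<notin> set (A @ B)" and
    e: "e1 \<in> G" "e2 \<in> G" "fst e1 = {u, last A}" "fst e2 = {u, hd B}"
    unfolding straddling_end_def by blast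
  note e1 = G_edgeD[OF e(1,3)] and e2 = G_edgeD[OF e(2,4)]
  have "e1 \<noteq> e2" using e(3,4) cut_last_neq_hd[OF AB(1)] by (auto simp: doubleton_eq_iff)
  with e1 e2 have "edges_at G u = {e1, e2}" by (intro edges_at_eq_pair)
  moreover have "straddles u A B" using AB e1(1) e2(1) by (simp add: straddles_def)
  ultimately show ?thesis using that e(3,4) by blast
qed

lemma straddling_end_edge_not_subset:
  assumes "straddling_end u" "e \<in> edges_at G u" "oriented D" "u \<in> set D"
  shows "\<not> fst e \<subseteq> set D"
proof -
  from assms(1) obtain A B e1 e2 where AB: "straddles u A B" "edges_at G u = {e1, e2}"
    "fst e1 = {u, last A}" "fst e2 = {u, hd B}" by (rule straddling_endE)
  have "set D \<noteq> set (A @ B)" using assms(4) straddlesD(5)[OF AB(1)] by auto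
  from oriented_disjoint[OF assms(3) straddlesD(2)[OF AB(1)] this]
  have "last A \<notin> set D" "hd B \<notin> set D" using straddlesD(3,4)[OF AB(1)] by (auto simp: disjoint_iff)
  then show ?thesis using assms(2) AB(2-4) by auto
qed

lemma dropped_edge: "straddling_end u \<Longrightarrow> dropped u \<in> edges_at G u"
  unfolding dropped_def by (rule someI_ex) (blast elim: straddling_endE)

definition incoming_slots :: "'v \<Rightarrow> 'v slot set" where
  "incoming_slots x = {(u, e). (u, e) \<in> charging_slots \<and> fst e = {u, x} \<and>
     (\<forall>D. oriented D \<longrightarrow> u \<in> set D \<longrightarrow> x \<notin> set D) \<and> \<not> (straddling_end u \<and> e = dropped u)}"

lemma incoming_slotsE:
  assumes "(u, e) \<in> incoming_slots x" "oriented D" "x \<in> set D"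
  obtains W where "W \<in># Ps" "(u, e) \<in> end_slots W" "set W \<noteq> set D" "u \<notin> set D"
    "e \<in> G" "fst e = {u, x}" "adj u x" "\<not> (straddling_end u \<and> e = dropped u)"
proof -
  from assms(1) obtain W where W: "W \<in># Ps" "(u, e) \<in> end_slots W" "fst e = {u, x}"
    "\<forall>D. oriented D \<longrightarrow> u \<in> set D \<longrightarrow> x \<notin> set D" "\<not> (straddling_end u \<and> e = dropped u)"
    unfolding incoming_slots_def charging_slots_def by auto
  have "e \<in> G" using end_slotsD(3)[OF W(1,2)] by (simp add: edges_at_def)
  moreover have "u \<notin> set D" using W(4) assms(2,3) by blast
  moreover have "set W \<noteq> set D" using end_slotsD(1)[OF W(1,2)] \<open>u \<notin> set D\<close> by auto
  ultimately show ?thesis using that[OF W(1,2)] W(3,5) G_edgeD(1)[OF _ W(3)] by blast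
qed

subsection \<open>Path edges for the slots that hit a path from outside\<close>

definition blocked :: "'v list \<Rightarrow> 'v \<Rightarrow> bool" where
  "blocked A x \<longleftrightarrow> (\<exists>e\<in>G. fst e = {last A, x} \<or> fst e = {hd A, x})"

text \<open>The path edges at \<open>x\<close> that are not already charged from inside the path of \<open>x\<close>.\<close>

definition free_edges :: "'v \<Rightarrow> 'v set set" where
  "free_edges x = {{last A, x} | A B. rigid_cut A B \<and> hd B = x \<and> \<not> blocked A x}"

lemma finite_free_edges: "finite (free_edges x)"
proof (rule finite_subset)
  show "free_edges x \<subseteq> Pow U"
    unfolding free_edges_def using oriented_subset rigid_cutD(2-4)
    by (force simp: subset_iff)
qed (simp add: finite_U)

lemma finite_incoming_slots: "finite (incoming_slots x)"
proof (rule finite_subset)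
  show "incoming_slots x \<subseteq> U \<times> G"
  proof
    fix s assume s: "s \<in> incoming_slots x"
    then have "snd s \<in> edges_at G (fst s)"
      using charging_slots_edge by (auto simp: incoming_slots_def)
    then obtain y where "snd s \<in> G" "fst (snd s) = {fst s, y}" by (rule edges_atE)
    with G_edgeD(3) show "s \<in> U \<times> G" by (auto simp: mem_Times_iff)
  qed
qed (simp add: finite_U finite_G)

lemma inj_on_snd_incoming_slots: "inj_on snd (incoming_slots x)"
proof (rule inj_onI)
  fix s s' assume s: "s \<in> incoming_slots x" "s' \<in> incoming_slots x" "snd s = snd s'"
  have "fst (snd s) = {fst s, x}" "fst s \<noteq> x" if "s \<in> incoming_slots x" for s
  proof -
    show edge: "fst (snd s) = {fst s, x}" using that by (auto simp: incoming_slots_def)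
    have "snd s \<in> G" using that charging_slots_edge by (auto simp: incoming_slots_def edges_at_def)
    then show "fst s \<noteq> x" using edge by (rule G_edgeD)
  qed
  from this[OF s(1)] this[OF s(2)] s(3) show "s = s'" by (auto simp: doubleton_eq_iff prod_eq_iff)
qed

text \<open>An unblocked side of \<open>x\<close> yields a free edge, while a blocked one takes up a slot of \<open>x\<close>.\<close>

definition inner_edges :: "'v \<Rightarrow> 'v list \<Rightarrow> ('v set \<times> bool) set" where
  "inner_edges x A = {e \<in> edges_at G x. fst e \<subseteq> insert x (set A)}"

lemma finite_inner_edges: "finite (inner_edges x A)"
  using finite_edges_at[of x] by (simp add: inner_edges_def)

lemma free_edge_if_no_inner_edges:
  assumes "rigid_cut A (x # B)" "inner_edges x A = {}"
  shows "{last A, x} \<in> free_edges x"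
proof -
  have "\<not> blocked A x"
  proof
    assume "blocked A x"
    then obtain e y where "e \<in> G" "fst e = {y, x}" "y \<in> set A"
      using rigid_cutD(3)[OF assms(1)] unfolding blocked_def by (metis hd_in_set last_in_set)
    then have "e \<in> inner_edges x A" by (simp add: inner_edges_def edges_at_def)
    with assms(2) show False by simp
  qed
  with assms(1) show ?thesis
    unfolding free_edges_def by (intro CollectI exI[of _ A] exI[of _ "x # B"]) simp
qed

lemma card_incoming_slots_inner_edges:
  assumes "rigid_cut L (x # M)"
  shows "card (incoming_slots x) + (card (inner_edges x L) + card (inner_edges x M)) \<le> 2"
proof -
  have oriented: "oriented (L @ x # M)" using assms by (rule rigid_cutD)
  have dist: "distinct (L @ x # M)" using oriented by (rule oriented_distinct)
  let ?E = "snd ` incoming_slots x" and ?I = "inner_edges x L \<union> inner_edges x M"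
  have outer: "e \<in> edges_at G x - ?I" if "e \<in> ?E" for e
  proof -
    from that obtain u where "(u, e) \<in> incoming_slots x" by auto
    then have "e \<in> edges_at G x" "\<not> fst e \<subseteq> set (L @ x # M)"
      using oriented by (auto simp: edges_at_def elim: incoming_slotsE)
    moreover have "fst e \<subseteq> set (L @ x # M)" if "e \<in> ?I" using that by (auto simp: inner_edges_def)
    ultimately show ?thesis by blast
  qed
  have "e \<notin> inner_edges x M" if "e \<in> inner_edges x L" for e
  proof
    assume "e \<in> inner_edges x M"
    with that dist have "fst e \<subseteq> {x}" "e \<in> edges_at G x" by (auto simp: inner_edges_def)
    moreover from this(2) obtain y where y: "e \<in> G" "fst e = {x, y}" by (rule edges_atE)
    ultimately show False using G_edgeD(2)[OF y] by simp
  qed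
  then have "inner_edges x L \<inter> inner_edges x M = {}" "?E \<inter> ?I = {}" using outer by blast+
  then have "card ?E + (card (inner_edges x L) + card (inner_edges x M)) = card (?E \<union> ?I)"
    using finite_incoming_slots finite_inner_edges by (simp add: card_Un_disjoint)
  moreover have "card (?E \<union> ?I) \<le> card (edges_at G x)"
    using outer by (intro card_mono[OF finite_edges_at]) (auto simp: inner_edges_def)
  moreover have "card (edges_at G x) \<le> 2"
    using oriented_subset[OF oriented] by (intro G_degree) simp
  ultimately show ?thesis using card_image[OF inj_on_snd_incoming_slots, of x] by simp
qed

lemma card_incoming_slots_le: "card (incoming_slots x) \<le> card (free_edges x)"
proof (cases "incoming_slots x = {}")
  case False
  then obtain u e where "(u, e) \<in> incoming_slots x" by auto
  then obtain W where W: "W \<in># Ps" "(u, e) \<in> end_slots W" "fst e = {u, x}"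
    "\<forall>D. oriented D \<longrightarrow> u \<in> set D \<longrightarrow> x \<notin> set D"
    unfolding incoming_slots_def charging_slots_def by auto
  note slot = end_slotsD[OF W(1,2)] and oriented_W = oriented_path[OF W(1)]
  have "e \<in> G" using slot(3) by (simp add: edges_at_def)
  have "x \<notin> set W" using W(4) slot(1) oriented_W by blast
  then obtain L M where LM: "rigid_cut L (x # M)" "M \<noteq> []"
    using outside_neighbourE[OF oriented_W slot(2) \<open>e \<in> G\<close> W(3)] by metis
  have oriented: "oriented (L @ x # M)" and "L \<noteq> []" using rigid_cutD[OF LM(1)] by auto
  have "rigid_cut (rev M) (x # rev L)"
    using LM(2) oriented rigid_cutD(5)[OF LM(1)] oriented_rev[of "L @ x # M"]
      spinnable_rev[of "L @ x # M"] by (simp add: rigid_cut_def cut_def)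
  then have free_M: "{hd M, x} \<in> free_edges x" if "inner_edges x M = {}"
    using free_edge_if_no_inner_edges[of "rev M" x "rev L"] that LM(2)
    by (simp add: inner_edges_def last_rev)
  have "last L \<in> set L" "hd M \<in> set M" "set L \<inter> set M = {}"
    using \<open>L \<noteq> []\<close> LM(2) oriented_distinct[OF oriented] by auto
  then have "last L \<noteq> hd M" by (metis disjoint_iff)
  then have "{last L, x} \<noteq> {hd M, x}" by (metis doubleton_eq_iff)
  then have "(if inner_edges x L = {} then 1 else 0) + (if inner_edges x M = {} then 1 else 0)
      \<le> card (free_edges x \<inter> {{last L, x}, {hd M, x}})"
    using free_edge_if_no_inner_edges[OF LM(1)] free_M by (auto simp: Int_insert_right)
  also have "\<dots> \<le> card (free_edges x)" using finite_free_edges by (intro card_mono) auto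
  finally have "(if card (inner_edges x L) = 0 then 1 else 0) +
      (if card (inner_edges x M) = 0 then 1 else 0)
      \<le> card (free_edges x)" by (simp only: card_0_eq[OF finite_inner_edges])
  then show ?thesis
    using card_incoming_slots_inner_edges[OF LM(1)] by (simp split: if_splits)
qed simp

subsection \<open>The charging scheme\<close>

text \<open>The four ways in which a slot is charged to the edge between \<open>last A\<close> and \<open>hd B\<close> of the path
  \<open>A @ B\<close>. Two different slots charged to the same edge give rise to an improvement.\<close>

definition charges_chord :: "'v \<Rightarrow> 'v set \<times> bool \<Rightarrow> 'v list \<Rightarrow> 'v list \<Rightarrow> bool" where
  "charges_chord u e A B \<longleftrightarrow> rigid_cut A B \<and> (u, e) \<in> charging_slots \<and>
     u = hd A \<and> fst e = {u, hd B} \<and> primary e"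

definition charges_parallel :: "'v \<Rightarrow> 'v set \<times> bool \<Rightarrow> 'v list \<Rightarrow> 'v list \<Rightarrow> bool" where
  "charges_parallel u e A B \<longleftrightarrow> rigid_cut A B \<and> (u, e) \<in> charging_slots \<and>
     (\<exists>b. A = [u, b] \<and> fst e = {u, b}) \<and> \<not> primary e"

definition charges_straddling :: "'v \<Rightarrow> 'v set \<times> bool \<Rightarrow> 'v list \<Rightarrow> 'v list \<Rightarrow> bool" where
  "charges_straddling u e A B \<longleftrightarrow> rigid_cut A B \<and> A = [u] \<and> straddling_end u \<and> e = dropped u"

definition charges_incoming :: "'v \<Rightarrow> 'v set \<times> bool \<Rightarrow> 'v list \<Rightarrow> 'v list \<Rightarrow> bool" where
  "charges_incoming u e A B \<longleftrightarrow> rigid_cut A B \<and> (u, e) \<in> incoming_slots (hd B) \<and>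
     \<not> blocked A (hd B)"

lemma end_slot_if_charging_slot:
  assumes "(u, e) \<in> charging_slots" "P \<in># Ps" "u \<in> set P"
  shows "(u, e) \<in> end_slots P"
proof -
  from assms(1) obtain W where W: "W \<in># Ps" "(u, e) \<in> end_slots W"
    unfolding charging_slots_def by blast
  then have "W = P" using end_slotsD(1) paths_eq_if_common_vertex assms(2,3) by blast
  with W(2) show ?thesis by simp
qed

lemma two_path_one_slot:
  assumes "oriented [a, b]" "(a, e) \<in> charging_slots" "(b, e') \<in> charging_slots"
    and "fst e = {a, b}"
  shows "fst e' \<noteq> {a, b}"
proof
  assume "fst e' = {a, b}"
  have "\<not> spinnable [a, b]" "\<not> spinnable [b, a]" by (auto simp: spinnable_def)
  from assms(1) consider (forward) "[a, b] \<in># Ps" | (backward) "[b, a] \<in># Ps"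
    by (auto simp: oriented_def)
  then show False
  proof cases
    case forward
    from end_slot_if_charging_slot[OF assms(3) this] show False
      using \<open>fst e' = {a, b}\<close> \<open>\<not> spinnable [a, b]\<close> by (simp add: end_slots_def)
  next
    case backward
    from end_slot_if_charging_slot[OF assms(2) this] show False
      using assms(4) \<open>\<not> spinnable [b, a]\<close> by (simp add: end_slots_def insert_commute)
  qed
qed

lemma incoming_slot_endE:
  assumes "(u, e) \<in> incoming_slots x" "oriented D" "x \<in> set D"
  obtains W where "oriented W" "endable W u" "adj u x" "set W \<noteq> set D"
  using assms
proof (rule incoming_slotsE)
  fix W assume "W \<in># Ps" "(u, e) \<in> end_slots W" "adj u x" "set W \<noteq> set D"
  then show thesis using that oriented_path end_slotsD(2) by blast
qed

lemma charges_parallelE: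
  assumes "charges_parallel u e A B"
  obtains b e' where "A = [u, b]" "fst e = {u, b}" "fst e' = {u, b}" "snd e" "adj u b"
    "closed_wrt \<T> {u, b}" "edges_at G u = {e, e'}" "edges_at G b = {e, e'}"
proof -
  from assms obtain b where b: "A = [u, b]" "fst e = {u, b}" and e: "e \<in> G" "\<not> primary e"
    using charging_slots_in_G[of u e] by (auto simp: charges_parallel_def)
  have e': "(fst e, False) \<in> G" "fst (fst e, False) = {u, b}" "(fst e, False) \<noteq> e"
    using not_primaryD[OF e(2)] b(2) by auto
  note ends = G_edgeD[OF e(1) b(2)] and ends' = G_edgeD[OF e'(1,2)]
  have "edges_at G u = {e, (fst e, False)}"
    using edges_at_eq_pair[OF ends(3,5) ends'(5)] e'(3) by simp
  moreover have "edges_at G b = {e, (fst e, False)}"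
    using edges_at_eq_pair[OF ends(4,6) ends'(6)] e'(3) by simp
  ultimately show ?thesis
    using that[OF b e'(2) not_primaryD(1)[OF e(2)] ends(1)]
      parallel_closed[OF e'(1) e(1) e'(3,2) b(2)]
    by blast
qed

lemma charges_chordD:
  assumes "charges_chord u e A B"
  shows "rigid_cut A B" "cut A B" "A \<noteq> []" "B \<noteq> []" "e \<in> G" "fst e = {hd A, hd B}"
  using assms rigid_cutD[of A B] charging_slots_in_G[of u e] unfolding charges_chord_def by auto

lemma charges_chord_unique:
  assumes "charges_chord u e A B" "charges_chord u' e' A' B'" "{last A, hd B} = {last A', hd B'}"
  shows "(u, e) = (u', e')"
proof -
  have cut: "rigid_cut A B" "cut A B" "cut A' B'" "A \<noteq> []" "B \<noteq> []"
    using assms(1,2) by (auto simp: charges_chord_def dest: rigid_cutD)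
  note edge = charges_chordD(5,6)[OF assms(1)] charges_chordD(5,6)[OF assms(2)]
  from cut(2,3) assms(3) show ?thesis
  proof (cases rule: cut_edgeE)
    case forward
    then have "fst e = fst e'" using edge(2,4) by simp
    then have "e = e'"
      using assms(1,2) edge(1,3) by (intro primary_unique) (auto simp: charges_chord_def)
    then show ?thesis using assms(1,2) forward by (simp add: charges_chord_def)
  next
    case backward
    then have e': "fst e' = {last B, last A}" using edge(4) cut(4,5) by (simp add: hd_rev)
    have "crossing (A @ B)"
      unfolding crossing_def using cut(4,5) G_edgeD(1)[OF edge(1,2)]
        adj_sym[OF G_edgeD(1)[OF edge(3) e']]
      by blast
    then have "length (A @ B) < 3" using rigid_cutD(5)[OF cut(1)] by (simp add: spinnable_def)
    then have "length A = 1" "length B = 1" using cut(4,5) by (cases A; cases B; simp)+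
    then obtain a b where AB: "A = [a]" "B = [b]" by (auto simp: length_Suc_conv)
    have "(a, e) \<in> charging_slots" "(b, e') \<in> charging_slots"
      using assms(1,2) AB backward by (auto simp: charges_chord_def)
    moreover have "oriented [a, b]" using cutD(1)[OF cut(2)] AB by simp
    moreover have "fst e = {a, b}" "fst e' = {a, b}" using edge(2) e' AB by auto
    ultimately show ?thesis using two_path_one_slot by blast
  qed
qed

lemma charges_chord_not_parallel:
  assumes "charges_chord u e A B" "charges_parallel u' e' A' B'"
  shows "{last A, hd B} \<noteq> {last A', hd B'}"
proof
  assume same: "{last A, hd B} = {last A', hd B'}"
  from assms(2) obtain b d where par: "A' = [u', b]" "fst e' = {u', b}" "fst d = {u', b}"
    "edges_at G u' = {e', d}" "edges_at G b = {e', d}" by (rule charges_parallelE)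
  have cut: "cut A B" "cut A' B'" "A \<noteq> []" "B \<noteq> []"
    using assms by (auto simp: charges_chord_def charges_parallel_def dest: rigid_cutD)
  have dist: "distinct (A @ B)" using cutD(1)[OF cut(1)] by (rule oriented_distinct)
  note edge = charges_chordD(5,6)[OF assms(1)]
  from cut(1,2) same show False
  proof (cases rule: cut_edgeE)
    case forward
    have A: "A = [u', b]" using forward(1) par(1) by simp
    then have "e \<in> edges_at G u'" using edge by (simp add: edges_at_def)
    then have "{u', hd B} = {u', b}" using edge(2) par(2-4) A by auto
    moreover have "hd B \<in> set B" using cut(4) by simp
    ultimately show False using dist A by (auto simp: doubleton_eq_iff)
  next
    case backward
    then have B: "B = [b, u']" using par(1) by (metis rev_rev_ident rev.simps append.simps)
    then have "e \<in> edges_at G b" using edge by (simp add: edges_at_def)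
    then have "{hd A, b} = {u', b}" using edge(2) par B by auto
    moreover have "hd A \<in> set A" using cut(3) by simp
    ultimately show False using dist B by (auto simp: doubleton_eq_iff)
  qed
qed

lemma charges_chord_not_straddling:
  assumes "charges_chord u e A B" "charges_straddling u' e' A' B'"
  shows "{last A, hd B} \<noteq> {last A', hd B'}"
proof
  assume same: "{last A, hd B} = {last A', hd B'}"
  have cut: "cut A B" "cut A' B'" "oriented (A @ B)" "A \<noteq> []" "B \<noteq> []"
    using assms by (auto simp: charges_chord_def charges_straddling_def dest: rigid_cutD)
  note edge = charges_chordD(5,6)[OF assms(1)]
  have A': "A' = [u']" and straddling: "straddling_end u'"
    using assms(2) by (auto simp: charges_straddling_def)
  from cut(1,2) same have "u' = hd A \<or> u' = hd B"
  proof (cases rule: cut_edgeE)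
    case backward
    then have "B = [u']" using A' by (metis rev_rev_ident rev.simps append.simps)
    then show ?thesis by simp
  qed (use A' in auto)
  then have "e \<in> edges_at G u'" "u' \<in> set (A @ B)" using edge cut(4,5) by (auto simp: edges_at_def)
  from straddling_end_edge_not_subset[OF straddling this(1) cut(3) this(2)]
  show False using edge(2) cut(4,5) by simp
qed

lemma charges_chord_not_incoming:
  assumes "charges_chord u e A B" "charges_incoming u' e' A' B'"
  shows "{last A, hd B} \<noteq> {last A', hd B'}"
proof
  assume same: "{last A, hd B} = {last A', hd B'}"
  have cut: "cut A B" "cut A' B'" "oriented (A @ B)" "A \<noteq> []" "B \<noteq> []"
    using assms by (auto simp: charges_chord_def charges_incoming_def dest: rigid_cutD)
  note edge = charges_chordD(5,6)[OF assms(1)]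
  from cut(1,2) same show False
  proof (cases rule: cut_edgeE)
    case forward
    then show False using assms(2) edge by (auto simp: charges_incoming_def blocked_def)
  next
    case backward
    then have "(u', e') \<in> incoming_slots (last A)"
      using assms(2) cut(4) by (simp add: charges_incoming_def hd_rev)
    moreover have "last A \<in> set (A @ B)" using cut(4) by simp
    ultimately obtain W where W: "oriented W" "endable W u'" "adj u' (last A)" "set W \<noteq> set (A @ B)"
      using incoming_slot_endE[OF _ cut(3)] by blast
    have "endable (A @ B) (last A)"
      using endable_last_prefix[OF cut(4,5)] G_edgeD(1)[OF edge] by blast
    with endable_not_adj[OF W(1) cut(3) W(4,2)] W(3) show False by blast
  qed
qed

lemma charges_parallel_unique:
  assumes "charges_parallel u e A B" "charges_parallel u' e' A' B'"
    and same: "{last A, hd B} = {last A', hd B'}"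
  shows "(u, e) = (u', e')"
proof -
  have cut: "cut A B" "cut A' B'"
    using assms(1,2) by (auto simp: charges_parallel_def dest: rigid_cutD)
  from assms(1) obtain b where b: "A = [u, b]" "fst e = {u, b}" "snd e" "adj u b"
    "closed_wrt \<T> {u, b}"
    by (rule charges_parallelE)
  from assms(2) obtain b' where b': "A' = [u', b']" "fst e' = {u', b'}" "snd e'" "adj u' b'"
    "closed_wrt \<T> {u', b'}" by (rule charges_parallelE)
  from cut same show ?thesis
  proof (cases rule: cut_edgeE)
    case forward
    with b b' show ?thesis by (simp add: prod_eq_iff)
  next
    case backward
    then have "B = [b', u']" using b'(1) by (metis rev_rev_ident rev.simps append.simps)
    with cut(1) b(1) have "cut [u, b] [b', u']" by simp
    from closed_pair_successor_not_closed[OF this b(4,5) adj_sym[OF b'(4)]] b'(5) show ?thesis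
      by (simp add: insert_commute)
  qed
qed

lemma charges_parallel_not_straddling:
  assumes "charges_parallel u e A B" "charges_straddling u' e' A' B'"
  shows "{last A, hd B} \<noteq> {last A', hd B'}"
proof
  assume same: "{last A, hd B} = {last A', hd B'}"
  have cut: "cut A B" "cut A' B'"
    using assms by (auto simp: charges_parallel_def charges_straddling_def dest: rigid_cutD)
  from assms(1) obtain b where b: "A = [u, b]" "adj u b" "closed_wrt \<T> {u, b}"
    by (rule charges_parallelE)
  have A': "A' = [u']" "straddling_end u'" using assms(2) by (auto simp: charges_straddling_def)
  from cut same show False
  proof (cases rule: cut_edgeE)
    case forward
    then show False using b(1) A'(1) by simp
  next
    case backward
    then have "B = [u']" using A'(1) by (metis rev_rev_ident rev.simps append.simps)
    then have path: "oriented [u, b, u']" using cutD(1)[OF cut(1)] b(1) by simp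
    have "transforms 3 {#[u, b, u']#} {#u' # [b, u]#}"
      using reach_mono[OF transforms_rev[of "[u, b, u']" "{#}"], of 3] by simp
    moreover obtain X Y where "straddles u' X Y" using A'(2) by (rule straddling_endE)
    ultimately have "\<not> closed_wrt \<T> (set [b, u])"
      using b(2) by (intro straddling_rest_not_closed[OF path]) simp_all
    then show False using b(3) by (simp add: insert_commute)
  qed
qed

lemma charges_parallel_not_incoming:
  assumes "charges_parallel u e A B" "charges_incoming u' e' A' B'"
  shows "{last A, hd B} \<noteq> {last A', hd B'}"
proof
  assume same: "{last A, hd B} = {last A', hd B'}"
  have cut: "cut A B" "cut A' B'" "oriented (A @ B)" "B \<noteq> []"
    using assms by (auto simp: charges_parallel_def charges_incoming_def dest: rigid_cutD)
  from assms(1) obtain b d where b: "A = [u, b]" "fst e = {u, b}" "fst d = {u, b}" "adj u b"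
    "closed_wrt \<T> {u, b}" "edges_at G b = {e, d}" by (rule charges_parallelE)
  have incoming: "(u', e') \<in> incoming_slots (hd B')"
    using assms(2) by (simp add: charges_incoming_def)
  from cut(1,2) same show False
  proof (cases rule: cut_edgeE)
    case forward
    have "hd B \<in> set (A @ B)" using cut(4) by simp
    with incoming forward obtain W where W: "oriented W" "endable W u'" "adj u' (hd B)"
      "set W \<noteq> set (A @ B)"
      using incoming_slot_endE[OF _ cut(3)] by blast
    with closed_pair_successor_not_adj[of u b B W u'] cut(1) b(1,4,5) show False by simp
  next
    case backward
    then have "(u', e') \<in> incoming_slots b" using incoming b(1) by simp
    moreover have "b \<in> set (A @ B)" using b(1) by simp
    ultimately obtain W where "e' \<in> G" "fst e' = {u', b}" "u' \<notin> set (A @ B)"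
      using incoming_slotsE[OF _ cut(3)] by metis
    moreover from this have "e' \<in> edges_at G b" by (simp add: edges_at_def)
    ultimately show False using b by auto
  qed
qed

lemma charges_straddling_unique:
  assumes "charges_straddling u e A B" "charges_straddling u' e' A' B'"
    and same: "{last A, hd B} = {last A', hd B'}"
  shows "(u, e) = (u', e')"
proof -
  have cut: "cut A B" "cut A' B'"
    using assms(1,2) by (auto simp: charges_straddling_def dest: rigid_cutD)
  have A: "A = [u]" "straddling_end u" "e = dropped u"
    and A': "A' = [u']" "straddling_end u'" "e' = dropped u'"
    using assms(1,2) by (auto simp: charges_straddling_def)
  from cut same show ?thesis
  proof (cases rule: cut_edgeE)
    case forward
    with A A' show ?thesis by simp
  next
    case backward
    then have "B = [u']" using A'(1) by (metis rev_rev_ident rev.simps append.simps)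
    then have "cut [u] [u']" using cut(1) A(1) by simp
    moreover obtain X Y where "straddles u X Y" using A(2) by (rule straddling_endE)
    moreover obtain X' Y' where "straddles u' X' Y'" using A'(2) by (rule straddling_endE)
    ultimately show ?thesis using two_straddling_impossible by blast
  qed
qed

lemma straddling_end_neighbour_not_incoming:
  assumes "rigid_cut [a] B" "straddling_end a"
  shows "(u, e) \<notin> incoming_slots (hd B)"
proof
  assume incoming: "(u, e) \<in> incoming_slots (hd B)"
  have path: "oriented (a # B)" "cut [a] B" "B \<noteq> []" using rigid_cutD[OF assms(1)] by auto
  have "hd B \<in> set (a # B)" using path(3) by simp
  with incoming path(1) obtain W where W: "W \<in># Ps" "(u, e) \<in> end_slots W"
    "set W \<noteq> set (a # B)" "adj u (hd B)" by (rule incoming_slotsE)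
  note slot = end_slotsD[OF W(1,2)]
  obtain X Y where XY: "straddles a X Y" using assms(2) by (rule straddling_endE)
  show False
  proof (cases "set W = set (X @ Y)")
    case False
    from straddling_successor_not_adj_other[OF path(2) XY oriented_path[OF W(1)] W(3) False slot(2)]
      W(4)
    show False by blast
  next
    case True
    have "\<not> endable (X @ Y) (last X)"
      using endable_not_adj[OF path(1) straddlesD(2)[OF XY], of a "last X"] endable_hd[of "a # B"]
        straddlesD[OF XY] by auto
    then have "\<not> spinnable (X @ Y)"
      using endable_spinnable[of "X @ Y" "last X"] straddlesD(3)[OF XY] by auto
    moreover have "W = X @ Y \<or> W = rev (X @ Y)"
      using oriented_common_vertex[OF straddlesD(2)[OF XY] oriented_path[OF W(1)], of u]
        slot(1) True by simp
    ultimately have "u = hd X \<or> u = last Y"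
      using slot(4) spinnable_rev[of "X @ Y"] straddlesD(3,4)[OF XY]
      by (auto simp: hd_rev last_rev hd_append)
    with straddling_successor_not_adj_ends[OF path(2) XY] W(4) show False by blast
  qed
qed

lemma charges_straddling_not_incoming:
  assumes "charges_straddling u e A B" "charges_incoming u' e' A' B'"
  shows "{last A, hd B} \<noteq> {last A', hd B'}"
proof
  assume same: "{last A, hd B} = {last A', hd B'}"
  have cut: "rigid_cut A B" "cut A B" "cut A' B'"
    using assms by (auto simp: charges_straddling_def charges_incoming_def dest: rigid_cutD)
  have A: "A = [u]" "straddling_end u" using assms(1) by (auto simp: charges_straddling_def)
  then have path: "oriented (u # B)" using cutD(1)[OF cut(2)] by simp
  have incoming: "(u', e') \<in> incoming_slots (hd B')"
    using assms(2) by (simp add: charges_incoming_def)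
  from cut(2,3) same show False
  proof (cases rule: cut_edgeE)
    case forward
    with incoming straddling_end_neighbour_not_incoming[of u B u' e'] cut(1) A show False by simp
  next
    case backward
    with incoming A(1) have "(u', e') \<in> incoming_slots u" by simp
    moreover have "u \<in> set (u # B)" by simp
    ultimately obtain W where W: "oriented W" "endable W u'" "adj u' u" "set W \<noteq> set (u # B)"
      using incoming_slot_endE[OF _ path] by blast
    from endable_not_adj[OF W(1) path W(4,2)] endable_hd[of "u # B"] W(3) show False by simp
  qed
qed

lemma end_slots_transforms:
  assumes "P \<in># Ps" "(u, e) \<in> end_slots P" "(u', e') \<in> end_slots P" "u \<noteq> u'"
  obtains P' where "transforms 3 {#P#} {#P'#}" "hd P' = u" "last P' = u'"
proof (cases "spinnable P")
  case True
  with assms(2,3) have "(u, e) \<in> selection P" "(u', e') \<in> selection P"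
    by (auto simp: end_slots_def)
  then have "length P = 3"
    using selectable_selection[OF assms(1) True] assms(4) unfolding selectable_def by blast
  with True show ?thesis
    using transforms_triangle end_slotsD(1)[OF assms(1)] assms(2-4) that by metis
next
  case False
  note slot = end_slotsD[OF assms(1,2)] and slot' = end_slotsD[OF assms(1,3)]
  have "P \<noteq> []" using slot(1) by auto
  from slot(4)[OF False] slot'(4)[OF False] assms(4)
  consider (forward) "u = hd P" "u' = last P" | (backward) "u = last P" "u' = hd P" by blast
  then show ?thesis
  proof cases
    case forward
    then show ?thesis using that[OF reach_refl] by simp
  next
    case backward
    have "transforms 3 {#P#} {#rev P#}" using transforms_rev by (rule reach_mono) simp
    then show ?thesis using backward hd_rev[of P] last_rev[of P] \<open>P \<noteq> []\<close> by (intro that) auto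
  qed
qed

lemma spinnable_straddles_one_slot:
  assumes "P \<in># Ps" "spinnable P" "(u, e) \<in> end_slots P" "(u, e') \<in> end_slots P" "straddles u A B"
  shows "e = e'"
proof (rule ccontr)
  assume "e \<noteq> e'"
  with assms(1-4) obtain b c where bc: "length P = 3" "set P = {u, b, c}" "adj b c"
    "closed_wrt \<T> {b, c}"
    using selectable_selection[of P] unfolding selectable_def end_slots_def by fastforce
  have oriented: "oriented P" using assms(1) by (rule oriented_path)
  then have "card {u, b, c} = 3" using bc(1,2) distinct_card[OF oriented_distinct] by metis
  then have "u \<noteq> b" "u \<noteq> c" "b \<noteq> c" by (auto simp: card_insert_if split: if_splits)
  obtain P' where P': "transforms 3 {#P#} {#P'#}" "hd P' = u" "last P' = b"
    using transforms_triangle[OF assms(2) bc(1)] bc(2) \<open>u \<noteq> b\<close> by blast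
  have "mset P' = mset P" using P'(1) by (rule mset_eq_if_transforms)
  then have "length P' = 3" "set P' = {u, b, c}" using bc(1,2) mset_eq_length mset_eq_setD by metis+
  then obtain x y z where "P' = [x, y, z]" by (auto simp: length_Suc_conv numeral_3_eq_3)
  with P'(2,3) \<open>set P' = {u, b, c}\<close> \<open>u \<noteq> c\<close> \<open>b \<noteq> c\<close> have "P' = u # [c, b]" by auto
  with P'(1) have "transforms 3 {#P#} {#u # [c, b]#}" by simp
  from straddling_rest_not_closed[OF oriented this _ assms(5)] bc(3,4) show False
    by (simp add: insert_commute)
qed

lemma straddling_end_if_rigid:
  assumes "P \<in># Ps" "\<not> spinnable P" "(u, e) \<in> end_slots P" "length P \<noteq> 1"
  obtains D where "rigid_cut [u] D"
proof -
  have oriented: "oriented P" using assms(1) by (rule oriented_path)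
  have "P \<noteq> []" using oriented by (rule oriented_nonempty)
  from end_slotsD(4)[OF assms(1,3,2)] consider "u = hd P" | "u = hd (rev P)"
    using \<open>P \<noteq> []\<close> by (auto simp: hd_rev)
  then obtain Q where Q: "oriented Q" "\<not> spinnable Q" "Q \<noteq> []" "length Q \<noteq> 1" "u = hd Q"
    using that oriented oriented_rev[of P] assms(2,4) spinnable_rev[of P] \<open>P \<noteq> []\<close>
    by cases (metis | (metis length_rev rev_is_Nil_conv))+
  then have "Q = [u] @ tl Q" "tl Q \<noteq> []" by (cases Q; simp)+
  then show ?thesis using Q that[of "tl Q"] by (metis rigid_cut_def cut_def list.discI)
qed

lemma incoming_slots_same_vertex:
  assumes "cut A B" "(u, e) \<in> incoming_slots (last A)" "(u, e') \<in> incoming_slots (hd B)"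
  shows False
proof -
  have path: "oriented (A @ B)" "last A \<in> set (A @ B)" "hd B \<in> set (A @ B)"
    using cutD[OF assms(1)] by auto
  obtain W where W: "W \<in># Ps" "(u, e) \<in> end_slots W" "set W \<noteq> set (A @ B)" "u \<notin> set (A @ B)"
    "e \<in> G" "fst e = {u, last A}" "adj u (last A)" "\<not> (straddling_end u \<and> e = dropped u)"
    using assms(2) path(1,2) by (rule incoming_slotsE)
  obtain W' where W': "W' \<in># Ps" "(u, e') \<in> end_slots W'"
    "e' \<in> G" "fst e' = {u, hd B}" "adj u (hd B)" "\<not> (straddling_end u \<and> e' = dropped u)"
    using assms(3) path(1,3) by (rule incoming_slotsE)
  have "W' = W" using end_slotsD(1) paths_eq_if_common_vertex W(1,2) W'(1,2) by blast
  have straddles: "straddles u A B" using assms(1) W(4,7) W'(5) by (simp add: straddles_def)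
  have "e \<noteq> e'" using W(6) W'(4) cut_last_neq_hd[OF assms(1)] by (auto simp: doubleton_eq_iff)
  then have rigid: "\<not> spinnable W"
    using spinnable_straddles_one_slot[OF W(1) _ W(2) _ straddles] W'(2) \<open>W' = W\<close> by blast
  show False
  proof (cases "length W = 1")
    case True
    then have "W = [u]" using end_slotsD(1)[OF W(1,2)] by (auto simp: length_Suc_conv)
    with insert_not_adj[OF oriented_path[OF W(1)] assms(1) W(3) reach_refl[of _ _ 0]]
      W'(5) straddlesD(7)[OF straddles]
    show False by simp
  next
    case False
    with W(1,2) rigid obtain D where "rigid_cut [u] D" by (metis straddling_end_if_rigid)
    then have "straddling_end u"
      unfolding straddling_end_def using assms(1) W(4-6) W'(3,4) by blast
    moreover have "edges_at G u = {e, e'}"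
      using G_edgeD(3,5)[OF W(5,6)] G_edgeD(5)[OF W'(3,4)] \<open>e \<noteq> e'\<close> by (intro edges_at_eq_pair)
    ultimately show False using dropped_edge[of u] W(8) W'(6) by auto
  qed
qed

lemma incoming_slots_opposite:
  assumes "cut A B" "(u, e) \<in> incoming_slots (last A)" "(u', e') \<in> incoming_slots (hd B)"
  shows False
proof -
  have path: "oriented (A @ B)" "last A \<in> set (A @ B)" "hd B \<in> set (A @ B)"
    using cutD[OF assms(1)] by auto
  obtain W where W: "W \<in># Ps" "(u, e) \<in> end_slots W" "set W \<noteq> set (A @ B)" "adj u (last A)"
    using assms(2) path(1,2) by (rule incoming_slotsE)
  obtain W' where W': "W' \<in># Ps" "(u', e') \<in> end_slots W'" "set W' \<noteq> set (A @ B)" "adj u' (hd B)"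
    using assms(3) path(1,3) by (rule incoming_slotsE)
  show False
  proof (cases "W = W'")
    case False
    then have "set W \<noteq> set W'"
      using paths_eq_if_common_vertex[OF W(1) W'(1)] end_slotsD(1)[OF W(1,2)] by blast
    from bridge_not_adj[OF oriented_path[OF W(1)] oriented_path[OF W'(1)] assms(1) this W(3) W'(3)
        end_slotsD(2)[OF W(1,2)] end_slotsD(2)[OF W'(1,2)] W(4)] W'(4)
    show False by blast
  next
    case True
    have "u \<noteq> u'" using incoming_slots_same_vertex[OF assms(1,2)] assms(3) by blast
    then obtain P where P: "transforms 3 {#W#} {#P#}" "hd P = u" "last P = u'"
      using end_slots_transforms[OF W(1,2)] W'(2) True by blast
    from insert_not_adj[OF oriented_path[OF W(1)] assms(1) W(3) P(1)] show False
      using P(2,3) adj_sym[OF W(4)] W'(4) by simp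
  qed
qed

definition free_edge_of :: "'v \<Rightarrow> 'v slot \<Rightarrow> 'v set" where
  "free_edge_of x = (SOME g. inj_on g (incoming_slots x) \<and> g ` incoming_slots x \<subseteq> free_edges x)"

lemma free_edge_of:
  "inj_on (free_edge_of x) (incoming_slots x)" "free_edge_of x ` incoming_slots x \<subseteq> free_edges x"
proof -
  have "\<exists>g. inj_on g (incoming_slots x) \<and> g ` incoming_slots x \<subseteq> free_edges x"
    using card_le_inj[OF finite_incoming_slots finite_free_edges card_incoming_slots_le] by blast
  then have "inj_on (free_edge_of x) (incoming_slots x) \<and>
      free_edge_of x ` incoming_slots x \<subseteq> free_edges x"
    unfolding free_edge_of_def by (rule someI_ex)
  then show "inj_on (free_edge_of x) (incoming_slots x)"
    "free_edge_of x ` incoming_slots x \<subseteq> free_edges x" by blast+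
qed

lemma charges_incoming_unique:
  assumes "charges_incoming u e A B" "charges_incoming u' e' A' B'"
    and "free_edge_of (hd B) (u, e) = {last A, hd B}"
      "free_edge_of (hd B') (u', e') = {last A', hd B'}"
    and same: "{last A, hd B} = {last A', hd B'}"
  shows "(u, e) = (u', e')"
proof -
  have cut: "cut A B" "cut A' B'" "A \<noteq> []"
    using assms(1,2) by (auto simp: charges_incoming_def dest: rigid_cutD)
  have incoming: "(u, e) \<in> incoming_slots (hd B)" "(u', e') \<in> incoming_slots (hd B')"
    using assms(1,2) by (auto simp: charges_incoming_def)
  from cut(1,2) same show ?thesis
  proof (cases rule: cut_edgeE)
    case forward
    with assms(3,4) have "free_edge_of (hd B) (u, e) = free_edge_of (hd B) (u', e')" by simp
    then show ?thesis using incoming forward by (intro inj_onD[OF free_edge_of(1)]) simp_all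
  next
    case backward
    then have "(u', e') \<in> incoming_slots (last A)" using incoming(2) cut(3) by (simp add: hd_rev)
    from incoming_slots_opposite[OF cut(1) this incoming(1)] show ?thesis ..
  qed
qed

definition charges_own_path :: "'v \<Rightarrow> 'v set \<times> bool \<Rightarrow> 'v list \<Rightarrow> 'v list \<Rightarrow> bool" where
  "charges_own_path u e A B \<longleftrightarrow>
     charges_chord u e A B \<or> charges_parallel u e A B \<or> charges_straddling u e A B"

lemma charges_own_path_unique:
  assumes "charges_own_path u e A B" "charges_own_path u' e' A' B'"
    and same: "{last A, hd B} = {last A', hd B'}"
  shows "(u, e) = (u', e')"
proof -
  from assms(1) consider (chord) "charges_chord u e A B" | (parallel) "charges_parallel u e A B"
    | (straddling) "charges_straddling u e A B" unfolding charges_own_path_def by blast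
  then show ?thesis
  proof cases
    case chord
    then have "charges_chord u' e' A' B'"
      using assms(2) same charges_chord_not_parallel charges_chord_not_straddling
      unfolding charges_own_path_def by metis
    from charges_chord_unique[OF chord this same] show ?thesis .
  next
    case parallel
    then have "charges_parallel u' e' A' B'"
      using assms(2) same charges_chord_not_parallel charges_parallel_not_straddling
      unfolding charges_own_path_def by metis
    from charges_parallel_unique[OF parallel this same] show ?thesis .
  next
    case straddling
    then have "charges_straddling u' e' A' B'"
      using assms(2) same charges_chord_not_straddling charges_parallel_not_straddling
      unfolding charges_own_path_def by metis
    from charges_straddling_unique[OF straddling this same] show ?thesis .
  qed
qed

lemma charges_own_path_not_incoming:
  "charges_own_path u e A B \<Longrightarrow> charges_incoming u' e' A' B' \<Longrightarrow> {last A, hd B} \<noteq> {last A', hd B'}"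
  unfolding charges_own_path_def
  using charges_chord_not_incoming charges_parallel_not_incoming charges_straddling_not_incoming
  by metis

definition charged_to :: "'v slot \<Rightarrow> 'v set \<Rightarrow> bool" where
  "charged_to s f \<longleftrightarrow> (\<exists>u e A B. s = (u, e) \<and> f = {last A, hd B} \<and>
     (charges_own_path u e A B \<or> charges_incoming u e A B \<and> free_edge_of (hd B) s = f))"

lemma charged_to_unique:
  assumes "charged_to s f" "charged_to s' f"
  shows "s = s'"
proof -
  from assms(1) obtain u e A B where s: "s = (u, e)" and f: "f = {last A, hd B}" and
    charges: "charges_own_path u e A B \<or> charges_incoming u e A B \<and> free_edge_of (hd B) s = f"
    unfolding charged_to_def by blast
  from assms(2) obtain u' e' A' B' where s': "s' = (u', e')" and f': "f = {last A', hd B'}" and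
    charges': "charges_own_path u' e' A' B' \<or> charges_incoming u' e' A' B' \<and>
        free_edge_of (hd B') s' = f"
    unfolding charged_to_def by blast
  have same: "{last A, hd B} = {last A', hd B'}" using f f' by simp
  show ?thesis
  proof (cases "charges_own_path u e A B")
    case True
    then have "charges_own_path u' e' A' B'"
      using charges' same charges_own_path_not_incoming by metis
    from charges_own_path_unique[OF True this same] show ?thesis unfolding s s' .
  next
    case False
    then have incoming: "charges_incoming u e A B" "free_edge_of (hd B) s = f"
      using charges by blast+
    then have incoming': "charges_incoming u' e' A' B'" "free_edge_of (hd B') s' = f"
      using charges' same charges_own_path_not_incoming by metis+
    show ?thesis
      using charges_incoming_unique[OF incoming(1) incoming'(1) _ _ same] incoming(2) incoming'(2) f
        f'
      unfolding s s' by metis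
  qed
qed

lemma ex_charged_to_inside:
  assumes "(u, e) \<in> charging_slots" "P \<in># Ps" "u \<in> set P" "fst e = {u, x}" "x \<in> set P"
  shows "\<exists>f. charged_to (u, e) f"
proof -
  note slot = end_slotsD[OF assms(2) end_slot_if_charging_slot[OF assms(1-3)]]
  have "e \<in> G" using assms(1) by (rule charging_slots_in_G)
  note edge = G_edgeD[OF this assms(4)]
  have rigid: "\<not> spinnable P" using slot(5) assms(3-5) by auto
  have "P \<noteq> []" using assms(3) by auto
  with slot(4)[OF rigid] obtain D where D: "oriented D" "hd D = u" "set D = set P" "\<not> spinnable D"
    using oriented_path[OF assms(2)] oriented_rev[of P] spinnable_rev[of P] rigid
    by (metis hd_rev set_rev)
  obtain A M where AM: "D = A @ x # M" using assms(5) D(3) by (metis in_set_conv_decomp)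
  have A: "A \<noteq> []" "hd A = u" using AM D(2) edge(2) by (cases A; auto)+
  have cut: "rigid_cut A (x # M)" using D(1,4) AM A(1) by (simp add: rigid_cut_def cut_def)
  show ?thesis
  proof (cases "primary e")
    case True
    then have "charges_chord u e A (x # M)"
      using cut assms(1,4) A(2) by (simp add: charges_chord_def)
    then show ?thesis unfolding charged_to_def charges_own_path_def by blast
  next
    case False
    have closed: "closed_wrt \<T> {u, x}"
      using parallel_closed[OF _ \<open>e \<in> G\<close> _ _ assms(4)] not_primaryD(2,3)[OF False] assms(4) by simp
    then have "\<not> 2 \<le> length A"
      using chord_not_closed[OF rigid_cutD(1)[OF cut]] A(2) edge(1) by auto
    then have A_eq: "A = [u]" using A by (cases A) (auto simp: not_le less_Suc_eq)
    have "M \<noteq> []"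
      using closable_not_closed[OF D(1) reach_refl] AM A_eq adj_sym[OF edge(1)] closed by auto
    then have "charges_parallel u e [u, x] M"
      using cut assms(1,4) A_eq False by (simp add: charges_parallel_def rigid_cut_def cut_def)
    then show ?thesis unfolding charged_to_def charges_own_path_def by blast
  qed
qed

lemma ex_charged_to_outside:
  assumes "(u, e) \<in> charging_slots" "P \<in># Ps" "u \<in> set P" "fst e = {u, x}" "x \<notin> set P"
  shows "\<exists>f. charged_to (u, e) f"
proof (cases "straddling_end u \<and> e = dropped u")
  case True
  then obtain D where "rigid_cut [u] D" unfolding straddling_end_def by blast
  with True have "charges_straddling u e [u] D" by (simp add: charges_straddling_def)
  then show ?thesis unfolding charged_to_def charges_own_path_def by blast
next
  case False
  have "x \<notin> set D" if "oriented D" "u \<in> set D" for D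
    using oriented_common_vertex[OF oriented_path[OF assms(2)] that(1) assms(3) that(2)] assms(5)
    by auto
  with False have incoming: "(u, e) \<in> incoming_slots x"
    using assms(1,4) by (auto simp: incoming_slots_def)
  then have "free_edge_of x (u, e) \<in> free_edges x" using free_edge_of(2) by blast
  then obtain A B where "free_edge_of x (u, e) = {last A, x}" "rigid_cut A B" "hd B = x"
    "\<not> blocked A x"
    unfolding free_edges_def by blast
  with incoming have "charged_to (u, e) {last A, x}"
    unfolding charged_to_def charges_incoming_def by blast
  then show ?thesis ..
qed

lemma ex_charged_to: "s \<in> charging_slots \<Longrightarrow> \<exists>f. charged_to s f"
proof -
  assume "s \<in> charging_slots"
  then obtain u e where s: "s = (u, e)" "(u, e) \<in> charging_slots" by (cases s) simp
  then obtain P where P: "P \<in># Ps" "u \<in> set P" unfolding charging_slots_def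
    using end_slotsD(1) by blast
  obtain x where "fst e = {u, x}" using charging_slots_edge[OF s(2)] by (rule edges_atE)
  with ex_charged_to_inside[OF s(2) P] ex_charged_to_outside[OF s(2) P] show ?thesis
    unfolding s(1) by blast
qed

definition path_edges :: "'v list \<Rightarrow> 'v set set" where
  "path_edges P = {{last A, hd B} | A B. P = A @ B \<and> A \<noteq> [] \<and> B \<noteq> []}"

lemma card_path_edges: "finite (path_edges P)" "card (path_edges P) \<le> length P - 1"
proof -
  have sub: "path_edges P \<subseteq> (\<lambda>i. {P ! i, P ! Suc i}) ` {..<length P - 1}"
  proof
    fix f assume "f \<in> path_edges P"
    then obtain A B where AB: "P = A @ B" "A \<noteq> []" "B \<noteq> []" "f = {last A, hd B}"
      by (auto simp: path_edges_def)
    then have "f = {P ! (length A - 1), P ! Suc (length A - 1)}"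
      by (cases A rule: rev_cases; cases B) (auto simp: nth_append)
    moreover have "length A - 1 < length P - 1" using AB by (cases A; cases B) auto
    ultimately show "f \<in> (\<lambda>i. {P ! i, P ! Suc i}) ` {..<length P - 1}" by blast
  qed
  then show "finite (path_edges P)" by (rule finite_subset) simp
  show "card (path_edges P) \<le> length P - 1" using surj_card_le[OF _ sub] by simp
qed

lemma charged_to_path_edge:
  assumes "charged_to s f"
  obtains P where "P \<in># Ps" "\<not> spinnable P" "f \<in> path_edges P"
proof -
  from assms obtain A B where f: "f = {last A, hd B}" and cut: "rigid_cut A B"
    unfolding charged_to_def charges_own_path_def charges_chord_def charges_parallel_def
      charges_straddling_def charges_incoming_def by blast
  note cutD = rigid_cutD[OF cut]
  from cutD(2) consider (forward) "A @ B \<in># Ps" | (backward) "rev B @ rev A \<in># Ps"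
    by (auto simp: oriented_def)
  then show ?thesis
  proof cases
    case forward
    then show ?thesis using that cutD(3-5) unfolding path_edges_def f by blast
  next
    case backward
    have "f = {last (rev B), hd (rev A)}" using f cutD(3,4) by (auto simp: last_rev hd_rev)
    then have "f \<in> path_edges (rev B @ rev A)" using cutD(3,4) unfolding path_edges_def by force
    moreover have "\<not> spinnable (rev B @ rev A)" using cutD(5) spinnable_rev[of "A @ B"] by simp
    ultimately show ?thesis using that backward by blast
  qed
qed

lemma card_charging_slots_le:
  "card charging_slots \<le> (\<Sum>P\<in>{P \<in> set_mset Ps. \<not> spinnable P}. length P - 1)"
proof -
  let ?S = "{P \<in> set_mset Ps. \<not> spinnable P}"
  obtain \<phi> where \<phi>: "charged_to s (\<phi> s)" if "s \<in> charging_slots" for s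
    using ex_charged_to by metis
  have "inj_on \<phi> charging_slots" using \<phi> charged_to_unique by (metis inj_onI)
  moreover have "\<phi> ` charging_slots \<subseteq> (\<Union>P\<in>?S. path_edges P)"
    using \<phi> by (blast elim: charged_to_path_edge)
  ultimately have "card charging_slots \<le> card (\<Union>P\<in>?S. path_edges P)"
    using card_path_edges(1) by (intro card_inj_on_le[of \<phi>]) auto
  also have "\<dots> \<le> (\<Sum>P\<in>?S. card (path_edges P))" by (intro card_UN_le) auto
  also have "\<dots> \<le> (\<Sum>P\<in>?S. length P - 1)" using card_path_edges(2) by (intro sum_mono)
  finally show ?thesis .
qed

section \<open>Counting the paths of a local optimum\<close>

definition singles :: "'v list set" where
  "singles = {P \<in> set_mset Ps. length P = 1}"

definition tight_pairs :: "'v list set" where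
  "tight_pairs = {P \<in> set_mset Ps. length P = 2 \<and> (\<exists>e\<in>G. fst e = set P)}"

definition stars :: "'v list set" where
  "stars = {P \<in> set_mset Ps. length P = 3 \<and> (\<exists>u e. [u] \<in># Ps \<and> e \<in> G \<and> fst e = {u, P ! 1})}"

definition medium_paths :: "'v list set" where
  "medium_paths = {P \<in> set_mset Ps. 3 \<le> length P \<and> length P \<le> 5}"

lemma path_kinds_subset:
  "singles \<subseteq> set_mset Ps" "tight_pairs \<subseteq> set_mset Ps" "stars \<subseteq> set_mset Ps"
    "medium_paths \<subseteq> set_mset Ps"
  by (auto simp: singles_def tight_pairs_def stars_def medium_paths_def)

lemma finite_path_kinds: "finite singles" "finite tight_pairs" "finite stars" "finite medium_paths"
  using path_kinds_subset[THEN finite_subset] by simp_all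

lemma path_kinds_disjoint:
  "singles \<inter> tight_pairs = {}" "singles \<inter> stars = {}" "singles \<inter> medium_paths = {}"
  "tight_pairs \<inter> stars = {}" "tight_pairs \<inter> medium_paths = {}"
  by (auto simp: singles_def tight_pairs_def stars_def medium_paths_def)

lemma sum_paths_vertices_le: "(\<Sum>P\<in>set_mset Ps. \<Sum>v\<in>set P. f v) \<le> (\<Sum>v\<in>U. f v :: nat)"
proof -
  have "(\<Sum>P\<in>set_mset Ps. \<Sum>v\<in>set P. f v) = (\<Sum>v\<in>(\<Union>P\<in>set_mset Ps. set P). f v)"
    using paths_disjoint by (intro sum.UNION_disjoint[symmetric]) auto
  also have "\<dots> \<le> (\<Sum>v\<in>U. f v)"
    using oriented_subset[OF oriented_path] finite_U by (intro sum_mono2) auto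
  finally show ?thesis .
qed

lemma card_edges_on_path:
  assumes "P \<in># Ps"
  shows "finite {e \<in> G. fst e = set P}" "card {e \<in> G. fst e = set P} \<le> of_bool (P \<in> tight_pairs)"
proof -
  show "finite {e \<in> G. fst e = set P}" using finite_G by simp
  have oriented: "oriented P" using assms by (rule oriented_path)
  have len: "length P = 2" if e: "e \<in> G" "fst e = set P" for e
  proof -
    from G_edge[OF e(1)] obtain u v where "fst e = {u, v}" by blast
    then have "card (set P) = 2" using G_edgeD(2)[OF e(1)] e(2) by simp
    then show ?thesis using distinct_card[OF oriented_distinct[OF oriented]] by simp
  qed
  show "card {e \<in> G. fst e = set P} \<le> of_bool (P \<in> tight_pairs)"
  proof (cases "{e \<in> G. fst e = set P} = {}")
    case True
    show ?thesis unfolding True by simp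
  next
    case False
    then obtain e where e: "e \<in> G" "fst e = set P" by blast
    then have "{e \<in> G. fst e = set P} = {e}"
      using pair_path_edge_unique[OF oriented len[OF e] e] by blast
    moreover have "P \<in> tight_pairs" using assms e len[OF e] by (auto simp: tight_pairs_def)
    ultimately show ?thesis by simp
  qed
qed

lemma card_edges_at_ends:
  assumes "P \<in># Ps"
  shows "4 \<le> card (Sigma {hd P, last P} (edges_at G)) + (\<Sum>v\<in>set P. deficit v) +
    2 * of_bool (P \<in> singles)"
proof -
  let ?E = "{hd P, last P}"
  have "oriented P" using assms by (rule oriented_path)
  then have path: "P \<noteq> []" "distinct P" "set P \<subseteq> U"
    by (rule oriented_nonempty oriented_distinct oriented_subset)+
  then have ends: "?E \<subseteq> set P" by simp
  have "2 \<le> card ?E + of_bool (P \<in> singles)"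
  proof (cases "length P = 1")
    case True
    then show ?thesis using assms by (auto simp: singles_def length_Suc_conv)
  next
    case False
    then have "hd P \<noteq> last P" using path(1,2) by (cases P) auto
    then show ?thesis by simp
  qed
  moreover have "card (Sigma ?E (edges_at G)) + (\<Sum>v\<in>?E. deficit v) =
      (\<Sum>v\<in>?E. card (edges_at G v) + deficit v)"
    by (simp add: sum.distrib finite_edges_at)
  moreover have "\<dots> = (\<Sum>v\<in>?E. 2)"
    using ends path(3) by (intro sum.cong) (auto simp: card_edges_at_deficit)
  moreover have "(\<Sum>v\<in>?E. deficit v) \<le> (\<Sum>v\<in>set P. deficit v)" using ends by (intro sum_mono2) auto
  ultimately show ?thesis by simp
qed

lemma finite_end_slots: "P \<in># Ps \<Longrightarrow> finite (end_slots P)"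
  by (rule finite_subset[of _ "set P \<times> G"]) (auto dest: end_slotsD simp: edges_at_def finite_G)

lemma card_end_slots_ge:
  assumes "P \<in># Ps"
  shows "4 \<le> card (end_slots P) + (\<Sum>v\<in>set P. deficit v) + of_bool (spinnable P) * (length P - 1) +
    2 * of_bool (P \<in> singles) + of_bool (P \<in> tight_pairs)"
proof (cases "spinnable P")
  case True
  then have "5 \<le> card (end_slots P) + (\<Sum>v\<in>set P. deficit v) + length P"
    using selectable_selection[OF assms True] by (simp add: selectable_def end_slots_def)
  then show ?thesis using True by simp
next
  case False
  let ?X = "{e \<in> G. fst e = set P}"
  have "Sigma {hd P, last P} (edges_at G) \<subseteq> end_slots P \<union> {last P} \<times> ?X"
    using False by (auto simp: end_slots_def edges_at_def)
  then have "card (Sigma {hd P, last P} (edges_at G)) \<le> card (end_slots P \<union> {last P} \<times> ?X)"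
    using finite_end_slots[OF assms] card_edges_on_path(1)[OF assms] by (intro card_mono) auto
  also have "\<dots> \<le> card (end_slots P) + card ?X"
    using card_Un_le[of "end_slots P" "{last P} \<times> ?X"]
    by (simp add: card_cartesian_product_singleton)
  also have "\<dots> \<le> card (end_slots P) + of_bool (P \<in> tight_pairs)"
    using card_edges_on_path(2)[OF assms] by simp
  finally show ?thesis using card_edges_at_ends[OF assms] by linarith
qed

lemma card_charging_slots: "card charging_slots = (\<Sum>P\<in>set_mset Ps. card (end_slots P))"
  unfolding charging_slots_def
proof (intro card_UN_disjoint ballI impI)
  fix P P' assume "P \<in># Ps" "P' \<in># Ps" "P \<noteq> P'"
  then show "end_slots P \<inter> end_slots P' = {}" using end_slotsD(1) paths_disjoint by fast
qed (simp_all add: finite_end_slots)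

lemma five_size_paths_le:
  "5 * size Ps \<le> card U + (\<Sum>v\<in>U. deficit v) + 2 * card singles + card tight_pairs"
proof -
  let ?S = "set_mset Ps" and ?inner = "\<lambda>P. length P - 1"
  have kinds: "?S \<inter> {P. P \<in> singles} = singles" "?S \<inter> {P. P \<in> tight_pairs} = tight_pairs"
    using path_kinds_subset by blast+
  have "5 * card ?S = (\<Sum>P\<in>?S. 4) + card ?S" by simp
  also have "(\<Sum>P\<in>?S. 4) \<le> (\<Sum>P\<in>?S. card (end_slots P) + (\<Sum>v\<in>set P. deficit v) +
      of_bool (spinnable P) * ?inner P + 2 * of_bool (P \<in> singles) + of_bool (P \<in> tight_pairs))"
    using card_end_slots_ge by (intro sum_mono) simp
  also have "\<dots> = card charging_slots + (\<Sum>P\<in>?S. \<Sum>v\<in>set P. deficit v) +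
      (\<Sum>P\<in>?S. of_bool (spinnable P) * ?inner P) + 2 * card singles + card tight_pairs"
    using kinds by (simp add: sum.distrib card_charging_slots sum_distrib_left[symmetric]
      sum_of_bool_eq)
  also have "card charging_slots \<le> (\<Sum>P\<in>?S. of_bool (\<not> spinnable P) * ?inner P)"
    using card_charging_slots_le by (simp add: Int_def)
  finally have "5 * card ?S \<le>
      (\<Sum>P\<in>?S. of_bool (\<not> spinnable P) * ?inner P + of_bool (spinnable P) * ?inner P + 1) +
      (\<Sum>P\<in>?S. \<Sum>v\<in>set P. deficit v) + 2 * card singles + card tight_pairs"
    unfolding sum.distrib by simp
  also have "(\<Sum>P\<in>?S. of_bool (\<not> spinnable P) * ?inner P + of_bool (spinnable P) * ?inner P + 1) =
      (\<Sum>P\<in>?S. \<Sum>v\<in>set P. 1)"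
    using oriented_path oriented_nonempty oriented_distinct
    by (intro sum.cong) (auto simp: distinct_card Suc_le_eq)
  also have "\<dots> \<le> card U" using sum_paths_vertices_le[of "\<lambda>_. 1"] by simp
  finally show ?thesis
    using sum_paths_vertices_le[of deficit] size_paths by linarith
qed

subsection \<open>Edges leaving singles, stars and tight pairs\<close>

definition leaf_slots :: "'v list \<Rightarrow> 'v slot set" where
  "leaf_slots P = (SIGMA u:{hd P, last P}. {e \<in> edges_at G u. fst e \<noteq> set P})"

lemma finite_leaf_slots: "finite (leaf_slots P)"
  using finite_edges_at by (simp add: leaf_slots_def)

lemma leaf_slotsE:
  assumes "P \<in># Ps" "(u, e) \<in> leaf_slots P"
  obtains x where "u \<in> {hd P, last P}" "u \<in> set P" "e \<in> G" "fst e = {u, x}" "adj u x" "x \<noteq> u"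
    "fst e \<noteq> set P"
proof -
  have e: "u \<in> {hd P, last P}" "e \<in> edges_at G u" "fst e \<noteq> set P"
    using assms(2) by (auto simp: leaf_slots_def)
  from e(2) obtain x where x: "e \<in> G" "fst e = {u, x}" by (rule edges_atE)
  have "P \<noteq> []" using assms(1) nonempty by auto
  then have "u \<in> set P" using e(1) by auto
  with that e(1,3) x G_edgeD(1,2)[OF x] show ?thesis by metis
qed

lemma card_leaf_slots_ge:
  assumes "P \<in># Ps"
  shows "4 \<le> card (leaf_slots P) + (\<Sum>v\<in>set P. deficit v) +
    2 * of_bool (P \<in> singles) + 2 * of_bool (P \<in> tight_pairs)"
proof -
  let ?E = "{hd P, last P}" and ?X = "{e \<in> G. fst e = set P}"
  have "Sigma ?E (edges_at G) \<subseteq> leaf_slots P \<union> ?E \<times> ?X" by (auto simp: leaf_slots_def edges_at_def)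
  then have "card (Sigma ?E (edges_at G)) \<le> card (leaf_slots P \<union> ?E \<times> ?X)"
    using finite_leaf_slots card_edges_on_path(1)[OF assms] by (intro card_mono) auto
  also have "\<dots> \<le> card (leaf_slots P) + card ?E * card ?X"
    using card_Un_le[of "leaf_slots P" "?E \<times> ?X"] by (simp only: card_cartesian_product)
  also have "card ?E * card ?X \<le> 2 * of_bool (P \<in> tight_pairs)"
    using card_edges_on_path(2)[OF assms] by (intro mult_le_mono) (simp_all add: card_insert_if)
  finally show ?thesis using card_edges_at_ends[OF assms] by linarith
qed

definition hits_centre :: "'v \<Rightarrow> 'v set \<times> bool \<Rightarrow> 'v list \<Rightarrow> 'v \<Rightarrow> bool" where
  "hits_centre u e Q x \<longleftrightarrow> Q \<in># Ps \<and> e \<in> G \<and> fst e = {u, x} \<and> x \<in> set Q \<and>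
     (length Q = 3 \<and> x = Q ! 1 \<or>
      (\<exists>P\<in>tight_pairs. (u, e) \<in> leaf_slots P \<and> u \<notin> set Q) \<and>
      (\<exists>L M. Q = L @ x # M \<and> length L \<in> {1, 2} \<and> length M \<in> {1, 2}))"

lemma three_path_centreE:
  assumes "oriented (L @ x # M)" "L \<noteq> []" "M \<noteq> []" "\<not> 4 \<le> length (L @ x # M)"
  obtains Q where "Q \<in># Ps" "length Q = 3" "Q ! 1 = x" "x \<in> set Q"
proof -
  have "0 < length L" "0 < length M" "length L + length M < 3" using assms(2-4) by simp_all
  then have "length L = 1" "length M = 1" by linarith+
  then obtain a b where "L = [a]" "M = [b]" by (auto simp: length_Suc_conv)
  with assms(1) consider "[a, x, b] \<in># Ps" | "[b, x, a] \<in># Ps" by (auto simp: oriented_def)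
  then show ?thesis by cases (auto intro: that)
qed

lemma single_hits_star:
  assumes "P \<in> singles" "(u, e) \<in> leaf_slots P"
  shows "\<exists>Q\<in>stars. \<exists>x. hits_centre u e Q x"
proof -
  have P: "P \<in># Ps" "length P = 1" using assms(1) by (auto simp: singles_def)
  from P(1) assms(2) obtain x where x: "u \<in> set P" "e \<in> G" "fst e = {u, x}" "adj u x" "x \<noteq> u"
    by (rule leaf_slotsE)
  have "P = [u]" using P(2) x(1) by (auto simp: length_Suc_conv)
  then have single: "[u] \<in># Ps" "oriented [u]" using P(1) oriented_path by auto
  have "endable [u] u" using endable_hd[of "[u]"] by simp
  with single(2) obtain L M where LM: "rigid_cut L (x # M)" "M \<noteq> []"
    "set [u] \<inter> set (L @ x # M) = {}"
    using x(2,3) by (rule outside_neighbourE) (use x(5) in simp)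
  note cut = rigid_cutD[OF LM(1)]
  have "\<not> 4 \<le> length (L @ x # M)"
    using single_not_adj_long[OF single(2) cut(2) _ cut(3) LM(2)] x(4) LM(3) by auto
  with cut(2,3) LM(2) obtain Q where Q: "Q \<in># Ps" "length Q = 3" "Q ! 1 = x" "x \<in> set Q"
    by (rule three_path_centreE)
  have "Q \<in> stars" using Q(1-3) single(1) x(2,3) unfolding stars_def by blast
  moreover have "hits_centre u e Q x" using Q x(2,3) by (simp add: hits_centre_def)
  ultimately show ?thesis by blast
qed

lemma starE:
  assumes "P \<in> stars" "u \<in> {hd P, last P}"
  obtains a y r where "P \<in># Ps" "oriented [a]" "oriented [u, y, r]" "adj a y" "a \<notin> {u, y, r}"
    "\<not> adj u r" "set P = {u, y, r}" "P ! 1 = y" "length P = 3"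
proof -
  from assms(1) obtain a e where P: "P \<in># Ps" "length P = 3" "[a] \<in># Ps" "e \<in> G"
    "fst e = {a, P ! 1}"
    by (auto simp: stars_def)
  from P(2) obtain b y c where "P = [b, y, c]" by (auto simp: length_Suc_conv numeral_3_eq_3)
  then obtain r where r: "P = [u, y, r] \<or> P = [r, y, u]" using assms(2) by auto
  then have y: "P ! 1 = y" "set P = {u, y, r}" by auto
  have path: "oriented [u, y, r]" "oriented [a]" using r P(1,3) by (auto simp: oriented_def)
  have "adj a y" using G_edgeD(1)[OF P(4,5)] y by simp
  have "a \<notin> {u, y, r}"
  proof
    assume "a \<in> {u, y, r}"
    then have "[a] = P" using paths_eq_if_common_vertex[OF P(3,1), of a] y by simp
    then show False using P(2) by auto
  qed
  then have "set [a] \<noteq> set [u, y, r]" by auto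
  from endable_not_adj[OF path(2,1) this endable_hd[of "[a]"]] have "\<not> endable [u, y, r] y"
    using \<open>adj a y\<close> by auto
  then have "\<not> adj u r" using endable_spinnable[of "[u, y, r]" y] adj_sym[of u r]
    by (auto simp: spinnable_def)
  with that[OF P(1) path(2,1) \<open>adj a y\<close> \<open>a \<notin> {u, y, r}\<close>] y P(2) show ?thesis by blast
qed

lemma star_hits_centre:
  assumes "P \<in> stars" "(u, e) \<in> leaf_slots P"
  shows "\<exists>Q\<in>medium_paths. \<exists>x. hits_centre u e Q x"
proof -
  have "P \<in># Ps" using assms(1) path_kinds_subset by blast
  from this assms(2) obtain x where x: "u \<in> {hd P, last P}" "e \<in> G" "fst e = {u, x}" "adj u x"
    "x \<noteq> u"
    by (rule leaf_slotsE)
  from assms(1) x(1) obtain a y r where star: "P \<in># Ps" "oriented [a]" "oriented [u, y, r]"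
    "adj a y"
    "a \<notin> {u, y, r}" "\<not> adj u r" "set P = {u, y, r}" "P ! 1 = y" "length P = 3" by (rule starE)
  have "\<exists>Q\<in>#Ps. length Q = 3 \<and> Q ! 1 = x \<and> x \<in> set Q"
  proof (cases "x \<in> {u, y, r}")
    case True
    then have "x = y" using x(4,5) star(6) by auto
    then show ?thesis using star(1,7-9) by (intro bexI[of _ P]) auto
  next
    case False
    have "endable [u, y, r] u" using endable_hd[of "[u, y, r]"] by simp
    with star(3) obtain L M where LM: "rigid_cut L (x # M)" "M \<noteq> []"
      "set [u, y, r] \<inter> set (L @ x # M) = {}"
      using x(2,3) by (rule outside_neighbourE) (use False in simp)
    note cut = rigid_cutD[OF LM(1)]
    have "a \<notin> set (L @ x # M)"
      using oriented_common_vertex[OF star(2) cut(2), of a] cut(3) by (cases L) auto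
    moreover have "set [u, y, r] \<noteq> set (L @ x # M)" using LM(3) by auto
    ultimately have "\<not> 4 \<le> length (L @ x # M)"
      using star_leaf_not_adj_long[OF star(2-5) cut(2) _ _ cut(3) LM(2)] x(4) by blast
    with cut(2,3) LM(2) show ?thesis by (metis three_path_centreE)
  qed
  then obtain Q where Q: "Q \<in># Ps" "length Q = 3" "Q ! 1 = x" "x \<in> set Q" by blast
  then have "Q \<in> medium_paths" "hits_centre u e Q x"
    using x(2,3) by (simp_all add: medium_paths_def hits_centre_def)
  then show ?thesis by blast
qed

lemma tight_pairE:
  assumes "P \<in> tight_pairs" "(u, e) \<in> leaf_slots P"
  obtains v d x where "oriented [u, v]" "set P = {u, v}" "d \<in> G" "fst d = {u, v}"
    "e \<in> G" "fst e = {u, x}" "x \<notin> {u, v}" "adj u x"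
proof -
  from assms(1) obtain d where P: "P \<in># Ps" "length P = 2" "d \<in> G" "fst d = set P"
    by (auto simp: tight_pairs_def)
  from P(1) assms(2) obtain x where x: "u \<in> set P" "e \<in> G" "fst e = {u, x}" "adj u x" "x \<noteq> u"
    "fst e \<noteq> set P" by (rule leaf_slotsE)
  from P(2) obtain a b where "P = [a, b]" by (auto simp: length_Suc_conv numeral_2_eq_2)
  then obtain v where v: "P = [u, v] \<or> P = [v, u]" using x(1) by auto
  then have "oriented [u, v]" "set P = {u, v}" using P(1) by (auto simp: oriented_def)
  moreover from this have "x \<notin> {u, v}" using x(3,5,6) by auto
  ultimately show ?thesis using that P(3,4) x(2-4) by simp
qed

lemma tight_pair_hits_centre:
  assumes "P \<in> tight_pairs" "(u, e) \<in> leaf_slots P"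
  shows "\<exists>Q\<in>medium_paths. \<exists>x. hits_centre u e Q x"
proof -
  from assms obtain v d x where x: "oriented [u, v]" "set P = {u, v}" "d \<in> G" "fst d = {u, v}"
    "e \<in> G" "fst e = {u, x}" "x \<notin> {u, v}" "adj u x" by (rule tight_pairE)
  have "endable [u, v] u" using endable_hd[of "[u, v]"] by simp
  with x(1) obtain L M where LM: "rigid_cut L (x # M)" "M \<noteq> []" "set [u, v] \<inter> set (L @ x # M) = {}"
    using x(5,6) by (rule outside_neighbourE) (use x(7) in simp)
  note cut = rigid_cutD[OF LM(1)]
  have outside: "u \<notin> set (L @ x # M)" using LM(3) by auto
  have "oriented (rev M @ x # rev L)" using oriented_rev[of "L @ x # M"] cut(2) by simp
  then have "\<not> 3 \<le> length L" using two_path_not_adj_long[OF x(1), of "rev M" x "rev L"] outside x(8)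
    by auto
  moreover have "\<not> 3 \<le> length M" using two_path_not_adj_long[OF x(1) cut(2) outside] x(8) by blast
  ultimately have len: "length L \<in> {1, 2}" "length M \<in> {1, 2}"
    using cut(3) LM(2) by (simp_all add: not_le less_Suc_eq numeral_eq_Suc)
  from cut(2) obtain L' M' where Q: "L' @ x # M' \<in># Ps" "length L' \<in> {1, 2}" "length M' \<in> {1, 2}"
    "u \<notin> set (L' @ x # M')"
    using that[of L M] that[of "rev M" "rev L"] len outside unfolding oriented_def by auto
  then have "hits_centre u e (L' @ x # M') x" using assms x(5,6) unfolding hits_centre_def by auto
  moreover have "L' @ x # M' \<in> medium_paths" using Q by (auto simp: medium_paths_def)
  ultimately show ?thesis by blast
qed

lemma tight_pairs_not_opposite:
  assumes "P \<in> tight_pairs" "(u, e) \<in> leaf_slots P" "P' \<in> tight_pairs" "(u', e') \<in> leaf_slots P'"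
    and cut: "cut A B" "fst e = {u, last A}" "fst e' = {u', hd B}"
    and outside: "u \<notin> set (A @ B)" "u' \<notin> set (A @ B)"
  shows False
proof -
  from assms(1,2) obtain v d x where x: "oriented [u, v]" "set P = {u, v}" "d \<in> G" "fst d = {u, v}"
    "e \<in> G" "fst e = {u, x}" "x \<notin> {u, v}" "adj u x" by (rule tight_pairE)
  from assms(3,4) obtain v' d' y where y: "oriented [u', v']" "set P' = {u', v'}" "d' \<in> G"
    "fst d' = {u', v'}"
    "e' \<in> G" "fst e' = {u', y}" "y \<notin> {u', v'}" "adj u' y" by (rule tight_pairE)
  have ends: "x = last A" "y = hd B" using cut(2,3) x(6) y(6) by (auto simp: doubleton_eq_iff)
  have sets: "set [u, v] \<noteq> set (A @ B)" "set [u', v'] \<noteq> set (A @ B)" using outside by auto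
  show False
  proof (cases "set [u, v] = set [u', v']")
    case False
    have "endable [u, v] u" "endable [u', v'] u'"
      using endable_hd[of "[u, v]"] endable_hd[of "[u', v']"] by auto
    from bridge_not_adj[OF x(1) y(1) cut(1) False sets this] x(8) y(8) ends show False by simp
  next
    case True
    show False
    proof (cases "u = u'")
      case False
      then have "u' = v" using True by auto
      with insert_not_adj[OF x(1) cut(1) sets(1) reach_refl[of _ _ 0]] adj_sym[OF x(8)] y(8) ends
      show False by simp
    next
      case same: True
      have "v = v'" using True same oriented_distinct[OF x(1)] oriented_distinct[OF y(1)] by auto
      then have distinct: "e \<noteq> d" "e' \<noteq> d" "e \<noteq> e'"
        using x(4,6,7) y(4,6,7) same ends cut_last_neq_hd[OF cut(1)]
        by (auto simp: doubleton_eq_iff)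
      then have "edges_at G u = {e, d}"
        using G_edgeD(3,5)[OF x(5,6)] G_edgeD(5)[OF x(3,4)] by (intro edges_at_eq_pair)
      moreover have "e' \<in> edges_at G u" using G_edgeD(5)[OF y(5,6)] same by simp
      ultimately show False using distinct by simp
    qed
  qed
qed

lemma hits_centre_unique:
  assumes "hits_centre u e Q x" "hits_centre u' e' Q x'"
  shows "x = x'"
proof -
  have Q: "Q \<in># Ps" "fst e = {u, x}" "fst e' = {u', x'}" using assms by (auto simp: hits_centre_def)
  have pos: "length Q = 3 \<and> x = Q ! 1 \<or> length Q = 5 \<and> x = Q ! 2 \<or>
      length Q = 4 \<and> (x = Q ! 1 \<or> x = Q ! 2) \<and> (\<exists>P\<in>tight_pairs. (u, e) \<in> leaf_slots P \<and> u \<notin> set Q)"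
    if "hits_centre u e Q x" for u e x
    using that unfolding hits_centre_def by (auto simp: nth_append)
  show ?thesis
  proof (cases "length Q = 4")
    case False
    then show ?thesis using pos[OF assms(1)] pos[OF assms(2)] by auto
  next
    case True
    then obtain a y z b where abyz: "Q = [a, y, z, b]"
      by (auto simp: length_Suc_conv numeral_eq_Suc)
    then have cut: "cut [a, y] [z, b]" using oriented_path[OF Q(1)] by (simp add: cut_def)
    from pos[OF assms(1)] True obtain P where P: "P \<in> tight_pairs" "(u, e) \<in> leaf_slots P"
      "u \<notin> set Q" by auto
    from pos[OF assms(2)] True obtain P' where P': "P' \<in> tight_pairs" "(u', e') \<in> leaf_slots P'"
      "u' \<notin> set Q"
      by auto
    have "\<not> (x = y \<and> x' = z)" "\<not> (x = z \<and> x' = y)"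
      using tight_pairs_not_opposite[OF P(1,2) P'(1,2) cut]
        tight_pairs_not_opposite[OF P'(1,2) P(1,2) cut]
        Q(2,3) P(3) P'(3) abyz by auto
    moreover have "x = y \<or> x = z" "x' = y \<or> x' = z"
      using pos[OF assms(1)] pos[OF assms(2)] abyz by auto
    ultimately show ?thesis by blast
  qed
qed

definition centre_slots :: "'v list \<Rightarrow> 'v slot set" where
  "centre_slots Q = {(u, e). \<exists>x. hits_centre u e Q x}"

lemma centre_slots_card: "finite (centre_slots Q)" "card (centre_slots Q) \<le> 2"
proof -
  have "finite (centre_slots Q) \<and> card (centre_slots Q) \<le> 2"
  proof (cases "centre_slots Q = {}")
    case False
    then obtain x where x: "\<exists>u e. hits_centre u e Q x" by (auto simp: centre_slots_def)
    then have "x \<in> U" unfolding hits_centre_def using oriented_subset[OF oriented_path] by blast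
    have edge: "snd s \<in> G" "fst (snd s) = {fst s, x}" if "s \<in> centre_slots Q" for s
    proof -
      from that obtain x' where "hits_centre (fst s) (snd s) Q x'" by (auto simp: centre_slots_def)
      moreover from this x have "x' = x" using hits_centre_unique by blast
      ultimately show "snd s \<in> G" "fst (snd s) = {fst s, x}" by (simp_all add: hits_centre_def)
    qed
    have "inj_on snd (centre_slots Q)"
    proof (rule inj_onI)
      fix s s' assume s: "s \<in> centre_slots Q" "s' \<in> centre_slots Q" "snd s = snd s'"
      from G_edgeD(2)[OF edge[OF s(1)]] G_edgeD(2)[OF edge[OF s(2)]] edge(2)[OF s(1)]
        edge(2)[OF s(2)] s(3)
      show "s = s'" by (auto simp: doubleton_eq_iff prod_eq_iff)
    qed
    moreover have "snd ` centre_slots Q \<subseteq> edges_at G x"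
      using edge unfolding edges_at_def by blast
    ultimately have "finite (centre_slots Q)" "card (centre_slots Q) \<le> card (edges_at G x)"
      using finite_edges_at[of x] inj_on_finite card_inj_on_le by metis+
    with G_degree[OF \<open>x \<in> U\<close>] show ?thesis by simp
  qed simp
  then show "finite (centre_slots Q)" "card (centre_slots Q) \<le> 2" by blast+
qed

lemma four_card_le_if_hits_centre:
  assumes "X \<subseteq> set_mset Ps" "finite Y"
    and hits: "\<And>P u e. P \<in> X \<Longrightarrow> (u, e) \<in> leaf_slots P \<Longrightarrow> \<exists>Q\<in>Y. \<exists>x. hits_centre u e Q x"
  shows "4 * card X \<le> 2 * card Y + (\<Sum>v\<in>U. deficit v) +
    2 * card (X \<inter> singles) + 2 * card (X \<inter> tight_pairs)"
proof -
  have fin: "finite X" using assms(1) finite_subset by auto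
  have disjoint: "leaf_slots P \<inter> leaf_slots P' = {}" if "P \<in> X" "P' \<in> X" "P \<noteq> P'" for P P'
  proof -
    have paths: "P \<in># Ps" "P' \<in># Ps" using that(1,2) assms(1) by auto
    have "u \<in> set P \<inter> set P'" if "(u, e) \<in> leaf_slots P \<inter> leaf_slots P'" for u e
      using that paths by (auto elim: leaf_slotsE)
    with paths_disjoint[OF paths that(3)] show ?thesis by auto
  qed
  have "(\<Sum>P\<in>X. card (leaf_slots P)) = card (\<Union>P\<in>X. leaf_slots P)"
    using fin finite_leaf_slots disjoint by (intro card_UN_disjoint[symmetric]) auto
  also have "\<dots> \<le> card (\<Union>Q\<in>Y. centre_slots Q)"
  proof (rule card_mono)
    show "(\<Union>P\<in>X. leaf_slots P) \<subseteq> (\<Union>Q\<in>Y. centre_slots Q)"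
      using hits unfolding centre_slots_def by fast
  qed (use assms(2) centre_slots_card(1) in blast)
  also have "\<dots> \<le> (\<Sum>Q\<in>Y. card (centre_slots Q))" using assms(2) by (rule card_UN_le)
  also have "\<dots> \<le> (\<Sum>Q\<in>Y. 2)" by (intro sum_mono centre_slots_card(2))
  finally have slots: "(\<Sum>P\<in>X. card (leaf_slots P)) \<le> 2 * card Y" by simp
  have "4 * card X = (\<Sum>P\<in>X. 4)" by simp
  also have "\<dots> \<le> (\<Sum>P\<in>X. card (leaf_slots P) + (\<Sum>v\<in>set P. deficit v) +
      2 * of_bool (P \<in> singles) + 2 * of_bool (P \<in> tight_pairs))"
    by (intro sum_mono card_leaf_slots_ge subsetD[OF assms(1)])
  also have "\<dots> = (\<Sum>P\<in>X. card (leaf_slots P)) + (\<Sum>P\<in>X. \<Sum>v\<in>set P. deficit v) +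
      2 * card (X \<inter> singles) + 2 * card (X \<inter> tight_pairs)"
    using fin by (simp add: sum.distrib sum_distrib_left[symmetric] sum_of_bool_eq)
  also have "(\<Sum>P\<in>X. \<Sum>v\<in>set P. deficit v) \<le> (\<Sum>P\<in>set_mset Ps. \<Sum>v\<in>set P. deficit v)"
    using assms(1) by (intro sum_mono2) auto
  also have "\<dots> \<le> (\<Sum>v\<in>U. deficit v)" by (rule sum_paths_vertices_le)
  finally show ?thesis using slots by linarith
qed

lemma card_short_paths_le:
  "8 * card singles + 4 * card tight_pairs \<le> 2 * size Ps + 3 * (\<Sum>v\<in>U. deficit v)"
proof -
  let ?d = "\<Sum>v\<in>U. deficit v" and ?X = "singles \<union> stars \<union> tight_pairs"
  note disjoint = path_kinds_disjoint and fin = finite_path_kinds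
  have "?X \<inter> singles = singles" "?X \<inter> tight_pairs = tight_pairs" by blast+
  moreover have "stars \<subseteq> medium_paths" by (auto simp: stars_def medium_paths_def)
  moreover have "\<exists>Q\<in>medium_paths. \<exists>x. hits_centre u e Q x"
    if "P \<in> ?X" "(u, e) \<in> leaf_slots P" for P u e
    using that single_hits_star \<open>stars \<subseteq> medium_paths\<close> star_hits_centre tight_pair_hits_centre
    by blast
  ultimately have "4 * card ?X \<le>
      2 * card medium_paths + ?d + 2 * card singles + 2 * card tight_pairs"
    using four_card_le_if_hits_centre[of ?X medium_paths] path_kinds_subset fin by simp
  moreover have "card ?X = card singles + card stars + card tight_pairs"
    using disjoint fin by (subst card_Un_disjoint; (subst card_Un_disjoint)?) auto
  moreover have "4 * card singles \<le> 2 * card stars + ?d + 2 * card singles"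
    using four_card_le_if_hits_centre[OF path_kinds_subset(1) fin(3) single_hits_star] disjoint(1)
    by simp
  moreover have "card singles + card tight_pairs + card medium_paths \<le> size Ps"
  proof -
    have "card (singles \<union> tight_pairs \<union> medium_paths) =
        card singles + card tight_pairs + card medium_paths"
      using disjoint fin by (subst card_Un_disjoint; (subst card_Un_disjoint)?) auto
    moreover have "card (singles \<union> tight_pairs \<union> medium_paths) \<le> card (set_mset Ps)"
      using path_kinds_subset by (intro card_mono) auto
    ultimately show ?thesis by (simp add: size_paths)
  qed
  ultimately show ?thesis by linarith
qed

theorem size_paths_le: "18 * size Ps \<le> 4 * card U + 7 * (\<Sum>v\<in>U. 2 - card (edges_at G v))"
  using five_size_paths_le card_short_paths_le unfolding deficit_def by linarith

end

section \<open>From local optima to solutions\<close>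

subsection \<open>Cycles given by vertex lists\<close>

text \<open>The flag selects the parallel copy for the closing edge of a cycle of length 2.\<close>

definition cyc_edge :: "'v list \<Rightarrow> nat \<Rightarrow> 'v set \<times> bool" where
  "cyc_edge c i = ({c ! i, c ! (Suc i mod length c)}, length c = 2 \<and> i = 1)"

definition cyc_graph :: "'v list \<Rightarrow> 'v mgraph" where
  "cyc_graph c = \<lparr>verts = set c, edges = cyc_edge c ` {..<length c}\<rparr>"

lemma cyc_graph_simps [simp]:
  "verts (cyc_graph c) = set c" "edges (cyc_graph c) = cyc_edge c ` {..<length c}"
  by (simp_all add: cyc_graph_def)

lemma connected_cyc_graph: "connected_mgraph (cyc_graph c)"
proof -
  let ?r = "{(a, b). \<exists>e\<in>edges (cyc_graph c). fst e = {a, b}}"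
  have step: "(c ! i, c ! Suc i) \<in> ?r" if "Suc i < length c" for i
    using that by (auto simp: cyc_edge_def intro!: bexI[of _ i])
  have up: "(c ! 0, c ! i) \<in> ?r\<^sup>*" if "i < length c" for i
    using that
  proof (induction i)
    case (Suc i)
    then show ?case using step[of i] by (meson Suc_lessD rtrancl.rtrancl_into_rtrancl)
  qed simp
  have "sym ?r" by (auto simp: sym_def insert_commute)
  then have "sym (?r\<^sup>*)" by (rule sym_rtrancl)
  then have "(c ! i, c ! j) \<in> ?r\<^sup>*" if "i < length c" "j < length c" for i j
    using up[OF that(1)] up[OF that(2)] by (meson rtrancl_trans symD)
  then have "(u, v) \<in> ?r\<^sup>*" if "u \<in> set c" "v \<in> set c" for u v
    using that unfolding in_set_conv_nth by blast
  then show ?thesis unfolding connected_mgraph_def cyc_graph_simps(1) by blast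
qed

context
  fixes c :: "'v list"
  assumes distinct: "distinct c" and length: "2 \<le> length c"
begin

lemma Suc_mod_length_less: "Suc i mod length c < length c"
  using length by (intro mod_less_divisor) linarith

lemma inj_on_cyc_edge: "inj_on (cyc_edge c) {..<length c}"
proof (rule inj_onI, rule ccontr)
  let ?m = "length c"
  fix i j assume ij: "i \<in> {..<?m}" "j \<in> {..<?m}" "cyc_edge c i = cyc_edge c j" "i \<noteq> j"
  have "c ! i \<noteq> c ! j" using ij distinct by (simp add: nth_eq_iff_index_eq)
  then have "c ! i = c ! (Suc j mod ?m)" "c ! (Suc i mod ?m) = c ! j"
    using ij(3) by (auto simp: cyc_edge_def doubleton_eq_iff)
  then have "i = Suc j mod ?m" "j = Suc i mod ?m"
    using ij(1,2) distinct Suc_mod_length_less by (auto simp: nth_eq_iff_index_eq)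
  then have "(i + 2) mod ?m = i mod ?m" using ij(1) by (simp add: mod_Suc_eq)
  then have "?m dvd 2" by (simp add: mod_eq_dvd_iff_nat)
  then have "?m = 2" using length dvd_imp_le[of ?m 2] by simp
  then show False using ij by (auto simp: cyc_edge_def)
qed

lemma degree_in_cyc_graph:
  assumes "v \<in> set c"
  shows "degree_in (cyc_graph c) v = 2"
proof -
  let ?m = "length c"
  from assms obtain j where j: "j < ?m" "v = c ! j" by (auto simp: in_set_conv_nth)
  define k where "k = (if j = 0 then ?m - 1 else j - 1)"
  have k: "k < ?m" "k \<noteq> j" using j length by (auto simp: k_def)
  have "v \<in> fst (cyc_edge c i) \<longleftrightarrow> i \<in> {j, k}" if "i < ?m" for i
  proof -
    have "v \<in> fst (cyc_edge c i) \<longleftrightarrow> i = j \<or> Suc i mod ?m = j"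
      using that j distinct Suc_mod_length_less[of i]
      by (auto simp: cyc_edge_def nth_eq_iff_index_eq)
    moreover have "Suc i mod ?m = j \<longleftrightarrow> i = k" using that j(1) by (auto simp: mod_Suc k_def)
    ultimately show ?thesis by simp
  qed
  then have "{e \<in> cyc_edge c ` {..<?m}. v \<in> fst e} = cyc_edge c ` {j, k}" using j k by auto
  moreover have "card (cyc_edge c ` {j, k}) = card {j, k}"
    using j k by (intro card_image inj_on_subset[OF inj_on_cyc_edge]) auto
  ultimately show ?thesis using k by (simp add: degree_in_def)
qed

lemma is_cycle_cyc_graph:
  assumes "set c \<subseteq> V" "length c = 2 \<Longrightarrow> set c \<in> \<T>"
  shows "is_cycle V \<T> (cyc_graph c)"
proof -
  have "cyc_edge c i \<in> dup_edges V \<T>" if i: "i < length c" for i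
  proof -
    have "i \<noteq> Suc i mod length c" using i length by (simp add: mod_Suc)
    then have card: "card {c ! i, c ! (Suc i mod length c)} = 2"
      using i distinct Suc_mod_length_less by (simp add: nth_eq_iff_index_eq card_insert_if)
    have sub: "{c ! i, c ! (Suc i mod length c)} \<subseteq> set c" using i Suc_mod_length_less by auto
    show ?thesis
    proof (cases "length c = 2 \<and> i = 1")
      case True
      have "{c ! i, c ! (Suc i mod length c)} = set c"
        using sub card True distinct_card[OF distinct] by (intro card_subset_eq) simp_all
      then show ?thesis using True assms(2) card by (simp add: cyc_edge_def dup_edges_def)
    next
      case False
      then show ?thesis
        using sub card assms(1) by (auto simp: cyc_edge_def dup_edges_def complete_edges_def)
    qed
  qed
  then have "is_subgraph V \<T> (cyc_graph c)"
    unfolding is_subgraph_def using assms(1) Suc_mod_length_less by (auto simp: cyc_edge_def)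
  then show ?thesis unfolding is_cycle_def
    using connected_cyc_graph degree_in_cyc_graph length by auto
qed

end

fun path_cost :: "('v set \<Rightarrow> nat) \<Rightarrow> 'v list \<Rightarrow> nat" where
  "path_cost w (x # y # zs) = w {x, y} + path_cost w (y # zs)"
| "path_cost w _ = 0"

definition tour_cost :: "('v set \<Rightarrow> nat) \<Rightarrow> 'v list \<Rightarrow> nat" where
  "tour_cost w c = path_cost w c + w {last c, hd c}"

lemma path_cost_append:
  "A \<noteq> [] \<Longrightarrow> B \<noteq> [] \<Longrightarrow> path_cost w (A @ B) = path_cost w A + path_cost w B + w {last A, hd B}"
proof (induction w A rule: path_cost.induct)
  case ("2_2" w x)
  then show ?case by (cases B) auto
qed auto

lemma path_cost_conv_sum: "path_cost w c = (\<Sum>i<length c - 1. w {c ! i, c ! Suc i})"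
proof (induction w c rule: path_cost.induct)
  case (1 w x y zs)
  then show ?case by (simp add: sum.lessThan_Suc_shift del: sum.lessThan_Suc)
qed auto

lemma sum_edges_cyc_graph:
  assumes "distinct c" "2 \<le> length c"
  shows "(\<Sum>e\<in>edges (cyc_graph c). w (fst e)) = tour_cost w c"
proof -
  from assms(2) obtain m where m: "length c = Suc m" "m \<ge> 1" by (cases "length c") auto
  have "c \<noteq> []" using assms(2) by auto
  then have "c ! m = last c" "c ! 0 = hd c" using m by (auto simp: last_conv_nth hd_conv_nth)
  moreover have "(\<Sum>e\<in>edges (cyc_graph c). w (fst e)) =
      (\<Sum>i<length c. w {c ! i, c ! (Suc i mod length c)})"
    unfolding cyc_graph_simps by (subst sum.reindex[OF inj_on_cyc_edge[OF assms]])
      (simp add: cyc_edge_def)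
  ultimately show ?thesis using m by (simp add: tour_cost_def path_cost_conv_sum)
qed

lemma path_cost_successively:
  assumes "\<And>u v. adj u v \<Longrightarrow> w {u, v} = 1" "successively adj c"
  shows "path_cost w c = length c - 1"
  using assms by (induction w c rule: path_cost.induct) auto

lemma path_cost_concat_le:
  assumes "ps \<noteq> []" "\<And>P. P \<in> set ps \<Longrightarrow> P \<noteq> [] \<and> path_cost w P = length P - 1"
    and "distinct (concat ps)"
    and "\<And>u v. u \<in> set (concat ps) \<Longrightarrow> v \<in> set (concat ps) \<Longrightarrow> u \<noteq> v \<Longrightarrow> w {u, v} \<le> 2"
  shows "path_cost w (concat ps) + 2 \<le> length (concat ps) + length ps"
  using assms
proof (induction ps rule: list_nonempty_induct)
  case (cons P ps)
  have P: "P \<noteq> []" "path_cost w P = length P - 1" using cons.prems(1) by auto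
  have ps: "concat ps \<noteq> []" using cons.hyps cons.prems(1) by (cases ps) auto
  have ends: "last P \<in> set P" "hd (concat ps) \<in> set (concat ps)" 
    by (rule last_in_set[OF P(1)] hd_in_set[OF ps])+
  then have "last P \<noteq> hd (concat ps)" using cons.prems(2) by (auto simp: disjoint_iff)
  then have "w {last P, hd (concat ps)} \<le> 2" using ends by (intro cons.prems(3)) auto
  moreover have "path_cost w (concat ps) + 2 \<le> length (concat ps) + length ps"
    using cons.prems by (intro cons.IH) auto
  moreover have "1 \<le> length P" using P(1) by (simp add: Suc_le_eq)
  ultimately show ?case using P path_cost_append[OF P(1) ps, of w] by simp
qed (auto simp: Suc_le_eq)

subsection \<open>Invariants of the local search\<close>

definition proper :: "'v multiset \<Rightarrow> 'v state \<Rightarrow> bool" where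
  "proper M S \<longleftrightarrow> [] \<notin># fst S \<and> [] \<notin># snd S \<and> vertices S = M"

definition light_state :: "('v \<Rightarrow> 'v \<Rightarrow> bool) \<Rightarrow> 'v set set \<Rightarrow> 'v state \<Rightarrow> bool" where
  "light_state adj \<T> S \<longleftrightarrow> (\<forall>P\<in>#fst S. successively adj P) \<and>
     (\<forall>c\<in>#snd S. successively adj c \<and> adj (last c) (hd c) \<and> closed_wrt \<T> (set c))"

lemma proper_reach:
  assumes "proper M S" "reach adj \<T> n S S'"
  shows "proper M S'"
  using assms(2)
proof (induction rule: reach_induct)
  case (step n S1 S2)
  have "[] \<notin># fst S2 \<and> [] \<notin># snd S2"
    using step(2,3) by (induction rule: move.induct) (auto simp: proper_def)
  then show ?case using step(3) vertices_move[OF step(2)] by (simp add: proper_def)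
qed (rule assms(1))

lemma light_state_move:
  assumes "\<And>u v. adj u v \<Longrightarrow> adj v u" "move adj \<T> S S'" "light_state adj \<T> S"
  shows "light_state adj \<T> S'"
  using assms(2,3)
proof (induction rule: move.induct)
  case (reverse P R C)
  have "successively (\<lambda>x y. adj y x) P" if "successively adj P"
    using that by (rule successively_mono) (auto intro: assms(1))
  with reverse show ?case by (auto simp: light_state_def)
next
  case (unclose A B R C)
  then have "successively adj (A @ B)" "adj (last (A @ B)) (hd (A @ B))"
    by (auto simp: light_state_def)
  then have "successively adj (B @ A)"
    by (cases "A = []"; cases "B = []") (auto simp: successively_append_iff)
  with unclose show ?case by (auto simp: light_state_def)
qed (auto simp: light_state_def successively_append_iff)

lemma light_state_reach:
  assumes "\<And>u v. adj u v \<Longrightarrow> adj v u" "light_state adj \<T> S" "reach adj \<T> n S S'"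
  shows "light_state adj \<T> S'"
  using assms(3)
proof (induction rule: reach_induct)
  case (step n S1 S2)
  from light_state_move[OF assms(1) step(2,3)] show ?case .
qed (rule assms(2))

subsection \<open>Comparing a local optimum with an optimal solution\<close>

lemma opt_attained:
  assumes "smc_instance V \<T>" "disjoint_cycles V \<T> \<D>" "respects_terminals \<T> \<D>"
  obtains \<C> where "disjoint_cycles V \<T> \<C>" "respects_terminals \<T> \<C>" "cost w \<C> = opt V w \<T>"
proof -
  let ?costs = "{cost w \<C> |\<C>. disjoint_cycles V \<T> \<C> \<and> respects_terminals \<T> \<C>}"
  have "finite ?costs" using finite_imageI[OF finite_solutions[OF assms(1)], of "cost w"]
    by (simp add: setcompr_eq_image)
  moreover have "?costs \<noteq> {}" using assms(2,3) by blast
  ultimately have "opt V w \<T> \<in> ?costs" unfolding opt_def by (rule Min_in)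
  with that show ?thesis by auto
qed

definition light :: "'v set \<Rightarrow> ('v set \<Rightarrow> nat) \<Rightarrow> 'v \<Rightarrow> 'v \<Rightarrow> bool" where
  "light V w u v \<longleftrightarrow> u \<in> V \<and> v \<in> V \<and> u \<noteq> v \<and> w {u, v} = 1"

lemma light_sym: "light V w u v \<Longrightarrow> light V w v u"
  by (auto simp: light_def insert_commute)

locale one_two_instance =
  fixes V :: "'v set" and w :: "'v set \<Rightarrow> nat" and \<T> :: "'v set set"
  assumes smc_instance: "smc_instance V \<T>"
    and weights: "e \<in> complete_edges V \<Longrightarrow> w e \<in> {1, 2}"
begin

lemma finite_vertices: "finite V"
  and terminals_subset: "\<Union>\<T> \<subseteq> V"
  and terminal_card: "T \<in> \<T> \<Longrightarrow> 2 \<le> card T"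
  using smc_instance by (auto simp: smc_instance_def)

lemma finite_terminals: "finite (\<Union>\<T>)"
  using terminals_subset finite_vertices by (rule finite_subset)

lemma closed_wrt_card:
  assumes "finite X" "X \<noteq> {}" "X \<subseteq> \<Union>\<T>" "closed_wrt \<T> X"
  shows "2 \<le> card X" "card X = 2 \<Longrightarrow> X \<in> \<T>"
proof -
  from assms(2,3) obtain T x where T: "T \<in> \<T>" "x \<in> T" "x \<in> X" by blast
  then have "T \<subseteq> X" using assms(4) by (auto simp: closed_wrt_def)
  then have "card T \<le> card X" using assms(1) by (intro card_mono)
  then show "2 \<le> card X" using terminal_card[OF T(1)] by simp
  show "X \<in> \<T>" if "card X = 2"
    using card_seteq[OF assms(1) \<open>T \<subseteq> X\<close>] terminal_card[OF T(1)] that T(1) by simp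
qed

end

locale one_two_solution = one_two_instance V w \<T>
  for V :: "'v set" and w :: "'v set \<Rightarrow> nat" and \<T> :: "'v set set" +
  fixes \<C> :: "'v mgraph set"
  assumes disjoint_cycles: "disjoint_cycles V \<T> \<C>"
    and respects_terminals: "respects_terminals \<T> \<C>"
begin

definition all_edges :: "('v set \<times> bool) set" where
  "all_edges = (\<Union>C\<in>\<C>. edges C)"

definition good_edges :: "('v set \<times> bool) set" where
  "good_edges = {e \<in> all_edges. w (fst e) = 1 \<and> fst e \<subseteq> \<Union>\<T>}"

lemma is_cycle: "C \<in> \<C> \<Longrightarrow> is_cycle V \<T> C"
  using disjoint_cycles by (simp add: disjoint_cycles_def)

lemma cycles_eq_if_common_vertex:
  "C \<in> \<C> \<Longrightarrow> D \<in> \<C> \<Longrightarrow> v \<in> verts C \<Longrightarrow> v \<in> verts D \<Longrightarrow> C = D"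
  using disjoint_cycles by (auto simp: disjoint_cycles_def)

lemma edgeD:
  assumes "C \<in> \<C>" "e \<in> edges C"
  shows "fst e \<subseteq> verts C" "fst e \<in> complete_edges V" "finite (fst e)" "card (fst e) = 2"
proof -
  have subgraph: "is_subgraph V \<T> C" using is_cycle[OF assms(1)] by (simp add: is_cycle_def)
  then have "e \<in> dup_edges V \<T>" using assms(2) by (auto simp: is_subgraph_def)
  moreover have "T \<subseteq> V" if "T \<in> \<T>" for T using terminals_subset that by blast
  ultimately show "fst e \<in> complete_edges V"
    unfolding dup_edges_def complete_edges_def by fastforce
  then show "card (fst e) = 2" by (simp add: complete_edges_def)
  then show "finite (fst e)" using card_gt_0_iff[of "fst e"] by simp
  show "fst e \<subseteq> verts C" using subgraph assms(2) by (simp add: is_subgraph_def)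
qed

lemma finite_all_edges: "finite all_edges"
proof (rule finite_subset)
  show "all_edges \<subseteq> Pow V \<times> UNIV"
    using edgeD(2) by (fastforce simp: all_edges_def complete_edges_def)
qed (simp add: finite_vertices)

lemma good_edges_subset: "good_edges \<subseteq> all_edges"
  by (auto simp: good_edges_def)

lemma terminal_vertexE:
  assumes "v \<in> \<Union>\<T>"
  obtains C where "C \<in> \<C>" "v \<in> verts C"
  using assms respects_terminals that by (fastforce simp: respects_terminals_def)

lemma edges_at_all_edges:
  assumes "C \<in> \<C>" "v \<in> verts C"
  shows "edges_at all_edges v = {e \<in> edges C. v \<in> fst e}"
proof -
  have "D = C" if "D \<in> \<C>" "e \<in> edges D" "v \<in> fst e" for D e
    using that edgeD(1)[OF that(1,2)] cycles_eq_if_common_vertex[OF that(1) assms(1) _ assms(2)]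
    by blast
  then show ?thesis using assms(1) unfolding edges_at_def all_edges_def by blast
qed

lemma card_edges_at_all_edges:
  assumes "v \<in> \<Union>\<T>"
  shows "card (edges_at all_edges v) = 2"
proof -
  from assms obtain C where C: "C \<in> \<C>" "v \<in> verts C" by (rule terminal_vertexE)
  then have "degree_in C v = 2" using is_cycle by (simp add: is_cycle_def)
  then show ?thesis by (simp add: edges_at_all_edges[OF C] degree_in_def)
qed

lemma finite_cycles: "finite \<C>"
proof (rule finite_imageD)
  show "finite (verts ` \<C>)"
  proof (rule finite_subset)
    show "verts ` \<C> \<subseteq> Pow V" using is_cycle unfolding is_cycle_def is_subgraph_def by blast
  qed (simp add: finite_vertices)
  show "inj_on verts \<C>"
  proof (rule inj_onI)
    fix C D assume CD: "C \<in> \<C>" "D \<in> \<C>" "verts C = verts D"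
    then obtain x where "x \<in> verts C" using is_cycle unfolding is_cycle_def by blast
    then show "C = D" using cycles_eq_if_common_vertex CD by blast
  qed
qed

lemma cost_conv_sum: "cost w \<C> = (\<Sum>e\<in>all_edges. w (fst e))"
proof -
  have "edges C \<inter> edges D = {}" if CD: "C \<in> \<C>" "D \<in> \<C>" "C \<noteq> D" for C D
  proof (rule ccontr)
    assume "edges C \<inter> edges D \<noteq> {}"
    then obtain e where e: "e \<in> edges C" "e \<in> edges D" by auto
    have "fst e \<noteq> {}" using edgeD(4)[OF CD(1) e(1)] by auto
    then show False
      using edgeD(1)[OF CD(1) e(1)] edgeD(1)[OF CD(2) e(2)] cycles_eq_if_common_vertex CD by blast
  qed
  moreover have "finite (edges C)" if "C \<in> \<C>" for C
    using finite_all_edges by (rule rev_finite_subset) (use that in \<open>auto simp: all_edges_def\<close>)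
  ultimately show ?thesis
    unfolding cost_def all_edges_def
    using finite_cycles by (intro sum.UNION_disjoint[symmetric]) auto
qed

lemma card_terminal_ends_le:
  assumes "e \<in> all_edges"
  shows "card (fst e \<inter> \<Union>\<T>) + of_bool (e \<notin> good_edges) * card (fst e \<inter> \<Union>\<T>) \<le> 2 * w (fst e)"
proof -
  from assms obtain C where C: "C \<in> \<C>" "e \<in> edges C" by (auto simp: all_edges_def)
  note e = edgeD[OF C]
  have at_most_two: "card (fst e \<inter> \<Union>\<T>) \<le> 2" using card_mono[OF e(3), of "fst e \<inter> \<Union>\<T>"] e(4) by simp
  show ?thesis
  proof (cases "w (fst e) = 1 \<and> \<not> fst e \<subseteq> \<Union>\<T>")
    case True
    then have "card (fst e \<inter> \<Union>\<T>) < 2" using psubset_card_mono[OF e(3), of "fst e \<inter> \<Union>\<T>"] e(4) by auto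
    then show ?thesis using True by auto
  next
    case False
    then show ?thesis using weights[OF e(2)] at_most_two assms by (auto simp: good_edges_def)
  qed
qed

lemma sum_card_edges_at:
  "finite X \<Longrightarrow> (\<Sum>v\<in>\<Union>\<T>. card (edges_at X v)) = (\<Sum>e\<in>X. card (fst e \<inter> \<Union>\<T>))"
  unfolding edges_at_def using finite_terminals
  by (intro sum_multicount_gen) (auto intro!: arg_cong[where f = card])

lemma deficit_le_cost:
  "(\<Sum>v\<in>\<Union>\<T>. 2 - card (edges_at good_edges v)) + 2 * card (\<Union>\<T>) \<le> 2 * cost w \<C>"
proof -
  let ?U = "\<Union>\<T>" and ?bad = "all_edges - good_edges" and ?ends = "\<lambda>e. card (fst e \<inter> \<Union>\<T>)"
  have "2 - card (edges_at good_edges v) = card (edges_at ?bad v)" if "v \<in> ?U" for v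
  proof -
    have "edges_at good_edges v \<subseteq> edges_at all_edges v"
      using good_edges_subset by (auto simp: edges_at_def)
    moreover have "edges_at ?bad v = edges_at all_edges v - edges_at good_edges v"
      by (auto simp: edges_at_def)
    moreover have "finite (edges_at good_edges v)"
      using finite_all_edges by (simp add: edges_at_def good_edges_def)
    ultimately show ?thesis using card_edges_at_all_edges[OF that] by (simp add: card_Diff_subset)
  qed
  then have "(\<Sum>v\<in>?U. 2 - card (edges_at good_edges v)) = (\<Sum>v\<in>?U. card (edges_at ?bad v))" by simp
  also have "\<dots> = (\<Sum>e\<in>?bad. ?ends e)" using finite_all_edges by (intro sum_card_edges_at) simp
  also have "\<dots> = (\<Sum>e\<in>all_edges. of_bool (e \<notin> good_edges) * ?ends e)"
    using finite_all_edges by (intro sum.mono_neutral_cong_left) auto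
  finally have deficits: "(\<Sum>v\<in>?U. 2 - card (edges_at good_edges v)) =
    (\<Sum>e\<in>all_edges. of_bool (e \<notin> good_edges) * ?ends e)" .
  have "2 * card ?U = (\<Sum>v\<in>?U. card (edges_at all_edges v))" using card_edges_at_all_edges by simp
  also have "\<dots> = (\<Sum>e\<in>all_edges. ?ends e)" by (rule sum_card_edges_at[OF finite_all_edges])
  finally have "(\<Sum>v\<in>?U. 2 - card (edges_at good_edges v)) + 2 * card ?U =
      (\<Sum>e\<in>all_edges. ?ends e + of_bool (e \<notin> good_edges) * ?ends e)"
    unfolding deficits sum.distrib by simp
  also have "\<dots> \<le> (\<Sum>e\<in>all_edges. 2 * w (fst e))" by (intro sum_mono card_terminal_ends_le)
  also have "\<dots> = 2 * cost w \<C>" by (simp add: cost_conv_sum sum_distrib_left)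
  finally show ?thesis .
qed

text \<open>A set that no edge of the solution leaves is a union of vertex sets of cycles.\<close>

lemma closed_wrt_if_good_edges_inside:
  assumes "X \<subseteq> \<Union>\<T>"
    and inside: "\<And>v. v \<in> X \<Longrightarrow>
      card (edges_at good_edges v) = 2 \<and> (\<forall>e\<in>edges_at good_edges v. fst e \<subseteq> X)"
  shows "closed_wrt \<T> X"
  unfolding closed_wrt_def
proof (intro ballI disjCI)
  fix T assume T: "T \<in> \<T>" "T \<inter> X \<noteq> {}"
  then obtain x where x: "x \<in> T" "x \<in> X" by auto
  have "x \<in> \<Union>\<T>" using T(1) x(1) by blast
  then obtain C where C: "C \<in> \<C>" "x \<in> verts C" by (rule terminal_vertexE)
  have stays: "fst e \<subseteq> X" if "v \<in> X" "e \<in> all_edges" "v \<in> fst e" for v e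
  proof -
    have "edges_at good_edges v = edges_at all_edges v"
    proof (rule card_subset_eq)
      show "edges_at good_edges v \<subseteq> edges_at all_edges v"
        using good_edges_subset by (auto simp: edges_at_def)
      have "v \<in> \<Union>\<T>" using that(1) assms(1) by blast
      then show "card (edges_at good_edges v) = card (edges_at all_edges v)"
        using inside[OF that(1)] by (simp add: card_edges_at_all_edges)
    qed (simp add: edges_at_def finite_all_edges)
    then have "e \<in> edges_at good_edges v" using that(2,3) by (simp add: edges_at_def)
    then show ?thesis using inside[OF that(1)] by blast
  qed
  have "v \<in> X" if "v \<in> verts C" for v
  proof -
    have "(x, v) \<in> {(a, b). \<exists>e\<in>edges C. fst e = {a, b}}\<^sup>*"
      using is_cycle[OF C(1)] C(2) that by (auto simp: is_cycle_def connected_mgraph_def)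
    then show ?thesis
    proof (induction rule: rtrancl_induct)
      case (step y z)
      then obtain e where e: "e \<in> edges C" "fst e = {y, z}" by auto
      then have "e \<in> all_edges" using C(1) by (auto simp: all_edges_def)
      with stays[OF step.IH this] e(2) show ?case by simp
    qed (rule x(2))
  qed
  moreover have "T \<subseteq> verts C"
    using respects_terminals C T(1) x(1)
    unfolding respects_terminals_def cycle_respects_def by blast
  ultimately show "T \<subseteq> X" by blast
qed

lemma charging_good_edges:
  assumes "proper (mset_set (\<Union>\<T>)) (Ps, Cs)" "local_opt (light V w) \<T> 100 (Ps, Cs)"
  shows "charging (light V w) \<T> (\<Union>\<T>) Ps Cs good_edges"
proof
  show "light V w v u" if "light V w u v" for u v using that by (rule light_sym)
  show "\<not> light V w u u" for u by (simp add: light_def)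
  show "finite (\<Union>\<T>)" by (rule finite_terminals)
  show "\<not> closed_wrt \<T> {x}" if "x \<in> \<Union>\<T>" for x using closed_wrt_card(1)[of "{x}"] that by auto
  show "vertices (Ps, Cs) = mset_set (\<Union>\<T>)" "[] \<notin># Ps" using assms(1) by (simp_all add: proper_def)
  show "finite good_edges" using finite_all_edges by (simp add: good_edges_def)
  show "\<exists>u v. fst e = {u, v} \<and> u \<in> \<Union>\<T> \<and> v \<in> \<Union>\<T> \<and> light V w u v" if e: "e \<in> good_edges" for e
  proof -
    from e obtain C where C: "C \<in> \<C>" "e \<in> edges C" by (auto simp: good_edges_def all_edges_def)
    obtain u v where "fst e = {u, v}" "u \<noteq> v" using edgeD(4)[OF C] by (auto simp: card_2_iff)
    then show ?thesis using e edgeD(2)[OF C]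
      by (intro exI[of _ u] exI[of _ v]) (simp add: good_edges_def light_def complete_edges_def)
  qed
  show "card (edges_at good_edges v) \<le> 2" if "v \<in> \<Union>\<T>" for v
    unfolding card_edges_at_all_edges[OF that, symmetric]
    using finite_all_edges good_edges_subset by (intro card_mono) (auto simp: edges_at_def)
qed (fact closed_wrt_if_good_edges_inside assms(2))+

theorem local_optimum_bound:
  assumes "proper (mset_set (\<Union>\<T>)) (Ps, Cs)" "local_opt (light V w) \<T> 100 (Ps, Cs)"
  shows "9 * (card (\<Union>\<T>) + size Ps) \<le> 11 * cost w \<C>"
proof -
  obtain d where "18 * size Ps \<le> 4 * card (\<Union>\<T>) + 7 * d" "d + 2 * card (\<Union>\<T>) \<le> 2 * cost w \<C>"
    using charging.size_paths_le[OF charging_good_edges[OF assms]] deficit_le_cost by blast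
  then show ?thesis by simp
qed

end

subsection \<open>Joining the paths of a local optimum\<close>

definition out_cycles :: "'v list list \<Rightarrow> 'v list list \<Rightarrow> 'v list list" where
  "out_cycles ps cs = (if ps = [] then cs else concat ps # cs)"

lemma concat_out_cycles: "concat (out_cycles ps cs) = concat ps @ concat cs"
  by (simp add: out_cycles_def)

context one_two_instance
begin

definition tours :: "'v list list \<Rightarrow> bool" where
  "tours L \<longleftrightarrow> distinct (concat L) \<and> set (concat L) = \<Union>\<T> \<and>
     (\<forall>c\<in>set L. c \<noteq> [] \<and> closed_wrt \<T> (set c))"

lemma toursD:
  assumes "tours L" "c \<in> set L"
  shows "distinct c" "set c \<subseteq> \<Union>\<T>" "c \<noteq> []" "closed_wrt \<T> (set c)"
    "2 \<le> length c" "length c = 2 \<Longrightarrow> set c \<in> \<T>"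
proof -
  show tour: "distinct c" "set c \<subseteq> \<Union>\<T>" "c \<noteq> []" "closed_wrt \<T> (set c)"
    using assms by (auto simp: tours_def distinct_concat_iff)
  then have "card (set c) = length c" by (intro distinct_card)
  then show "2 \<le> length c" "length c = 2 \<Longrightarrow> set c \<in> \<T>"
    using closed_wrt_card[of "set c"] tour by simp_all
qed

lemma tours_disjoint: "tours L \<Longrightarrow> c \<in> set L \<Longrightarrow> d \<in> set L \<Longrightarrow> c \<noteq> d \<Longrightarrow> set c \<inter> set d = {}"
  unfolding tours_def distinct_concat_iff by blast

lemma distinct_tours: "tours L \<Longrightarrow> distinct L"
  unfolding tours_def distinct_concat_iff by (metis removeAll_id)

lemma inj_on_cyc_graph:
  assumes "tours L"
  shows "inj_on cyc_graph (set L)"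
proof (rule inj_onI)
  fix c d assume cd: "c \<in> set L" "d \<in> set L" "cyc_graph c = cyc_graph d"
  then have "set c = set d" by (metis cyc_graph_simps(1))
  then show "c = d" using tours_disjoint[OF assms cd(1,2)] toursD(3)[OF assms cd(1)] by fastforce
qed

lemma disjoint_cycles_tours:
  assumes "tours L"
  shows "disjoint_cycles V \<T> (cyc_graph ` set L)"
  unfolding disjoint_cycles_def
proof (intro conjI ballI impI)
  fix C assume "C \<in> cyc_graph ` set L"
  then obtain c where c: "c \<in> set L" "C = cyc_graph c" by auto
  note tour = toursD[OF assms c(1)]
  show "is_cycle V \<T> C"
    unfolding c(2) using tour(1,5) order_trans[OF tour(2) terminals_subset] tour(6)
    by (rule is_cycle_cyc_graph)
next
  fix C D assume "C \<in> cyc_graph ` set L" "D \<in> cyc_graph ` set L" "C \<noteq> D"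
  then obtain c d where "c \<in> set L" "d \<in> set L" "c \<noteq> d" "C = cyc_graph c" "D = cyc_graph d" by auto
  then show "verts C \<inter> verts D = {}" using tours_disjoint[OF assms] by simp
qed

lemma respects_terminals_tours:
  assumes "tours L"
  shows "respects_terminals \<T> (cyc_graph ` set L)"
  unfolding respects_terminals_def
proof (intro conjI ballI)
  fix C assume "C \<in> cyc_graph ` set L"
  then obtain c where "c \<in> set L" "C = cyc_graph c" by auto
  then show "cycle_respects \<T> C"
    using toursD(4)[OF assms] by (simp add: cycle_respects_def closed_wrt_def)
next
  fix T v assume "T \<in> \<T>" "v \<in> T"
  then have "v \<in> set (concat L)" using assms by (auto simp: tours_def)
  then show "\<exists>C\<in>cyc_graph ` set L. v \<in> verts C" by auto
qed

lemma cost_tours: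
  assumes "tours L"
  shows "cost w (cyc_graph ` set L) = (\<Sum>c\<leftarrow>L. tour_cost w c)"
proof -
  have "cost w (cyc_graph ` set L) = (\<Sum>c\<in>set L. \<Sum>e\<in>edges (cyc_graph c). w (fst e))"
    unfolding cost_def by (subst sum.reindex[OF inj_on_cyc_graph[OF assms]]) simp
  also have "\<dots> = (\<Sum>c\<in>set L. tour_cost w c)"
    by (intro sum.cong refl sum_edges_cyc_graph) (simp_all add: toursD[OF assms])
  finally show ?thesis using distinct_tours[OF assms] by (simp add: sum_list_distinct_conv_sum_set)
qed

lemma closed_wrt_Diff_Union:
  assumes "\<And>X. X \<in> \<X> \<Longrightarrow> closed_wrt \<T> X"
  shows "closed_wrt \<T> (\<Union>\<T> - \<Union>\<X>)"
  unfolding closed_wrt_def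
proof (intro ballI disjCI)
  fix T assume T: "T \<in> \<T>" "T \<inter> (\<Union>\<T> - \<Union>\<X>) \<noteq> {}"
  then obtain v where v: "v \<in> T" "v \<notin> \<Union>\<X>" by blast
  have "T \<inter> X = {}" if "X \<in> \<X>" for X
    using assms[OF that] T(1) v that unfolding closed_wrt_def by blast
  then show "T \<subseteq> \<Union>\<T> - \<Union>\<X>" using T(1) by blast
qed

lemma tours_out_cycles:
  assumes "proper (mset_set (\<Union>\<T>)) (mset ps, mset cs)" "\<And>c. c \<in> set cs \<Longrightarrow> closed_wrt \<T> (set c)"
  shows "tours (out_cycles ps cs)"
proof -
  let ?L = "out_cycles ps cs"
  have cover: "mset (concat ?L) = mset_set (\<Union>\<T>)" and nonempty: "[] \<notin> set ps" "[] \<notin> set cs"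
    using assms(1) by (simp_all add: concat_out_cycles proper_def vertices_mset)
  have "distinct (concat ?L)" using cover
    by (intro distinct_if_mset_subseteq_mset_set[of _ "\<Union>\<T>"]) simp
  moreover have set: "set (concat ?L) = \<Union>\<T>"
    using cover finite_terminals by (metis finite_set_mset_mset_set set_mset_mset)
  moreover have "c \<noteq> []" "closed_wrt \<T> (set c)" if c: "c \<in> set ?L" for c
  proof -
    show "c \<noteq> []" using c nonempty by (cases ps) (auto simp: out_cycles_def split: if_splits)
    show "closed_wrt \<T> (set c)"
    proof (cases "c \<in> set cs")
      case False
      with c have "c = concat ps" by (auto simp: out_cycles_def split: if_splits)
      then have "set c = \<Union>\<T> - \<Union>(set ` set cs)"
        using set \<open>distinct (concat ?L)\<close> unfolding concat_out_cycles by auto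
      then show ?thesis using closed_wrt_Diff_Union[of "set ` set cs"] assms(2) by auto
    qed (rule assms(2))
  qed
  ultimately show ?thesis unfolding tours_def by blast
qed

lemma tour_cost_light:
  assumes "c \<noteq> []" "successively (light V w) c" "light V w (last c) (hd c)"
  shows "tour_cost w c = length c"
proof -
  have "w {u, v} = 1" if "light V w u v" for u v using that by (simp add: light_def)
  then have "path_cost w c = length c - 1" "w {last c, hd c} = 1"
    using path_cost_successively[of "light V w" w c] assms(2,3) by blast+
  then show ?thesis using assms(1) by (simp add: tour_cost_def Suc_le_eq)
qed

lemma tour_cost_concat_le:
  assumes "ps \<noteq> []" "\<And>P. P \<in> set ps \<Longrightarrow> P \<noteq> [] \<and> successively (light V w) P"
    and "distinct (concat ps)" "set (concat ps) \<subseteq> \<Union>\<T>" "2 \<le> length (concat ps)"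
  shows "tour_cost w (concat ps) \<le> length (concat ps) + length ps"
proof -
  have weight_le: "w {u, v} \<le> 2" if "u \<in> set (concat ps)" "v \<in> set (concat ps)" "u \<noteq> v" for u v
  proof -
    have "{u, v} \<in> complete_edges V"
      using that assms(4) terminals_subset unfolding complete_edges_def by (simp add: subset_iff)
    then show ?thesis using weights by fastforce
  qed
  have "path_cost w P = length P - 1" if "P \<in> set ps" for P
    using path_cost_successively[of "light V w" w P] assms(2)[OF that] by (simp add: light_def)
  then have "path_cost w (concat ps) + 2 \<le> length (concat ps) + length ps"
    using assms(1-3) weight_le by (intro path_cost_concat_le) simp_all
  moreover have "w {last (concat ps), hd (concat ps)} \<le> 2"
  proof (rule weight_le)
    from assms(5) obtain x y zs where "concat ps = x # y # zs"
      by (cases "concat ps" rule: remdups_adj.cases) auto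
    then show "last (concat ps) \<in> set (concat ps)" "hd (concat ps) \<in> set (concat ps)"
      "last (concat ps) \<noteq> hd (concat ps)" using assms(3) by (auto simp del: set_concat)
  qed
  ultimately show ?thesis by (simp add: tour_cost_def)
qed

lemma cost_out_cycles_le:
  assumes "proper (mset_set (\<Union>\<T>)) (mset ps, mset cs)" "light_state (light V w) \<T> (mset ps, mset cs)"
  shows "cost w (cyc_graph ` set (out_cycles ps cs)) \<le> card (\<Union>\<T>) + length ps"
proof -
  let ?L = "out_cycles ps cs"
  have ps: "P \<noteq> [] \<and> successively (light V w) P" if "P \<in> set ps" for P
    using assms that by (auto simp: proper_def light_state_def)
  have cs: "c \<noteq> []" "successively (light V w) c" "light V w (last c) (hd c)" "closed_wrt \<T> (set c)"
    if "c \<in> set cs" for c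
    using assms that by (auto simp: proper_def light_state_def)
  have tours: "tours ?L" using assms(1) cs(4) by (rule tours_out_cycles)
  have "(\<Sum>c\<leftarrow>cs. tour_cost w c) = length (concat cs)"
    unfolding length_concat by (intro arg_cong[where f = sum_list] map_cong refl tour_cost_light cs)
  moreover have "tour_cost w (concat ps) \<le> length (concat ps) + length ps" if "ps \<noteq> []"
    using that ps toursD[OF tours, of "concat ps"]
    by (intro tour_cost_concat_le) (simp_all add: out_cycles_def)
  ultimately have "(\<Sum>c\<leftarrow>?L. tour_cost w c) \<le> length (concat ?L) + length ps"
    by (simp add: out_cycles_def)
  also have "length (concat ?L) = card (\<Union>\<T>)"
    using tours distinct_card[of "concat ?L"] by (simp add: tours_def)
  finally show ?thesis by (simp add: cost_tours[OF tours])
qed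

theorem local_optimum_approximation:
  assumes "proper (mset_set (\<Union>\<T>)) (mset ps, mset cs)" "light_state (light V w) \<T> (mset ps, mset cs)"
    and "local_opt (light V w) \<T> 100 (mset ps, mset cs)"
  shows "9 * cost w (cyc_graph ` set (out_cycles ps cs)) \<le> 11 * opt V w \<T>"
proof -
  have tours: "tours (out_cycles ps cs)"
    using assms(1,2) by (intro tours_out_cycles) (auto simp: light_state_def)
  obtain \<C> where \<C>: "disjoint_cycles V \<T> \<C>" "respects_terminals \<T> \<C>" "cost w \<C> = opt V w \<T>"
    using smc_instance disjoint_cycles_tours[OF tours] respects_terminals_tours[OF tours]
    by (rule opt_attained)
  then interpret one_two_solution V w \<T> \<C> by unfold_locales
  have "9 * (card (\<Union>\<T>) + length ps) \<le> 11 * opt V w \<T>"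
    using local_optimum_bound[OF assms(1,3)] \<C>(3) by simp
  then show ?thesis using cost_out_cycles_le[OF assms(1,2)] by simp
qed

end

section \<open>The algorithm\<close>

abbreviation enc_lists :: "nat list list \<Rightarrow> tree" where
  "enc_lists \<equiv> enc_list (enc_list enc_nat)"

abbreviation terminals :: "nat list list \<Rightarrow> nat set set" where
  "terminals Ts \<equiv> set ` set Ts"

type_synonym list_state = "nat list list \<times> nat list list"

abbreviation enc_state :: "list_state \<Rightarrow> tree" where
  "enc_state \<equiv> enc_pair enc_lists enc_lists"

definition abs_state :: "list_state \<Rightarrow> nat state" where
  "abs_state s = (mset (fst s), mset (snd s))"

subsection \<open>Conditions and potential of list states\<close>

definition matrix_adj :: "nat list list \<Rightarrow> nat \<Rightarrow> nat \<Rightarrow> bool" where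
  "matrix_adj M u v \<longleftrightarrow> u < length M \<and> v < length (M ! u) \<and> M ! u ! v = 1"

lemma case_drop: "(case drop k xs of [] \<Rightarrow> False | y # _ \<Rightarrow> Q y) \<longleftrightarrow> k < length xs \<and> Q (xs ! k)"
  by (cases "k < length xs") (simp_all add: Cons_nth_drop_Suc[symmetric])

lemma polytime_matrix_adj [polytime_intros]:
  assumes "polytime ea enc_lists M" "polytime ea enc_nat u" "polytime ea enc_nat v"
  shows "polytime ea enc_bool (\<lambda>x. matrix_adj (M x) (u x) (v x))"
proof (rule polytime_comp3[OF _ assms])
  have "matrix_adj M u v \<longleftrightarrow> (case drop u M of [] \<Rightarrow> False | r # _ \<Rightarrow>
      (case drop v r of [] \<Rightarrow> False | a # _ \<Rightarrow> a = 1))" for M u v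
    by (simp add: matrix_adj_def case_drop)
  then show "polytime (enc_pair enc_lists (enc_pair enc_nat enc_nat)) enc_bool
      (\<lambda>p. matrix_adj (fst p) (fst (snd p)) (snd (snd p)))"
    by simp (rule polytime_intros)+
qed

definition joinable :: "nat list list \<Rightarrow> nat list \<Rightarrow> nat list \<Rightarrow> bool" where
  "joinable M P Q \<longleftrightarrow> P \<noteq> [] \<and> Q \<noteq> [] \<and> matrix_adj M (last P) (hd Q)"

lemma polytime_joinable [polytime_intros]:
  assumes "polytime ea enc_lists M" "polytime ea (enc_list enc_nat) P"
    "polytime ea (enc_list enc_nat) Q"
  shows "polytime ea enc_bool (\<lambda>x. joinable (M x) (P x) (Q x))"
proof (rule polytime_comp3[OF _ assms])
  have "joinable M P Q \<longleftrightarrow> (case rev P of [] \<Rightarrow> False | a # _ \<Rightarrow>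
      (case Q of [] \<Rightarrow> False | b # _ \<Rightarrow> matrix_adj M a b))" for M P Q
    by (cases P rule: rev_cases; cases Q) (auto simp: joinable_def)
  then show "polytime (enc_pair enc_lists (enc_pair (enc_list enc_nat) (enc_list enc_nat))) enc_bool
      (\<lambda>p. joinable (fst p) (fst (snd p)) (snd (snd p)))"
    by simp (rule polytime_intros)+
qed

lemma polytime_closed_wrt [polytime_intros]:
  assumes "polytime ea enc_lists Ts" "polytime ea (enc_list enc_nat) P"
  shows "polytime ea enc_bool (\<lambda>x. closed_wrt (terminals (Ts x)) (set (P x)))"
proof (rule polytime_comp2[OF _ assms])
  have "closed_wrt (terminals Ts) (set P) \<longleftrightarrow>
      list_all (\<lambda>T. list_all (\<lambda>v. v \<in> set P) T \<or> list_all (\<lambda>v. \<not> v \<in> set P) T) Ts" for Ts P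
    by (auto simp: closed_wrt_def list_all_iff)
  then show "polytime (enc_pair enc_lists (enc_list enc_nat)) enc_bool
      (\<lambda>p. closed_wrt (terminals (fst p)) (set (snd p)))"
    by simp (rule polytime_intros)+
qed

lemma unlocked_conv_filter:
  "unlocked \<T> P = length (filter (\<lambda>q. \<not> closed_wrt \<T> (set [fst q, snd q])) (zip P (tl P)))"
  by (induction \<T> P rule: unlocked.induct) auto

lemma polytime_unlocked [polytime_intros]:
  assumes "polytime ea enc_lists Ts" "polytime ea (enc_list enc_nat) P"
  shows "polytime ea enc_nat (\<lambda>x. unlocked (terminals (Ts x)) (P x))"
proof (rule polytime_comp2[OF _ assms])
  show "polytime (enc_pair enc_lists (enc_list enc_nat)) enc_nat
      (\<lambda>p. unlocked (terminals (fst p)) (snd p))"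
    unfolding unlocked_conv_filter by (rule polytime_intros)+
qed

lemma potential_conv_sum_list:
  "potential \<T> (abs_state s) =
    (\<Sum>P\<leftarrow>fst s. 200000 + path_weight \<T> P) + (\<Sum>c\<leftarrow>snd s. 1000 + unlocked \<T> c)"
  unfolding potential_def rest_weight_def abs_state_def fst_conv snd_conv mset_map[symmetric]
    sum_mset_sum_list
  by (simp add: sum_list_addf sum_list_triv)

lemma polytime_potential [polytime_intros]:
  assumes "polytime ea enc_lists Ts" "polytime ea enc_state s"
  shows "polytime ea enc_nat (\<lambda>x. potential (terminals (Ts x)) (abs_state (s x)))"
proof (rule polytime_comp2[OF _ assms])
  show "polytime (enc_pair enc_lists enc_state) enc_nat
      (\<lambda>p. potential (terminals (fst p)) (abs_state (snd p)))"
    unfolding potential_conv_sum_list path_weight_def by (rule polytime_intros)+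
qed

subsection \<open>Enumerating the moves\<close>

definition reversals :: "list_state \<Rightarrow> list_state list" where
  "reversals s = map (\<lambda>q. (rev (fst q) # snd q, snd s)) (picks (fst s))"

definition splittings :: "list_state \<Rightarrow> list_state list" where
  "splittings s = concat (map (\<lambda>q. map (\<lambda>r. (fst r # snd r # snd q, snd s))
     (filter (\<lambda>r. fst r \<noteq> [] \<and> snd r \<noteq> []) (splits (fst q)))) (picks (fst s)))"

definition joins :: "nat list list \<Rightarrow> list_state \<Rightarrow> list_state list" where
  "joins M s = concat (map (\<lambda>q. map (\<lambda>r. ((fst q @ fst r) # snd r, snd s))
     (filter (\<lambda>r. joinable M (fst q) (fst r)) (picks (snd q)))) (picks (fst s)))"

definition closings :: "list_state \<Rightarrow> list_state \<Rightarrow> list_state list" where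
  "closings E s = map (\<lambda>q. (snd q, fst q # snd s))
     (filter (\<lambda>q. joinable (fst E) (fst q) (fst q) \<and> closed_wrt (terminals (snd E)) (set (fst q)))
       (picks (fst s)))"

definition unclosings :: "list_state \<Rightarrow> list_state list" where
  "unclosings s = concat (map (\<lambda>q. map (\<lambda>r. ((snd r @ fst r) # fst s, snd q)) (splits (fst q)))
     (filter (\<lambda>q. fst q \<noteq> []) (picks (snd s))))"

text \<open>The instance is passed around as the pair \<open>E\<close> of the weight matrix and the list of terminal sets.\<close>

definition nbrs :: "list_state \<Rightarrow> list_state \<Rightarrow> list_state list" where
  "nbrs E s = s # reversals s @ splittings s @ joins (fst E) s @ closings E s @ unclosings s"

lemma polytime_nbrs [polytime_intros]:
  assumes "polytime ea enc_state E" "polytime ea enc_state s"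
  shows "polytime ea (enc_list enc_state) (\<lambda>x. nbrs (E x) (s x))"
proof (rule polytime_comp2[OF _ assms])
  show "polytime (enc_pair enc_state enc_state) (enc_list enc_state) (\<lambda>p. nbrs (fst p) (snd p))"
    unfolding nbrs_def reversals_def splittings_def joins_def closings_def unclosings_def
    by (rule polytime_intros)+
qed

lemma set_reversals: "set (reversals s) = {(rev P # R, snd s) | P R. (P, R) \<in> set (picks (fst s))}"
  by (force simp: reversals_def)

lemma set_splittings: "set (splittings s) =
    {(A # B # R, snd s) | A B R. A \<noteq> [] \<and> B \<noteq> [] \<and> (A @ B, R) \<in> set (picks (fst s))}"
  by (force simp: splittings_def set_splits)

lemma set_joins: "set (joins M s) = {((A @ B) # R, snd s) | A B R Q.
    joinable M A B \<and> (A, Q) \<in> set (picks (fst s)) \<and> (B, R) \<in> set (picks Q)}"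
  by (force simp: joins_def)

lemma set_closings: "set (closings E s) = {(R, P # snd s) | P R. joinable (fst E) P P \<and>
    closed_wrt (terminals (snd E)) (set P) \<and> (P, R) \<in> set (picks (fst s))}"
  by (force simp: closings_def)

lemma set_unclosings: "set (unclosings s) = {((B @ A) # fst s, R) | A B R.
    A @ B \<noteq> [] \<and> (A @ B, R) \<in> set (picks (snd s))}"
  by (force simp: unclosings_def set_splits)

lemma set_nbrs: "set (nbrs E s) = {s} \<union> set (reversals s) \<union> set (splittings s) \<union>
    set (joins (fst E) s) \<union> set (closings E s) \<union> set (unclosings s)"
  by (auto simp: nbrs_def)

lemma move_if_mem_nbrs:
  assumes "t \<in> set (nbrs E s)"
  shows "move (matrix_adj (fst E)) (terminals (snd E)) (abs_state s) (abs_state t)"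
  using assms unfolding set_nbrs
proof (elim UnE)
  assume "t \<in> set (reversals s)"
  then show ?thesis
    by (auto simp: set_reversals abs_state_def dest!: mset_picks intro: move.reverse)
next
  assume "t \<in> set (splittings s)"
  then show ?thesis by (auto simp: set_splittings abs_state_def dest!: mset_picks intro: move.split)
next
  assume "t \<in> set (joins (fst E) s)"
  then show ?thesis
    by (auto simp: set_joins joinable_def abs_state_def dest!: mset_picks intro: move.join)
next
  assume "t \<in> set (closings E s)"
  then show ?thesis
    by (auto simp: set_closings joinable_def abs_state_def dest!: mset_picks intro: move.close)
next
  assume "t \<in> set (unclosings s)"
  then obtain A B R where "A @ B \<noteq> []" "(A @ B, R) \<in> set (picks (snd s))" "t = ((B @ A) # fst s, R)"
    unfolding set_unclosings by blast
  then show ?thesis using move.unclose[of A B] by (simp add: abs_state_def mset_picks)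
qed (simp add: move.stay)

lemma mem_nbrs_if_move:
  assumes "move (matrix_adj (fst E)) (terminals (snd E)) (abs_state s) S"
  shows "S \<in> abs_state ` set (nbrs E s)"
  using assms
proof cases
  case stay
  then show ?thesis by (auto simp: set_nbrs)
next
  case (reverse P R C)
  then obtain ys where "(P, ys) \<in> set (picks (fst s))" "mset ys = R"
    by (auto simp: abs_state_def elim: picks_complete)
  then have "(rev P # ys, snd s) \<in> set (nbrs E s)" by (auto simp: set_nbrs set_reversals)
  then show ?thesis by (rule rev_image_eqI) (use reverse \<open>mset ys = R\<close> in \<open>simp add: abs_state_def\<close>)
next
  case (split A B R C)
  then obtain ys where "(A @ B, ys) \<in> set (picks (fst s))" "mset ys = R"
    by (auto simp: abs_state_def elim: picks_complete)
  with split have "(A # B # ys, snd s) \<in> set (nbrs E s)" by (auto simp: set_nbrs set_splittings)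
  then show ?thesis by (rule rev_image_eqI) (use split \<open>mset ys = R\<close> in \<open>simp add: abs_state_def\<close>)
next
  case (join A B R C)
  then obtain ys where ys: "(A, ys) \<in> set (picks (fst s))" "mset ys = add_mset B R"
    by (auto simp: abs_state_def elim: picks_complete)
  from ys(2) obtain zs where "(B, zs) \<in> set (picks ys)" "mset zs = R" by (rule picks_complete)
  with join ys(1) have "((A @ B) # zs, snd s) \<in> set (nbrs E s)"
    unfolding set_nbrs set_joins joinable_def by blast
  then show ?thesis by (rule rev_image_eqI) (use join \<open>mset zs = R\<close> in \<open>simp add: abs_state_def\<close>)
next
  case (close P R C)
  then obtain ys where "(P, ys) \<in> set (picks (fst s))" "mset ys = R"
    by (auto simp: abs_state_def elim: picks_complete)
  with close have "(ys, P # snd s) \<in> set (nbrs E s)"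
    by (auto simp: set_nbrs set_closings joinable_def)
  then show ?thesis by (rule rev_image_eqI) (use close \<open>mset ys = R\<close> in \<open>simp add: abs_state_def\<close>)
next
  case (unclose A B R C)
  then obtain ys where "(A @ B, ys) \<in> set (picks (snd s))" "mset ys = C"
    by (auto simp: abs_state_def elim: picks_complete)
  with unclose have "((B @ A) # fst s, ys) \<in> set (nbrs E s)"
    unfolding set_nbrs set_unclosings by blast
  then show ?thesis by (rule rev_image_eqI) (use unclose \<open>mset ys = C\<close> in \<open>simp add: abs_state_def\<close>)
qed

abbreviation reachable :: "list_state \<Rightarrow> nat \<Rightarrow> list_state \<Rightarrow> nat state \<Rightarrow> bool" where
  "reachable E n s \<equiv> reach (matrix_adj (fst E)) (terminals (snd E)) n (abs_state s)"

primrec reach_list :: "nat \<Rightarrow> list_state \<Rightarrow> list_state \<Rightarrow> list_state list" where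
  "reach_list 0 E s = [s]"
| "reach_list (Suc n) E s = concat (map (nbrs E) (reach_list n E s))"

lemma polytime_reach_list [polytime_intros]:
  assumes "polytime ea enc_state E" "polytime ea enc_state s"
  shows "polytime ea (enc_list enc_state) (\<lambda>x. reach_list n (E x) (s x))"
proof (rule polytime_comp2[OF _ assms])
  show "polytime (enc_pair enc_state enc_state) (enc_list enc_state)
      (\<lambda>p. reach_list n (fst p) (snd p))"
  proof (induction n)
    case 0
    show ?case unfolding reach_list.simps by (rule polytime_intros)+
  next
    case (Suc n)
    show ?case unfolding reach_list.simps by (rule polytime_intros Suc)+
  qed
qed

lemma set_reach_list: "S \<in> abs_state ` set (reach_list n E s) \<longleftrightarrow> reachable E n s S"
proof (induction n arbitrary: S)
  case (Suc n)
  have "S \<in> abs_state ` set (reach_list (Suc n) E s) \<longleftrightarrow>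
      (\<exists>t\<in>set (reach_list n E s). S \<in> abs_state ` set (nbrs E t))" by auto
  also have "\<dots> \<longleftrightarrow> (\<exists>S1\<in>abs_state ` set (reach_list n E s).
      move (matrix_adj (fst E)) (terminals (snd E)) S1 S)"
    using move_if_mem_nbrs mem_nbrs_if_move by blast
  finally show ?case unfolding reach_Suc using Suc.IH by blast
qed (simp add: reach_0)

subsection \<open>The search for a local optimum\<close>

abbreviation state_potential :: "list_state \<Rightarrow> list_state \<Rightarrow> nat" where
  "state_potential E s \<equiv> potential (terminals (snd E)) (abs_state s)"

abbreviation optimal_state :: "list_state \<Rightarrow> list_state \<Rightarrow> bool" where
  "optimal_state E s \<equiv> local_opt (matrix_adj (fst E)) (terminals (snd E)) 100 (abs_state s)"

definition improve :: "list_state \<Rightarrow> list_state \<Rightarrow> list_state" where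
  "improve E s = (case filter (\<lambda>t. state_potential E t < state_potential E s) (reach_list 100 E s)
      of
     [] \<Rightarrow> s | t # _ \<Rightarrow> t)"

definition start :: "nat list list \<Rightarrow> list_state" where
  "start Ts = (map (\<lambda>v. [v]) (concat Ts), [])"

definition search :: "list_state \<Rightarrow> list_state" where
  "search E = (improve E ^^ state_potential E (start (snd E))) (start (snd E))"

lemma improve_cases:
  obtains (optimal) "improve E s = s" "optimal_state E s"
  | (better) "reachable E 100 s (abs_state (improve E s))"
    "state_potential E (improve E s) < state_potential E s"
proof -
  let ?better = "filter (\<lambda>t. state_potential E t < state_potential E s) (reach_list 100 E s)"
  show ?thesis
  proof (cases ?better)
    case Nil
    then have "state_potential E s \<le> potential (terminals (snd E)) S"
      if "S \<in> abs_state ` set (reach_list 100 E s)" for S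
      using that by (auto simp: filter_empty_conv not_less)
    then show ?thesis using optimal Nil by (simp add: set_reach_list local_opt_def improve_def)
  next
    case (Cons t ts)
    then have "t \<in> set ?better" by simp
    then have "abs_state t \<in> abs_state ` set (reach_list 100 E s)"
      "state_potential E t < state_potential E s" by auto
    moreover have "improve E s = t" using Cons by (simp add: improve_def)
    ultimately show ?thesis using better unfolding set_reach_list by simp
  qed
qed

lemma reachable_funpow_improve: "reachable E (100 * k) s (abs_state ((improve E ^^ k) s))"
proof (induction k)
  case (Suc k)
  let ?s = "(improve E ^^ k) s"
  have "reachable E 100 ?s (abs_state (improve E ?s))"
    by (cases rule: improve_cases[of E ?s]) (simp_all add: reach_refl)
  from reach_trans[OF Suc this] show ?case by (simp add: add.commute)
qed (simp add: reach_refl)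

lemma optimal_state_funpow_improve:
  assumes "state_potential E s \<le> k"
  shows "optimal_state E ((improve E ^^ k) s)"
proof -
  have "optimal_state E ((improve E ^^ k) s) \<or>
      state_potential E ((improve E ^^ k) s) + k \<le> state_potential E s" for k
  proof (induction k)
    case (Suc k)
    let ?s = "(improve E ^^ k) s"
    show ?case
    proof (cases rule: improve_cases[of E ?s])
      case better
      then have "\<not> optimal_state E ?s" unfolding local_opt_def using not_le by blast
      with Suc better(2) show ?thesis by simp
    qed simp
  qed simp
  from this[of k] assms
  have "optimal_state E ((improve E ^^ k) s) \<or> state_potential E ((improve E ^^ k) s) = 0"
    by linarith
  then show ?thesis by (auto simp: local_opt_def)
qed

lemma optimal_state_search: "optimal_state E (search E)"
  unfolding search_def by (rule optimal_state_funpow_improve) simp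

lemma proper_start: "proper (mset (concat Ts)) (abs_state (start Ts))"
proof -
  have "(\<Sum>P\<in>#image_mset (\<lambda>v. [v]) X. mset P) = X" for X :: "nat multiset" by (induction X) auto
  then show ?thesis by (auto simp: proper_def start_def abs_state_def vertices_def)
qed

lemma light_state_start: "light_state adj \<T> (abs_state (start Ts))"
  by (auto simp: light_state_def start_def abs_state_def)

lemma size_enc_lists_nonempty:
  "[] \<notin> set ps \<Longrightarrow> size (enc_lists ps) \<le> 2 * size (enc_list enc_nat (concat ps))"
proof (induction ps)
  case (Cons P ps)
  then have "1 \<le> size (enc_list enc_nat P)" by (cases P) auto
  with Cons show ?case by (simp add: size_enc_list_append)
qed simp

lemma size_enc_state_proper:
  assumes "proper (mset (concat Ts)) (abs_state s)"
  shows "size (enc_state s) \<le> 2 * size (enc_lists Ts) + 1"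
proof -
  let ?vs = "concat (fst s) @ concat (snd s)"
  have "mset ?vs = mset (concat Ts)"
    using assms by (simp add: proper_def abs_state_def vertices_mset)
  then have "size (enc_list enc_nat ?vs) = size (enc_list enc_nat (concat Ts))"
    unfolding size_enc_list_mset by (rule arg_cong)
  moreover have "size (enc_lists (fst s)) \<le> 2 * size (enc_list enc_nat (concat (fst s)))"
    "size (enc_lists (snd s)) \<le> 2 * size (enc_list enc_nat (concat (snd s)))"
    using assms by (auto intro!: size_enc_lists_nonempty simp: proper_def abs_state_def)
  moreover have "size (enc_list enc_nat (concat Ts)) \<le> size (enc_lists Ts)"
    by (rule size_enc_list_concat)
  ultimately show ?thesis by (simp add: enc_pair_conv size_enc_list_append)
qed

lemma polytime_improve [polytime_intros]:
  assumes "polytime ea enc_state E" "polytime ea enc_state s"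
  shows "polytime ea enc_state (\<lambda>x. improve (E x) (s x))"
proof (rule polytime_comp2[OF _ assms])
  show "polytime (enc_pair enc_state enc_state) enc_state (\<lambda>p. improve (fst p) (snd p))"
    unfolding improve_def by (rule polytime_intros)+
qed

lemma polytime_start [polytime_intros]:
  assumes "polytime ea enc_lists Ts"
  shows "polytime ea enc_state (\<lambda>x. start (Ts x))"
  unfolding start_def by (rule polytime_intros assms)+

lemma polytime_search [polytime_intros]:
  assumes "polytime ea enc_state E"
  shows "polytime ea enc_state (\<lambda>x. search (E x))"
  using assms
proof (rule polytime_comp)
  show "polytime enc_state enc_state search"
    unfolding search_def
  proof (rule polytime_funpow[where B = "[:1, 2:]"])
    fix E k
    have "proper (mset (concat (snd E))) (abs_state ((improve E ^^ k) (start (snd E))))"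
      using proper_start reachable_funpow_improve by (rule proper_reach)
    from size_enc_state_proper[OF this]
    show "size (enc_state ((improve E ^^ k) (start (snd E)))) \<le> poly [:1, 2:] (size (enc_state E))"
      by (simp add: enc_pair_conv)
  qed (rule polytime_intros)+
qed

subsection \<open>The output\<close>

definition cyc_edges :: "nat list \<Rightarrow> edge_code list" where
  "cyc_edges c = map (\<lambda>i. (c ! i, c ! (Suc i mod length c), length c = 2 \<and> i = 1)) [0..<length c]"

lemma map_edge_of_cyc_edges: "map edge_of (cyc_edges c) = map (cyc_edge c) [0..<length c]"
  by (simp add: cyc_edges_def cyc_edge_def edge_of_def)

lemma cyc_edges_conv_zip:
  "cyc_edges c = (case rev c of [] \<Rightarrow> [] | z # _ \<Rightarrow> (case c of [] \<Rightarrow> [] | x # _ \<Rightarrow>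
     map (\<lambda>q. (fst q, snd q, False)) (zip c (tl c)) @ [(z, x, length c = 2)]))"
proof (cases "c = []")
  case False
  then obtain m where m: "length c = Suc m" by (cases c) auto
  have "cyc_edges c =
      map (\<lambda>q. (fst q, snd q, False)) (zip c (tl c)) @ [(last c, hd c, length c = 2)]"
  proof (rule nth_equalityI)
    fix i assume "i < length (cyc_edges c)"
    then have "i < m \<or> i = m" using m by (auto simp: cyc_edges_def)
    then show "cyc_edges c ! i =
        (map (\<lambda>q. (fst q, snd q, False)) (zip c (tl c)) @ [(last c, hd c, length c = 2)]) ! i"
      using m False by (auto simp: cyc_edges_def nth_append nth_tl last_conv_nth hd_conv_nth)
  qed (simp add: cyc_edges_def m)
  then show ?thesis using False by (simp add: list.case_eq_if hd_rev)
qed (simp add: cyc_edges_def)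

lemma enc_edge_conv: "enc_edge = enc_pair enc_nat (enc_pair enc_nat enc_bool)"
  by (auto simp: enc_edge_def fun_eq_iff)

lemma enc_cycle_conv: "enc_cycle = enc_pair (enc_list enc_nat) (enc_list enc_edge)"
  by (auto simp: enc_cycle_def fun_eq_iff)

lemma polytime_cyc_edges [polytime_intros]:
  assumes "polytime ea (enc_list enc_nat) f"
  shows "polytime ea (enc_list enc_edge) (\<lambda>x. cyc_edges (f x))"
  using assms
proof (rule polytime_comp)
  show "polytime (enc_list enc_nat) (enc_list enc_edge) cyc_edges"
    unfolding cyc_edges_conv_zip enc_edge_conv by (rule polytime_intros)+
qed

definition algorithm :: "list_state \<Rightarrow> cycle_code list" where
  "algorithm E = map (\<lambda>c. (c, cyc_edges c)) (out_cycles (fst (search E)) (snd (search E)))"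

lemma polytime_algorithm: "polytime enc_state (enc_list enc_cycle) algorithm"
  unfolding algorithm_def out_cycles_def enc_cycle_conv by (rule polytime_intros)+

lemma represents_cyc_graphs:
  assumes "distinct L" "inj_on cyc_graph (set L)" "\<And>c. c \<in> set L \<Longrightarrow> distinct c \<and> 2 \<le> length c"
  shows "represents_cycles (enc_list enc_cycle (map (\<lambda>c. (c, cyc_edges c)) L)) (cyc_graph ` set L)"
  unfolding represents_cycles_def
proof (intro exI conjI)
  let ?Cs = "map (\<lambda>c. (c, cyc_edges c)) L"
  have "cycle_of (c, cyc_edges c) = cyc_graph c" for c
    by (simp only: cycle_of_def cyc_graph_def prod.case map_edge_of_cyc_edges)
      (simp add: atLeast0LessThan)
  then have "map cycle_of ?Cs = map cyc_graph L" by simp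
  then show "distinct (map cycle_of ?Cs)" "set (map cycle_of ?Cs) = cyc_graph ` set L"
    using assms(1,2) by (simp_all only: distinct_map set_map simp_thms)
  have "distinct (map edge_of (cyc_edges c))" if "c \<in> set L" for c
    unfolding map_edge_of_cyc_edges using inj_on_cyc_edge[of c] assms(3)[OF that]
    by (simp add: distinct_map atLeast0LessThan)
  then show "\<forall>(vs, es)\<in>set ?Cs. distinct vs \<and> distinct (map edge_of es)"
    using assms(3) by auto
qed (rule refl)

definition matrix :: "nat \<Rightarrow> (nat set \<Rightarrow> nat) \<Rightarrow> nat list list" where
  "matrix n w = map (\<lambda>i. map (\<lambda>j. if i = j then 0 else w {i, j}) [0..<n]) [0..<n]"

lemma enc_instance_conv: "enc_instance n w Ts = enc_state (matrix n w, Ts)"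
  by (simp add: enc_instance_def enc_matrix_def matrix_def enc_list_map)

lemma matrix_adj_matrix: "matrix_adj (matrix n w) = light {..<n} w"
  by (auto simp: fun_eq_iff matrix_adj_def matrix_def light_def split: if_splits)

lemma mset_concat_terminals:
  assumes "smc_instance V \<T>" "lists_terminals Ts \<T>"
  shows "mset (concat Ts) = mset_set (\<Union>\<T>)"
proof -
  have Ts: "distinct (map set Ts)" "\<And>T. T \<in> set Ts \<Longrightarrow> distinct T" "\<T> = terminals Ts"
    using assms(2) by (auto simp: lists_terminals_def)
  have "2 \<le> card (set T)" if "T \<in> set Ts" for T
    using assms(1) that unfolding Ts(3) smc_instance_def by blast
  then have "[] \<notin> set Ts" by force
  moreover have "set S \<inter> set T = {}" if "S \<in> set Ts" "T \<in> set Ts" "S \<noteq> T" for S T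
  proof -
    have "set S \<noteq> set T" using that Ts(1) by (auto simp: distinct_map inj_on_def)
    then show ?thesis using assms(1) that unfolding Ts(3) smc_instance_def disjoint_def by blast
  qed
  ultimately have "distinct (concat Ts)"
    using Ts(1,2) by (auto simp: distinct_concat_iff distinct_map removeAll_id)
  moreover have "set (concat Ts) = \<Union>\<T>" using Ts(3) by simp
  ultimately show ?thesis by (metis mset_set_set)
qed

lemma algorithm_correct:
  assumes "smc_instance {..<n} \<T>" "\<forall>e\<in>complete_edges {..<n}. w e \<in> {1, 2}" "lists_terminals Ts \<T>"
  obtains \<C> where "represents_cycles (enc_list enc_cycle (algorithm (matrix n w, Ts))) \<C>"
    "disjoint_cycles {..<n} \<T> \<C>" "respects_terminals \<T> \<C>" "9 * cost w \<C> \<le> 11 * opt {..<n} w \<T>"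
proof -
  interpret one_two_instance "{..<n}" w \<T> using assms(1,2) by unfold_locales auto
  let ?E = "(matrix n w, Ts)"
  let ?ps = "fst (search ?E)" and ?cs = "snd (search ?E)"
  have instance_eq: "matrix_adj (fst ?E) = light {..<n} w" "terminals (snd ?E) = \<T>"
    using assms(3) by (simp_all add: matrix_adj_matrix lists_terminals_def)
  obtain k where k: "reach (light {..<n} w) \<T> k (abs_state (start Ts)) (abs_state (search ?E))"
    using reachable_funpow_improve[of ?E _ "start Ts"] unfolding instance_eq search_def by force
  have proper: "proper (mset_set (\<Union>\<T>)) (mset ?ps, mset ?cs)"
    using proper_reach[OF proper_start k] mset_concat_terminals[OF assms(1,3)]
    by (simp add: abs_state_def)
  have light: "light_state (light {..<n} w) \<T> (mset ?ps, mset ?cs)"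
    using light_state_reach[OF light_sym light_state_start k] by (simp add: abs_state_def)
  have optimal: "local_opt (light {..<n} w) \<T> 100 (mset ?ps, mset ?cs)"
    using optimal_state_search[of ?E] unfolding instance_eq by (simp add: abs_state_def)
  have tours: "tours (out_cycles ?ps ?cs)"
    using proper light by (intro tours_out_cycles) (auto simp: light_state_def)
  show ?thesis
  proof (rule that)
    show "represents_cycles (enc_list enc_cycle (algorithm ?E))
        (cyc_graph ` set (out_cycles ?ps ?cs))"
      unfolding algorithm_def using tours
      by (intro represents_cyc_graphs distinct_tours inj_on_cyc_graph) (auto dest: toursD)
    show "9 * cost w (cyc_graph ` set (out_cycles ?ps ?cs)) \<le> 11 * opt {..<n} w \<T>"
      using proper light optimal by (rule local_optimum_approximation)
  qed (fact disjoint_cycles_tours[OF tours] respects_terminals_tours[OF tours])+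
qed

theorem theorem2:
  "\<exists>(P :: com) (p :: nat poly). \<forall>(n :: nat) (w :: nat set \<Rightarrow> nat) (\<T> :: nat set set) (Ts :: nat list list).
     smc_instance {..<n} \<T> \<longrightarrow>
     (\<forall>e\<in>complete_edges {..<n}. w e \<in> {1, 2}) \<longrightarrow>
     lists_terminals Ts \<T> \<longrightarrow>
     (\<exists>y \<C>. outputs_within P (enc_instance n w Ts) (poly p (size (enc_instance n w Ts))) y \<and>
        represents_cycles y \<C> \<and>
        disjoint_cycles {..<n} \<T> \<C> \<and>
        respects_terminals \<T> \<C> \<and>
        real (cost w \<C>) \<le> 11 / 9 * real (opt {..<n} w \<T>))"
proof -
  obtain P p where P: "outputs_within P (enc_state E) (poly p (size (enc_state E)))
      (enc_list enc_cycle (algorithm E))" for E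
    using polytime_algorithm by (rule polytime_outputs_within) blast
  show ?thesis
  proof (rule exI[of _ P], rule exI[of _ p], intro allI impI)
    fix n and w :: "nat set \<Rightarrow> nat" and \<T> Ts
    assume "smc_instance {..<n} \<T>" "\<forall>e\<in>complete_edges {..<n}. w e \<in> {1, 2}" "lists_terminals Ts \<T>"
    then obtain \<C> where \<C>: "represents_cycles (enc_list enc_cycle (algorithm (matrix n w, Ts))) \<C>"
      "disjoint_cycles {..<n} \<T> \<C>" "respects_terminals \<T> \<C>" "9 * cost w \<C> \<le> 11 * opt {..<n} w \<T>"
      by (rule algorithm_correct)
    have "real (9 * cost w \<C>) \<le> real (11 * opt {..<n} w \<T>)" using \<C>(4) by (simp only: of_nat_le_iff)
    then have "real (cost w \<C>) \<le> 11 / 9 * real (opt {..<n} w \<T>)" by simp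
    with \<C>(1-3) P[of "(matrix n w, Ts)"]
    show "\<exists>y \<C>. outputs_within P (enc_instance n w Ts) (poly p (size (enc_instance n w Ts))) y \<and>
        represents_cycles y \<C> \<and> disjoint_cycles {..<n} \<T> \<C> \<and> respects_terminals \<T> \<C> \<and>
        real (cost w \<C>) \<le> 11 / 9 * real (opt {..<n} w \<T>)"
      unfolding enc_instance_conv by blast
  qed
qed

end
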